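(* Let $\mathcal{G}=\langle a,b,c\rangle\le \mathrm{Aut}(\{0,1\}^* )$ be the group of automorphisms of the binary rooted tree generated by $a=(1,1)\sigma$, $b=(a,c)$, $c=(b,1)$ (this is the iterated monodromy group $\mathrm{IMG}(z^2+\mathrm{i})$). Then $\mathcal{G}$ embeds into the finitely presented group $$\tilde{\mathcal{G}}=\langle a,b,c,s\mid a^2,\ (ac)^4,\ [c,ab]^2,\ [c,bab]^2,\ [c,ababa]^2,\ [c,ababab]^2,\ [c,bababab]^2,\ a^s=b,\ b^s=c,\ c^s=aba\rangle,$$ and $\tilde{\mathcal{G}}$ is amenable, has exponential growth, and is an ascending HNN-extension of $\mathcal{G}$.
   Context: Let $X=\{0,1\}$; the set $X^*$ of finite words over $X$ is the binary rooted tree. Every tree automorphism $g$ is written uniquely as $g=(g|_0,g|_1)\sigma_g$, where $\sigma_g\in\mathrm{Sym}(2)$ is the permutation of $X$ induced by $g$ and $g|_x\in\mathrm{Aut}(X^* )$ is determined by $g(xw)=\sigma_g(x)\,g|_x(w)$ for all $w\in X^*$. Products are defined by $gh(w)=h(g(w))$, so $gh=(g|_0h|_{\sigma_g(0)},\,g|_1h|_{\sigma_g(1)})\sigma_g\sigma_h$. The nontrivial element of $\mathrm{Sym}(2)$ is denoted $\sigma$. Notation: $[g,h]=g^{-1}h^{-1}gh$ and $g^s=s^{-1}gs$. An ascending HNN-extension of a group $G$ is a group $\langle G,s\mid s^{-1}gs=\theta(g),\ g\in G\rangle$ for an injective endomorphism $\theta\colon G\to G$; here $\theta$ is the endomorphism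 of $\mathcal{G}$ induced by $a\mapsto b$, $b\mapsto c$, $c\mapsto aba$, and $s$ is the stable letter. *)

theory Defs
  imports Complex_Main "HOL-Algebra.Elementary_Groups"
begin

section \<open>Automorphisms of the binary rooted tree\<close>

text \<open>Vertices are words over \<^typ>\<open>bool\<close>; the letter 0 is \<^const>\<open>False\<close>, the letter 1 is \<^const>\<open>True\<close>.\<close>

type_synonym vertex = "bool list"

definition child :: "vertex \<Rightarrow> vertex \<Rightarrow> bool" where
  "child v w \<longleftrightarrow> (\<exists>x. w = v @ [x])"

definition tree_automorphism :: "(vertex \<Rightarrow> vertex) \<Rightarrow> bool" where
  "tree_automorphism g \<longleftrightarrow>
     bij g \<and> g [] = [] \<and> (\<forall>v w. child (g v) (g w) \<longleftrightarrow> child v w)"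

text \<open>Products are read from left to right: \<open>(gh)(w) = h(g(w))\<close>.\<close>

definition tree_aut_group :: "(vertex \<Rightarrow> vertex) monoid" where
  "tree_aut_group = \<lparr>carrier = {g. tree_automorphism g}, mult = (\<lambda>g h. h \<circ> g), one = id\<rparr>"

text \<open>\<open>wreath g0 g1 p\<close> is the automorphism written \<open>(g0, g1) p\<close>, with \<open>p\<close> acting on the first level.\<close>

fun wreath :: "(vertex \<Rightarrow> vertex) \<Rightarrow> (vertex \<Rightarrow> vertex) \<Rightarrow> (bool \<Rightarrow> bool) \<Rightarrow> vertex \<Rightarrow> vertex" where
  "wreath g0 g1 p [] = []"
| "wreath g0 g1 p (x # w) = p x # (if x then g1 w else g0 w)"

definition img_a :: "vertex \<Rightarrow> vertex" where
  "img_a = wreath id id Not"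

text \<open>The equations \<open>b = (a, c)\<close> and \<open>c = (b, 1)\<close>, by recursion on the vertex; they are
  restated with \<^const>\<open>wreath\<close> below.\<close>

fun img_b :: "vertex \<Rightarrow> vertex" and img_c :: "vertex \<Rightarrow> vertex" where
  "img_b [] = []"
| "img_b (x # w) = x # (if x then img_c w else img_a w)"
| "img_c [] = []"
| "img_c (x # w) = x # (if x then w else img_b w)"

lemma img_b_wreath: "img_b = wreath img_a img_c id"
proof
  show "img_b w = wreath img_a img_c id w" for w by (cases w) auto
qed

lemma img_c_wreath: "img_c = wreath img_b id id"
proof
  show "img_c w = wreath img_b id id w" for w by (cases w) auto
qed

definition img_group :: "(vertex \<Rightarrow> vertex) monoid" where
  "img_group = subgroup_generated tree_aut_group {img_a, img_b, img_c}"


section \<open>Groups given by generators and relations\<close>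

text \<open>The letters \<open>(x, True)\<close> and \<open>(x, False)\<close> stand for \<open>x\<close> and its formal inverse. A relation
  is a pair \<open>(u, v)\<close>, read \<open>u = v\<close>; a relator \<open>r\<close> is the relation \<open>(r, [])\<close>.\<close>

type_synonym 'g gword = "('g \<times> bool) list"

definition gletter :: "'g \<Rightarrow> 'g gword" where
  "gletter x = [(x, True)]"

definition winv :: "'g gword \<Rightarrow> 'g gword" where
  "winv w = rev (map (\<lambda>(x, e). (x, \<not> e)) w)"

definition wpow :: "'g gword \<Rightarrow> nat \<Rightarrow> 'g gword" where
  "wpow w n = concat (replicate n w)"

definition wconj :: "'g gword \<Rightarrow> 'g gword \<Rightarrow> 'g gword" where
  "wconj g s = winv s @ g @ s"

definition wcomm :: "'g gword \<Rightarrow> 'g gword \<Rightarrow> 'g gword" where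
  "wcomm g h = winv g @ winv h @ g @ h"

definition gwords :: "'g set \<Rightarrow> 'g gword set" where
  "gwords S = lists (S \<times> UNIV)"

inductive_set pres_rel :: "'g set \<Rightarrow> ('g gword \<times> 'g gword) set \<Rightarrow> ('g gword \<times> 'g gword) set"
  for S :: "'g set" and R :: "('g gword \<times> 'g gword) set" where
  refl: "u \<in> gwords S \<Longrightarrow> (u, u) \<in> pres_rel S R"
| sym: "(u, v) \<in> pres_rel S R \<Longrightarrow> (v, u) \<in> pres_rel S R"
| trans: "(u, v) \<in> pres_rel S R \<Longrightarrow> (v, w) \<in> pres_rel S R \<Longrightarrow> (u, w) \<in> pres_rel S R"
| cancel: "u \<in> gwords S \<Longrightarrow> v \<in> gwords S \<Longrightarrow> x \<in> S \<Longrightarrow>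
    (u @ [(x, e), (x, \<not> e)] @ v, u @ v) \<in> pres_rel S R"
| relation: "u \<in> gwords S \<Longrightarrow> v \<in> gwords S \<Longrightarrow> p \<in> gwords S \<Longrightarrow> q \<in> gwords S \<Longrightarrow> (p, q) \<in> R \<Longrightarrow>
    (u @ p @ v, u @ q @ v) \<in> pres_rel S R"

definition pres_class :: "'g set \<Rightarrow> ('g gword \<times> 'g gword) set \<Rightarrow> 'g gword \<Rightarrow> 'g gword set" where
  "pres_class S R w = pres_rel S R `` {w}"

definition presented_group :: "'g set \<Rightarrow> ('g gword \<times> 'g gword) set \<Rightarrow> 'g gword set monoid" where
  "presented_group S R =
     \<lparr>carrier = gwords S // pres_rel S R,
      mult = (\<lambda>A B. \<Union>u\<in>A. \<Union>v\<in>B. pres_class S R (u @ v)),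
      one = pres_class S R []\<rparr>"

text \<open>A finite generating set can always be taken to consist of natural numbers.\<close>

definition finitely_presented :: "('a, 'b) monoid_scheme \<Rightarrow> bool" where
  "finitely_presented G \<longleftrightarrow>
     (\<exists>(S :: nat set) R. finite S \<and> finite R \<and> R \<subseteq> gwords S \<times> gwords S \<and> presented_group S R \<cong> G)"


section \<open>Amenability and growth of discrete groups\<close>

definition amenable :: "('a, 'b) monoid_scheme \<Rightarrow> bool" where
  "amenable G \<longleftrightarrow> group G \<and>
     (\<exists>\<mu> :: 'a set \<Rightarrow> real.
        (\<forall>A. A \<subseteq> carrier G \<longrightarrow> 0 \<le> \<mu> A) \<and>
        \<mu> (carrier G) = 1 \<and>
        (\<forall>A B. A \<subseteq> carrier G \<longrightarrow> B \<subseteq> carrier G \<longrightarrow> A \<inter> B = {} \<longrightarrow> \<mu> (A \<union> B) = \<mu> A + \<mu> B) \<and>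
        (\<forall>g \<in> carrier G. \<forall>A. A \<subseteq> carrier G \<longrightarrow> \<mu> (g <#\<^bsub>G\<^esub> A) = \<mu> A))"

definition word_ball :: "('a, 'b) monoid_scheme \<Rightarrow> 'a set \<Rightarrow> nat \<Rightarrow> 'a set" where
  "word_ball G S n =
     {foldr (\<lambda>x y. x \<otimes>\<^bsub>G\<^esub> y) xs \<one>\<^bsub>G\<^esub> | xs. set xs \<subseteq> S \<union> m_inv G ` S \<and> length xs \<le> n}"

definition finite_generating_set :: "('a, 'b) monoid_scheme \<Rightarrow> 'a set \<Rightarrow> bool" where
  "finite_generating_set G S \<longleftrightarrow> finite S \<and> S \<subseteq> carrier G \<and> generate G S = carrier G"

definition exponential_growth :: "('a, 'b) monoid_scheme \<Rightarrow> bool" where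
  "exponential_growth G \<longleftrightarrow> group G \<and> (\<exists>S. finite_generating_set G S) \<and>
     (\<forall>S. finite_generating_set G S \<longrightarrow>
        (\<exists>r :: real. r > 1 \<and> (\<forall>n. r ^ n \<le> real (card (word_ball G S n)))))"


section \<open>Ascending HNN-extensions\<close>

text \<open>The group \<open>\<langle>G, s | s\<inverse> g s = \<theta>(g), g \<in> G\<rangle>\<close>, presented on the generators
  \<open>Some g\<close> for \<open>g \<in> G\<close>, subject to the multiplication table of \<open>G\<close>, and \<open>None\<close> for \<open>s\<close>.\<close>

definition hnn_gens :: "('a, 'b) monoid_scheme \<Rightarrow> 'a option set" where
  "hnn_gens G = insert None (Some ` carrier G)"

definition hnn_relations ::
  "('a, 'b) monoid_scheme \<Rightarrow> ('a \<Rightarrow> 'a) \<Rightarrow> ('a option gword \<times> 'a option gword) set" where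
  "hnn_relations G \<theta> =
     {(gletter (Some g) @ gletter (Some h), gletter (Some (g \<otimes>\<^bsub>G\<^esub> h))) | g h.
        g \<in> carrier G \<and> h \<in> carrier G} \<union>
     {(wconj (gletter (Some g)) (gletter None), gletter (Some (\<theta> g))) | g. g \<in> carrier G}"

definition hnn_group :: "('a, 'b) monoid_scheme \<Rightarrow> ('a \<Rightarrow> 'a) \<Rightarrow> 'a option gword set monoid" where
  "hnn_group G \<theta> = presented_group (hnn_gens G) (hnn_relations G \<theta>)"

definition hnn_elem :: "('a, 'b) monoid_scheme \<Rightarrow> ('a \<Rightarrow> 'a) \<Rightarrow> 'a option \<Rightarrow> 'a option gword set" where
  "hnn_elem G \<theta> x = pres_class (hnn_gens G) (hnn_relations G \<theta>) (gletter x)"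

text \<open>\<open>H\<close> is the ascending HNN-extension of \<open>G\<close> along \<open>\<theta>\<close>, where \<open>\<iota>\<close> is the canonical
  map from \<open>G\<close> to \<open>H\<close> and \<open>t\<close> is the stable letter.\<close>

definition ascending_HNN_extension ::
  "('c, 'd) monoid_scheme \<Rightarrow> ('a, 'b) monoid_scheme \<Rightarrow> ('a \<Rightarrow> 'a) \<Rightarrow> ('a \<Rightarrow> 'c) \<Rightarrow> 'c \<Rightarrow> bool" where
  "ascending_HNN_extension H G \<theta> \<iota> t \<longleftrightarrow>
     \<theta> \<in> hom G G \<and> inj_on \<theta> (carrier G) \<and>
     (\<exists>\<Phi> \<in> iso (hnn_group G \<theta>) H.
        (\<forall>g \<in> carrier G. \<Phi> (hnn_elem G \<theta> (Some g)) = \<iota> g) \<and> \<Phi> (hnn_elem G \<theta> None) = t)"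


section \<open>The finitely presented group\<close>

datatype gen = Ga | Gb | Gc | Gs

definition gt_relators :: "gen gword set" where
  "gt_relators =
     (let a = gletter Ga; b = gletter Gb; c = gletter Gc in
       {wpow a 2,
        wpow (a @ c) 4,
        wpow (wcomm c (a @ b)) 2,
        wpow (wcomm c (b @ a @ b)) 2,
        wpow (wcomm c (a @ b @ a @ b @ a)) 2,
        wpow (wcomm c (a @ b @ a @ b @ a @ b)) 2,
        wpow (wcomm c (b @ a @ b @ a @ b @ a @ b)) 2})"

definition gt_relations :: "(gen gword \<times> gen gword) set" where
  "gt_relations =
     (let a = gletter Ga; b = gletter Gb; c = gletter Gc; s = gletter Gs in
       (\<lambda>r. (r, [])) ` gt_relators \<union>
       {(wconj a s, b), (wconj b s, c), (wconj c s, a @ b @ a)})"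

definition gt_group :: "gen gword set monoid" where
  "gt_group = presented_group UNIV gt_relations"

definition gt_elem :: "gen \<Rightarrow> gen gword set" where
  "gt_elem x = pres_class UNIV gt_relations (gletter x)"


section \<open>Well-formedness of the constructions\<close>

lemma child_Cons: "child (x # v) (y # w) \<longleftrightarrow> x = y \<and> child v w"
  by (auto simp: child_def)

lemma tree_automorphism_id: "tree_automorphism id"
  by (simp add: tree_automorphism_def)

lemma tree_automorphism_comp:
  "tree_automorphism g \<Longrightarrow> tree_automorphism h \<Longrightarrow> tree_automorphism (h \<circ> g)"
  by (auto simp: tree_automorphism_def bij_comp)

lemma tree_automorphism_inv:
  assumes "tree_automorphism g"
  shows "tree_automorphism (inv_into UNIV g)"
proof -
  have g: "bij g" "g [] = []" "\<And>v w. child (g v) (g w) \<longleftrightarrow> child v w"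
    using assms by (auto simp: tree_automorphism_def)
  have s: "g (inv_into UNIV g w) = w" for w
    using g(1) by (simp add: bij_def surj_f_inv_f)
  have "child (inv_into UNIV g v) (inv_into UNIV g w) \<longleftrightarrow> child v w" for v w
    using g(3)[of "inv_into UNIV g v" "inv_into UNIV g w"] by (simp add: s)
  moreover have "inv_into UNIV g [] = []"
    using g(1,2) by (metis bij_inv_eq_iff)
  ultimately show ?thesis
    using g(1) by (simp add: tree_automorphism_def bij_imp_bij_inv)
qed

lemma group_tree_aut_group: "group tree_aut_group"
proof (rule groupI)
  fix g assume "g \<in> carrier tree_aut_group"
  then have g: "tree_automorphism g" by (simp add: tree_aut_group_def)
  then have "g \<circ> inv_into UNIV g = id"
    by (auto simp: tree_automorphism_def bij_def surj_iff)
  then show "\<exists>h \<in> carrier tree_aut_group. h \<otimes>\<^bsub>tree_aut_group\<^esub> g = \<one>\<^bsub>tree_aut_group\<^esub>"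
    using tree_automorphism_inv[OF g] by (auto simp: tree_aut_group_def)
qed (auto simp: tree_aut_group_def tree_automorphism_comp tree_automorphism_id comp_assoc)

lemma tree_automorphism_img:
  "tree_automorphism img_a" "tree_automorphism img_b" "tree_automorphism img_c"
proof -
  have as: "img_a [] = []" "img_a (x # w) = (\<not> x) # w" for x w
    by (simp_all add: img_a_def)
  have len: "length (img_a w) = length w" for w
    by (cases w) (simp_all add: as)
  have aa: "img_a (img_a w) = w" for w
    by (cases w) (simp_all add: as)
  have bc2: "img_b (img_b w) = w \<and> img_c (img_c w) = w" for w
    by (induction w) (auto simp: aa)
  have bcl: "length (img_b w) = length w \<and> length (img_c w) = length w" for w
    by (induction w) (auto simp: len)
  have bij: "bij img_b" "bij img_c"
    using bc2 by (auto intro: involuntory_imp_bij)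
  have nil: "child [] u \<longleftrightarrow> length u = 1" for u :: vertex
    by (auto simp: child_def length_Suc_conv)
  have nc: "\<not> child u []" for u by (simp add: child_def)
  have ac: "child (img_a v) (img_a w) \<longleftrightarrow> child v w" for v w
  proof (cases v)
    case Nil
    then show ?thesis by (simp add: nil len as)
  next
    case (Cons x v)
    then show ?thesis by (cases w) (simp_all add: as child_Cons nc)
  qed
  show "tree_automorphism img_a"
    using ac aa by (auto simp: tree_automorphism_def as intro: involuntory_imp_bij)
  have "(child (img_b v) (img_b w) \<longleftrightarrow> child v w) \<and> (child (img_c v) (img_c w) \<longleftrightarrow> child v w)" for v w
  proof (induction v arbitrary: w)
    case Nil
    then show ?case by (simp add: nil bcl)
  next
    case (Cons x v)
    then show ?case by (cases w) (auto simp: child_Cons ac nc)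
  qed
  then show "tree_automorphism img_b" "tree_automorphism img_c"
    using bij by (auto simp: tree_automorphism_def)
qed

lemma group_img_group: "group img_group"
  unfolding img_group_def using group_tree_aut_group by (rule group.group_subgroup_generated)

lemma carrier_img_group: "carrier img_group = generate tree_aut_group {img_a, img_b, img_c}"
proof -
  have "carrier tree_aut_group \<inter> {img_a, img_b, img_c} = {img_a, img_b, img_c}"
    using tree_automorphism_img by (auto simp: tree_aut_group_def)
  then show ?thesis by (simp add: img_group_def carrier_subgroup_generated)
qed

lemma gwords_append [simp]: "u @ v \<in> gwords S \<longleftrightarrow> u \<in> gwords S \<and> v \<in> gwords S"
  by (auto simp: gwords_def)

lemma gwords_Nil [simp]: "[] \<in> gwords S"
  by (simp add: gwords_def)

lemma gwords_Cons [simp]: "(x, e) # w \<in> gwords S \<longleftrightarrow> x \<in> S \<and> w \<in> gwords S"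
  by (auto simp: gwords_def)

lemma winv_gwords: "w \<in> gwords S \<Longrightarrow> winv w \<in> gwords S"
  by (auto simp: gwords_def winv_def)

lemma pres_rel_gwords: "(u, v) \<in> pres_rel S R \<Longrightarrow> u \<in> gwords S \<and> v \<in> gwords S"
  by (induction rule: pres_rel.induct) auto

lemma equiv_pres_rel: "equiv (gwords S) (pres_rel S R)"
proof (rule equivI)
  show "pres_rel S R \<subseteq> gwords S \<times> gwords S" using pres_rel_gwords by auto
  show "refl_on (gwords S) (pres_rel S R)"
    by (auto intro: refl_onI pres_rel.refl dest: pres_rel_gwords)
  show "Relation.sym (pres_rel S R)" by (auto intro: symI pres_rel.sym)
  show "Relation.trans (pres_rel S R)" by (auto intro: transI pres_rel.trans)
qed

lemma pres_rel_context:
  assumes "(u, v) \<in> pres_rel S R" "p \<in> gwords S" "q \<in> gwords S"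
  shows "(p @ u @ q, p @ v @ q) \<in> pres_rel S R"
  using assms(1)
proof (induction rule: pres_rel.induct)
  case (refl u)
  then show ?case using assms by (auto intro: pres_rel.refl)
next
  case (sym u v)
  then show ?case by (auto intro: pres_rel.sym)
next
  case (trans u v w)
  then show ?case by (auto intro: pres_rel.trans)
next
  case (cancel u v x e)
  then show ?case
    using pres_rel.cancel[of "p @ u" S "v @ q" x e R] assms by simp
next
  case (relation u v l r)
  then show ?case
    using pres_rel.relation[of "p @ u" S "v @ q" l r R] assms by simp
qed

lemma pres_rel_append:
  assumes "(u, u') \<in> pres_rel S R" "(v, v') \<in> pres_rel S R"
  shows "(u @ v, u' @ v') \<in> pres_rel S R"
proof -
  have w: "v \<in> gwords S" "u' \<in> gwords S" using assms pres_rel_gwords by auto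
  have "(u @ v, u' @ v) \<in> pres_rel S R"
    using pres_rel_context[OF assms(1), of "[]" v] w by simp
  moreover have "(u' @ v, u' @ v') \<in> pres_rel S R"
    using pres_rel_context[OF assms(2), of u' "[]"] w by simp
  ultimately show ?thesis by (rule pres_rel.trans)
qed

lemma pres_class_eq_iff:
  "u \<in> gwords S \<Longrightarrow> v \<in> gwords S \<Longrightarrow> pres_class S R u = pres_class S R v \<longleftrightarrow> (u, v) \<in> pres_rel S R"
  unfolding pres_class_def using eq_equiv_class_iff[OF equiv_pres_rel] by metis

lemma carrier_presented_group: "carrier (presented_group S R) = pres_class S R ` gwords S"
  by (auto simp: presented_group_def pres_class_def quotient_def)

lemma one_presented_group: "\<one>\<^bsub>presented_group S R\<^esub> = pres_class S R []"
  by (simp add: presented_group_def)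

lemma mult_presented_group:
  assumes "u \<in> gwords S" "v \<in> gwords S"
  shows "pres_class S R u \<otimes>\<^bsub>presented_group S R\<^esub> pres_class S R v = pres_class S R (u @ v)"
proof -
  have "pres_class S R (u' @ v') = pres_class S R (u @ v)"
    if "u' \<in> pres_class S R u" "v' \<in> pres_class S R v" for u' v'
  proof -
    have "(u, u') \<in> pres_rel S R" "(v, v') \<in> pres_rel S R"
      using that by (auto simp: pres_class_def)
    then have "(u @ v, u' @ v') \<in> pres_rel S R" by (rule pres_rel_append)
    then show ?thesis using pres_class_eq_iff pres_rel_gwords by metis
  qed
  moreover have "u \<in> pres_class S R u" "v \<in> pres_class S R v"
    using assms by (simp_all add: pres_class_def pres_rel.refl)
  ultimately have "(\<Union>u'\<in>pres_class S R u. \<Union>v'\<in>pres_class S R v. pres_class S R (u' @ v'))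
      = pres_class S R (u @ v)"
    by blast
  then show ?thesis by (simp add: presented_group_def)
qed

lemma winv_cancel: "w \<in> gwords S \<Longrightarrow> (winv w @ w, []) \<in> pres_rel S R"
proof (induction w)
  case Nil
  then show ?case by (auto simp: winv_def intro: pres_rel.refl)
next
  case (Cons y w)
  obtain x e where y: "y = (x, e)" by (cases y)
  have x: "x \<in> S" "w \<in> gwords S" using Cons.prems by (auto simp: y)
  have "(winv w @ [(x, \<not> e), (x, \<not> \<not> e)] @ w, winv w @ w) \<in> pres_rel S R"
    using x winv_gwords by (intro pres_rel.cancel) auto
  moreover have "winv (y # w) @ y # w = winv w @ [(x, \<not> e), (x, \<not> \<not> e)] @ w"
    by (simp add: winv_def y)
  ultimately show ?case using Cons.IH x by (auto intro: pres_rel.trans)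
qed

lemma group_presented_group: "group (presented_group S R)"
proof (rule groupI)
  fix x assume "x \<in> carrier (presented_group S R)"
  then obtain w where w: "w \<in> gwords S" "x = pres_class S R w"
    by (auto simp: carrier_presented_group)
  then have "pres_class S R (winv w) \<otimes>\<^bsub>presented_group S R\<^esub> x = \<one>\<^bsub>presented_group S R\<^esub>"
    using winv_gwords[OF w(1)] winv_cancel[OF w(1), of R]
    by (simp add: mult_presented_group one_presented_group pres_class_eq_iff)
  then show "\<exists>y \<in> carrier (presented_group S R). y \<otimes>\<^bsub>presented_group S R\<^esub> x = \<one>\<^bsub>presented_group S R\<^esub>"
    using w winv_gwords by (auto simp: carrier_presented_group)
qed (auto simp: carrier_presented_group one_presented_group mult_presented_group)

lemma pres_class_relation:
  assumes "(p, q) \<in> R" "p \<in> gwords S" "q \<in> gwords S"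
  shows "pres_class S R p = pres_class S R q"
  using pres_rel.relation[of "[]" S "[]" p q R] assms by (simp add: pres_class_eq_iff)

end

(* The word problem of img_group is solved by passing to the two sections of a word, which are
   trivial and shorter if the word is trivial. A word that fixes the first level equals
   theta(u) theta(v)^a in the presented group, with sections u and pi(u) v, where pi exchanges a
   and c and kills b. This only needs that c commutes with aca and its conjugates by <b, aba>, and
   the relators say exactly this. Conversely, moving all letters s of a word to one side turns a
   derivation of u = v into an equality of the elements theta^n(u) and theta^n(v) of img_group for
   large n; this replaces normal forms of HNN-extensions.

   Exponential growth: a is not in theta(G), so s and sa generate a free semigroup.

   Amenability: the Folner sets are the unions of the s^k B with k < m, for a ball B of img_group
   that hardly grows under the letters theta^k(x). Such balls exist because img_group has
   subexponential growth. With weights 1, 3, 3 for a, b, c, the total weight of the sections of a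
   reduced word exceeds that of the word by a bounded amount, and it drops at every window aca or
   bcb and at every cancellation. If little is lost in three steps, the sections at level two are
   almost free of windows xyx, and there are few such words. Hence a growth exponent l > 0 could be
   replaced by a smaller one. *)

theory Submission
  imports Defs "HOL-Analysis.Function_Topology"
begin

section \<open>Words in the generators and their sections\<close>

text \<open>Everything rests on theta(g) = (g, pi(g)), where pi takes values in a dihedral group of
  order 8. Injectivity of theta is visible in the first coordinate, and that theta respects the
  relations of the group reduces to the same statement for pi, a finite matter. The eight elements
  of the dihedral group are also the reason why finitely many commutations suffice: the stable
  letter supplies their images under all powers of theta. The obstacle to counting is the lack of a
  uniform contraction: the weight drops only in proportion to the number of certain windows. Words
  with few windows are counted separately, and a growth rate is improved by playing the two cases
  off against each other. The obstacle to amenability is that the extension has exponential growth,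
  so small boundaries cannot be had by counting its own balls. They come from balls of the subgroup,
  whose radius is chosen last.\<close>

datatype letter = LA | LB | LC

lemma UNIV_letter: "UNIV = {LA, LB, LC}"
  using letter.exhaust by blast

fun lact :: "letter \<Rightarrow> vertex \<Rightarrow> vertex" where
  "lact LA = img_a"
| "lact LB = img_b"
| "lact LC = img_c"

primrec ev :: "letter list \<Rightarrow> vertex \<Rightarrow> vertex" where
  "ev [] = id"
| "ev (x # w) = ev w \<circ> lact x"

text \<open>\<open>sec p w\<close> spells the section of \<open>w\<close> at the letter \<open>p\<close>, without cancellation.\<close>

fun sec :: "bool \<Rightarrow> letter list \<Rightarrow> letter list" where
  "sec p [] = []"
| "sec p (LA # w) = sec (\<not> p) w"
| "sec p (LB # w) = (if p then LC else LA) # sec p w"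
| "sec p (LC # w) = (if p then sec p w else LB # sec p w)"

definition flips :: "letter list \<Rightarrow> bool" where
  "flips w = odd (count_list w LA)"

lemma flips_simps [simp]:
  "flips [] = False" "flips (LA # w) = (\<not> flips w)" "flips (LB # w) = flips w"
  "flips (LC # w) = flips w" "flips (u @ v) = (flips u \<noteq> flips v)"
  by (auto simp: flips_def)

lemma ev_append: "ev (u @ v) = ev v \<circ> ev u"
  by (induction u) (auto simp: fun_eq_iff)

lemma lact_Nil [simp]: "lact x [] = []"
  by (cases x) (simp_all add: img_a_def)

lemma ev_Nil [simp]: "ev w [] = []"
  by (induction w) auto

lemma ev_Cons: "ev w (p # v) = (p \<noteq> flips w) # ev (sec p w) v"
proof (induction w arbitrary: p v)
  case (Cons x w)
  then show ?case by (cases x) (auto simp: img_a_def)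
qed simp

lemma lact_lact [simp]: "lact x (lact x v) = v"
proof -
  have a: "img_a (img_a v) = v" for v
    by (cases v) (simp_all add: img_a_def)
  have "img_b (img_b v) = v \<and> img_c (img_c v) = v"
    by (induction v) (auto simp: a)
  then show ?thesis by (cases x) (simp_all add: a)
qed

lemmas img_invol [simp] = lact_lact[of LA, simplified] lact_lact[of LB, simplified] lact_lact[of LC, simplified]

lemma ev_rev: "ev (rev w) (ev w v) = v"
  by (induction w arbitrary: v) (auto simp: ev_append)

lemma ev_rev': "ev w (ev (rev w) v) = v"
  using ev_rev[of "rev w"] by simp

lemma ev_eq_id_iff: "ev w = id \<longleftrightarrow> \<not> flips w \<and> ev (sec False w) = id \<and> ev (sec True w) = id"
proof
  assume "ev w = id"
  then have *: "ev w (p # v) = p # v" for p v by simp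
  from * have "\<not> flips w" by (auto simp: ev_Cons)
  moreover from * have "ev (sec p w) v = v" for p v by (auto simp: ev_Cons)
  ultimately show "\<not> flips w \<and> ev (sec False w) = id \<and> ev (sec True w) = id"
    by (auto simp: fun_eq_iff)
next
  assume *: "\<not> flips w \<and> ev (sec False w) = id \<and> ev (sec True w) = id"
  show "ev w = id"
  proof
    fix v show "ev w v = id v"
      using * by (cases v rule: list.exhaust; cases "hd v") (auto simp: ev_Cons)
  qed
qed

lemma ev_eq_wreath: "ev w = wreath (ev (sec False w)) (ev (sec True w)) (if flips w then Not else id)"
proof
  fix v show "ev w v = wreath (ev (sec False w)) (ev (sec True w)) (if flips w then Not else id) v"
    by (cases v) (auto simp: ev_Cons)
qed

lemma ev_eq_iff: "ev u = ev v \<longleftrightarrow> ev (rev u @ v) = id"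
proof
  assume "ev u = ev v"
  then have "ev v (ev (rev u) x) = x" for x using ev_rev'[of u x] by simp
  then show "ev (rev u @ v) = id" by (simp add: ev_append fun_eq_iff)
next
  assume "ev (rev u @ v) = id"
  then have "ev v (ev (rev u) (ev u x)) = ev u x" for x
    by (simp add: ev_append fun_eq_iff)
  then show "ev u = ev v" by (auto simp: ev_rev)
qed

section \<open>Free reduction of words in three involutions\<close>

fun push :: "letter \<Rightarrow> letter list \<Rightarrow> letter list" where
  "push x [] = [x]"
| "push x (y # r) = (if x = y then r else x # y # r)"

primrec red :: "letter list \<Rightarrow> letter list" where
  "red [] = []"
| "red (x # w) = push x (red w)"

lemma ev_push: "ev (push x w) = ev (x # w)"
  by (cases w) (auto simp: fun_eq_iff)

lemma ev_red: "ev (red w) = ev w"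
  by (induction w) (simp_all add: ev_push)

lemma distinct_adj_push: "distinct_adj w \<Longrightarrow> distinct_adj (push x w)"
  by (cases w) (auto dest: distinct_adj_ConsD)

lemma distinct_adj_red: "distinct_adj (red w)"
  by (induction w) (auto intro: distinct_adj_push)

text \<open>Reduction is a chain of deletions of pairs \<open>x # x\<close>, each inside some
  context. All estimates for \<open>red\<close> below (length, weight, windows) are therefore
  checked on a single deletion; integer values allow differences such as weight minus
  length.\<close>

lemma red_le:
  fixes f :: "letter list \<Rightarrow> int"
  assumes "\<And>u x v. f (u @ v) \<le> f (u @ x # x # v)"
  shows "f (red w) \<le> f w"
proof -
  have "f (u @ red w) \<le> f (u @ w)" for u
  proof (induction w arbitrary: u)
    case (Cons x w)
    have "f (u @ x # red w) \<le> f (u @ x # w)" using Cons[of "u @ [x]"] by simp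
    moreover have "f (u @ push x (red w)) \<le> f (u @ x # red w)"
      using assms by (cases "red w") auto
    ultimately show ?case by simp
  qed simp
  from this[of "[]"] show ?thesis by simp
qed

lemma length_red: "length (red w) \<le> length w"
  using red_le[of "\<lambda>w. int (length w)"] by simp

lemma length_sec: "length (sec p w) + count_list w LA \<le> length w"
  by (induction p w rule: sec.induct) auto

section \<open>The substitution\<close>

fun subst1 :: "letter \<Rightarrow> letter list" where
  "subst1 LA = [LB]"
| "subst1 LB = [LC]"
| "subst1 LC = [LA, LB, LA]"

definition subst :: "letter list \<Rightarrow> letter list" where
  "subst w = concat (map subst1 w)"

fun swp1 :: "letter \<Rightarrow> letter list" where
  "swp1 LA = [LC]"
| "swp1 LB = []"
| "swp1 LC = [LA]"

definition swp :: "letter list \<Rightarrow> letter list" where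
  "swp w = concat (map swp1 w)"

lemma subst_simps [simp]:
  "subst [] = []" "subst (x # w) = subst1 x @ subst w" "subst (u @ v) = subst u @ subst v"
  by (auto simp: subst_def)

lemma swp_simps [simp]:
  "swp [] = []" "swp (x # w) = swp1 x @ swp w" "swp (u @ v) = swp u @ swp v"
  by (auto simp: swp_def)

lemma flips_subst [simp]: "\<not> flips (subst w)"
proof (induction w)
  case (Cons x w) then show ?case by (cases x) auto
qed simp

text \<open>This is theta(w) = (w, pi(w)), read off from theta(a) = b = (a, c), theta(b) = c = (b,
  1) and theta(c) = aba = (c, a).\<close>

lemma sec_subst: "sec False (subst w) = w" "sec True (subst w) = swp w"
proof (induction w)
  case (Cons x w)
  { case 1 show ?case using Cons by (cases x) auto }
  { case 2 show ?case using Cons by (cases x) auto }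
qed auto

lemma rev_subst: "rev (subst w) = subst (rev w)"
proof (induction w)
  case (Cons x w) then show ?case by (cases x) auto
qed simp

text \<open>The relation of the dihedral group \<open>\<langle>a, c\<rangle>\<close> of order 8.\<close>

inductive dih :: "letter list \<Rightarrow> letter list \<Rightarrow> bool" where
  dih_refl: "dih u u"
| dih_sym: "dih u v \<Longrightarrow> dih v u"
| dih_trans: "dih u v \<Longrightarrow> dih v w \<Longrightarrow> dih u w"
| dih_sq: "x \<noteq> LB \<Longrightarrow> dih (u @ x # x # v) (u @ v)"
| dih_ac: "dih (u @ [LA, LC, LA, LC, LA, LC, LA, LC] @ v) (u @ v)"

text \<open>One reduced word for each of the eight elements; the longest element is spelled acac,
  not caca.\<close>

definition dih_forms :: "letter list set" where
  "dih_forms = {[], [LA], [LC], [LA, LC], [LC, LA], [LA, LC, LA], [LC, LA, LC], [LA, LC, LA, LC]}"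

lemma dih_context: "dih u v \<Longrightarrow> dih (p @ u @ q) (p @ v @ q)"
proof (induction rule: dih.induct)
  case (dih_sq x u v) then show ?case using dih.dih_sq[of x "p @ u" "v @ q"] by simp
next
  case (dih_ac u v) then show ?case using dih.dih_ac[of "p @ u" "v @ q"] by simp
qed (auto intro: dih.intros)

lemma dih_red: "LB \<notin> set w \<Longrightarrow> dih (red w) w \<and> LB \<notin> set (red w)"
proof (induction w)
  case (Cons x w)
  then have IH: "dih (red w) w" "LB \<notin> set (red w)" and x: "x \<noteq> LB" by auto
  have "dih (x # red w) (x # w)" using dih_context[OF IH(1), of "[x]" "[]"] by simp
  moreover have "dih (push x (red w)) (x # red w)"
    using dih_sym[OF dih_sq[OF x, of "[]"]] by (cases "red w") (auto intro: dih_refl)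
  moreover have "LB \<notin> set (push x (red w))" using IH(2) x by (cases "red w") auto
  ultimately show ?case using dih_trans by fastforce
qed (auto intro: dih_refl)

lemma dih_of_red_eq:
  assumes "red u = red v" "LB \<notin> set u" "LB \<notin> set v"
  shows "dih u v"
  using dih_red[of u] dih_red[of v] assms dih_sym dih_trans by metis

declare dih_trans [trans]

lemma dih_ca: "dih [LC, LA, LC, LA, LC] [LA, LC, LA]"
proof -
  have "dih [LC, LA, LC, LA, LC] ([LC] @ [LA, LC, LA, LC, LA, LC, LA, LC] @ [LC, LA, LC, LA])"
    by (rule dih_of_red_eq) auto
  also have "dih \<dots> ([LC] @ [LC, LA, LC, LA])"
    by (rule dih_ac)
  also have "dih \<dots> [LA, LC, LA]"
    by (rule dih_of_red_eq) auto
  finally show ?thesis .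
qed

lemma dih_forms_ex:
  assumes "LB \<notin> set w"
  obtains q where "q \<in> dih_forms" "dih w q"
proof -
  have "\<exists>q \<in> dih_forms. dih w q" using assms
  proof (induction w)
    case (Cons x w)
    then obtain q where q: "q \<in> dih_forms" "dih w q" by auto
    have x: "x = LA \<or> x = LC" using Cons.prems by (cases x) auto
    have 1: "dih (x # w) (x # q)" using dih_context[OF q(2), of "[x]" "[]"] by simp
    have "\<exists>r \<in> dih_forms. dih (x # q) r"
    proof (cases "red (x # q) \<in> dih_forms")
      case True
      moreover have "LB \<notin> set (x # q)" using x q(1) by (auto simp: dih_forms_def)
      ultimately show ?thesis using dih_red dih_sym by blast
    next
      case False
      have c: "dih [LC, LA, LC, LA] [LA, LC, LA, LC]"
      proof -
        have "dih [LC, LA, LC, LA] ([] @ [LC, LA, LC, LA, LC] @ [LC])"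
          by (rule dih_of_red_eq) auto
        also have "dih \<dots> ([] @ [LA, LC, LA] @ [LC])"
          by (rule dih_context) (rule dih_ca)
        finally show ?thesis by simp
      qed
      \<comment> \<open>A product that stays outside the list after reduction begins with c and has
        four or five letters; (ac)^4 = 1 rewrites both.\<close>
      from False have "x # q \<in> {[LC, LA, LC, LA], [LC, LA, LC, LA, LC]} "
        using x q(1) by (auto simp: dih_forms_def)
      then show ?thesis using c dih_ca by (auto simp: dih_forms_def)
    qed
    then show ?case using 1 dih_trans by blast
  qed (auto simp: dih_forms_def intro: dih_refl)
  then show ?thesis using that by blast
qed

text \<open>Exchanging a and c turns (ac)^4 into (ca)^4, which is again trivial by
  \<open>dih_ca\<close>.\<close>

lemma dih_swp: "dih u v \<Longrightarrow> dih (swp u) (swp v)"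
proof (induction rule: dih.induct)
  case (dih_sq x u v)
  then show ?case by (cases x) (auto intro: dih.dih_sq)
next
  case (dih_ac u v)
  have "dih ([] @ [LC, LA, LC, LA, LC] @ [LA, LC, LA]) ([] @ [LA, LC, LA] @ [LA, LC, LA])"
    by (rule dih_context) (rule dih_ca)
  also have "dih \<dots> []"
    by (rule dih_of_red_eq) auto
  finally have "dih [LC, LA, LC, LA, LC, LA, LC, LA] []" by simp
  from dih_context[OF this, of "swp u" "swp v"] show ?case by simp
qed (auto intro: dih.intros)

lemma dih_ev: "dih u v \<Longrightarrow> ev u = ev v"
proof (induction rule: dih.induct)
  case (dih_sq x u v)
  show ?case by (auto simp: ev_append fun_eq_iff)
next
  case (dih_ac u v)
  have "ev [LA, LC, LA, LC, LA, LC, LA, LC] = id"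
    by (subst ev_eq_id_iff) (simp add: fun_eq_iff)
  then show ?case by (simp only: ev_append comp_id)
qed auto

text \<open>Every nonempty word of the list moves one of the vertices 000 and 100.\<close>

lemma dih_forms_ev:
  assumes "q \<in> dih_forms" "ev q = id"
  shows "q = []"
proof -
  have "ev q [p, False, False] = [p, False, False]" for p using assms(2) by simp
  from this[of False] this[of True] show ?thesis
    using assms(1) by (auto simp: dih_forms_def img_a_def)
qed

section \<open>The quotient that kills b, and injectivity of theta\<close>

abbreviation kill_b :: "letter list \<Rightarrow> letter list" where
  "kill_b \<equiv> filter (\<lambda>x. x \<noteq> LB)"

lemma swp_kill_b: "swp (kill_b w) = swp w"
proof (induction w)
  case (Cons x w) then show ?case by (cases x) auto
qed simp

lemma sec_kill_b: "sec p (kill_b w) = filter (\<lambda>x. x = LB) (sec p w)"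
  by (induction p w rule: sec.induct) auto

lemma count_sec: "count_list (sec False w) LA + count_list (sec True w) LA = count_list w LB"
proof (induction w)
  case (Cons x w) then show ?case by (cases x) auto
qed simp

text \<open>Each b puts exactly one a into the two sections together, and no other letter does. If
  \<open>w\<close> is trivial, so are its sections, and a trivial word has an even number of letters
  a.\<close>

lemma even_count_b: "ev w = id \<Longrightarrow> even (count_list w LB)"
  using ev_eq_id_iff[of w] ev_eq_id_iff[of "sec False w"] ev_eq_id_iff[of "sec True w"] count_sec[of w]
  unfolding flips_def by (metis even_add)

lemma ev_filter_b: "even (count_list w LB) \<Longrightarrow> ev (filter (\<lambda>x. x = LB) w) = id"
proof -
  have "filter (\<lambda>x. x = LB) w = replicate (count_list w LB) LB"
    by (induction w) auto
  moreover have "ev (replicate (2 * n) LB) = id" for n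
    using lact_lact[of LB] by (induction n) (auto simp: fun_eq_iff)
  ultimately show "even (count_list w LB) \<Longrightarrow> ev (filter (\<lambda>x. x = LB) w) = id"
    by (auto elim!: evenE)
qed

text \<open>Killing \<open>b\<close> maps the group onto the dihedral group \<open>\<langle>a, c\<rangle>\<close>: the sections of
  the image at level one only record the parities of \<open>b\<close> in the sections.\<close>

lemma dih_kill_b:
  assumes "ev w = id"
  shows "dih (kill_b w) []"
proof -
  have "ev (kill_b w) = id"
    unfolding ev_eq_id_iff[of "kill_b w"] sec_kill_b
  proof (intro conjI ev_filter_b even_count_b)
    have "count_list (kill_b w) LA = count_list w LA" by (induction w) auto
    then show "\<not> flips (kill_b w)" using assms ev_eq_id_iff[of w] by (simp add: flips_def)
  qed (use assms ev_eq_id_iff[of w] in auto)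
  moreover obtain q where "q \<in> dih_forms" "dih (kill_b w) q"
    using dih_forms_ex[of "kill_b w"] by auto
  ultimately show ?thesis using dih_ev dih_forms_ev by metis
qed

lemma dih_swp_Nil: "ev w = id \<Longrightarrow> dih (swp w) []"
  using dih_swp[OF dih_kill_b] by (simp add: swp_kill_b)

text \<open>The first section of theta(w) is \<open>w\<close> itself, which gives one direction. For
  the other, the second section pi(w) of a trivial \<open>w\<close> is trivial already by the
  dihedral relations.\<close>

lemma ev_subst_eq_id: "ev (subst w) = id \<longleftrightarrow> ev w = id"
  using dih_ev[OF dih_swp_Nil, of w] by (auto simp: ev_eq_id_iff[of "subst w"] sec_subst)

lemma ev_subst_cong: "ev (subst u) = ev (subst v) \<longleftrightarrow> ev u = ev v"
  using ev_subst_eq_id[of "rev u @ v"] by (simp add: ev_eq_iff[of u v] ev_eq_iff[of "subst u"] rev_subst)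

section \<open>Counting windows\<close>

text \<open>\<open>P\<close> is tested on suffixes, so that a window at a given place is a condition
  on the suffix starting there.\<close>

primrec cnt :: "(letter list \<Rightarrow> bool) \<Rightarrow> letter list \<Rightarrow> nat" where
  "cnt P [] = 0"
| "cnt P (x # w) = of_bool (P (x # w)) + cnt P w"

abbreviation win :: "letter list \<Rightarrow> letter list \<Rightarrow> bool" where
  "win p s \<equiv> take (length p) s = p"

text \<open>The windows xyx of a reduced word, sorted by their middle letter c, b, a. In a section,
  a window of the second kind is caused by one of the first kind in the word, and one of the third
  kind by one of the first two; so all of them are traced back to places where weight is
  lost.\<close>

abbreviation "win_lossy s \<equiv> win [LA, LC, LA] s \<or> win [LB, LC, LB] s"
abbreviation "win_near s \<equiv> win [LA, LB, LA] s \<or> win [LC, LB, LC] s"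
abbreviation "win_third s \<equiv> win [LB, LA, LB] s \<or> win [LC, LA, LC] s"

lemma cnt_mono: "(\<And>s. P s \<Longrightarrow> Q s) \<Longrightarrow> cnt P w \<le> cnt Q w"
  by (induction w) (auto simp: add_mono of_bool_def)

lemma cnt_disj: "cnt (\<lambda>s. P s \<or> Q s) w \<le> cnt P w + cnt Q w"
  by (induction w) (auto simp: of_bool_def)

lemma cnt_drop:
  assumes "\<not> P []"
  shows "cnt (\<lambda>s. P (drop j s)) w \<le> cnt P w"
proof (induction j arbitrary: w)
  case (Suc j)
  have "cnt (\<lambda>s. P (drop (Suc j) s)) (x # v) = cnt (\<lambda>s. P (drop j s)) v" for x v
    using assms by (induction v arbitrary: x) auto
  then have "cnt (\<lambda>s. P (drop (Suc j) s)) w \<le> cnt (\<lambda>s. P (drop j s)) w"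
    by (cases w) auto
  then show ?case using Suc le_trans by blast
qed simp

lemma cnt_nearby:
  assumes "\<not> P []"
  shows "cnt (\<lambda>s. \<exists>j<k. P (drop j s)) w \<le> k * cnt P w"
proof (induction k)
  case (Suc k)
  have "cnt (\<lambda>s. \<exists>j<Suc k. P (drop j s)) w \<le> cnt (\<lambda>s. (\<exists>j<k. P (drop j s)) \<or> P (drop k s)) w"
    by (rule cnt_mono) (auto simp: less_Suc_eq)
  then show ?case
    using cnt_disj[of "\<lambda>s. \<exists>j<k. P (drop j s)" "\<lambda>s. P (drop k s)" w] cnt_drop[of P k w, OF assms] Suc
    by simp
next
  case 0
  have "cnt (\<lambda>s. False) w = 0" by (induction w) auto
  then show ?case by simp
qed

text \<open>Deleting the pair can create windows only at the last two letters of \<open>u\<close>.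
  The bound 2 equals the number of deleted letters, so windows plus length never increase, as
  \<open>cnt_red\<close> needs.\<close>

lemma cnt_insert:
  assumes "\<And>s. P s \<longleftrightarrow> P (take 3 s)"
  shows "cnt P (u @ v) \<le> cnt P (u @ x # x # v) + min 2 (length u)"
proof (induction u)
  case (Cons y u)
  show ?case
  proof (cases "length u < 2")
    case True then show ?thesis using Cons by auto
  next
    case False
    then have "take 3 (y # u @ v) = take 3 (y # u @ x # x # v)"
      by (simp add: take_Cons' numeral_3_eq_3)
    then have "P (y # u @ v) = P (y # u @ x # x # v)" by (metis assms)
    then show ?thesis using Cons False by auto
  qed
qed simp

lemma cnt_red:
  assumes "\<And>s. P s \<longleftrightarrow> P (take 3 s)"
  shows "cnt P (red w) + length (red w) \<le> cnt P w + length w"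
proof -
  have "int (cnt P (u @ v) + length (u @ v)) \<le> int (cnt P (u @ x # x # v) + length (u @ x # x # v))" for u x v
    using cnt_insert[of P u v x] assms by simp
  from red_le[of "\<lambda>w. int (cnt P w + length w)", OF this, of w] show ?thesis by simp
qed

text \<open>Equal weights of b and c make c = (b, 1) neutral; b = (a, c) then gains and a = (1, 1)
  loses the weight of a. Deleting cc costs 6 and removes at most two windows cc, so 3 is lost per
  window. In \<open>wt_step\<close> the gain of 1 per window bcb counts twice; 3 covers it and
  leaves a surplus of one.\<close>

primrec wt :: "letter list \<Rightarrow> nat" where
  "wt [] = 0"
| "wt (x # w) = (if x = LA then 1 else 3) + wt w"

lemma wt_append [simp]: "wt (u @ v) = wt u + wt v"
  by (induction u) auto

lemma length_le_wt: "length w \<le> wt w"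
  by (induction w) auto

lemma wt_red_length: "wt (red w) + length w \<le> wt w + length (red w)"
proof -
  have "int (wt (u @ v)) - int (length (u @ v)) \<le> int (wt (u @ x # x # v)) - int (length (u @ x # x # v))" for u x v
    by simp
  from red_le[of "\<lambda>w. int (wt w) - int (length w)", OF this, of w] show ?thesis by simp
qed

lemma cnt_cc_insert:
  "cnt (win [LC, LC]) (u @ x # x # v) \<le> cnt (win [LC, LC]) (u @ v) + (if x = LC then 2 else 0)"
proof (induction u)
  case Nil
  then show ?case by (cases v) auto
next
  case (Cons y u)
  then show ?case by (cases u; cases v) auto
qed

lemma cnt_cc_reduced: "distinct_adj w \<Longrightarrow> cnt (win [LC, LC]) w = 0"
proof (induction w)
  case (Cons x w)
  then show ?case by (cases w) auto
qed simp

lemma wt_red_cc: "wt (red w) + 3 * cnt (win [LC, LC]) w \<le> wt w"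
proof -
  have "int (wt (u @ v)) - 3 * int (cnt (win [LC, LC]) (u @ v)) \<le>
      int (wt (u @ x # x # v)) - 3 * int (cnt (win [LC, LC]) (u @ x # x # v))" for u x v
    using cnt_cc_insert[of u x v] by (auto split: if_splits)
  from red_le[of "\<lambda>w. int (wt w) - 3 * int (cnt (win [LC, LC]) w)", OF this, of w]
  show ?thesis using cnt_cc_reduced[OF distinct_adj_red[of w]] by simp
qed

text \<open>In the section where b contributes c, the letter c contributes nothing, so bcb becomes
  cc there. The induction runs over both orders of the sections because a exchanges them.\<close>

lemma cnt_bcb: "cnt (win [LB, LC, LB]) w \<le> cnt (win [LC, LC]) (sec False w) + cnt (win [LC, LC]) (sec True w)"
proof -
  have "cnt (win [LB, LC, LB]) w \<le> cnt (win [LC, LC]) (sec p w) + cnt (win [LC, LC]) (sec (\<not> p) w)" for p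
  proof (induction w arbitrary: p)
    case (Cons x w)
    show ?case
    proof (cases x)
      case LB
      obtain y z v where w: "w = [] \<or> w = [y] \<or> w = y # z # v" by (metis list.exhaust)
      then show ?thesis using Cons[of p] LB by (cases p; cases y; cases z) (auto split: if_splits)
    qed (use Cons[of p] Cons[of "\<not> p"] in \<open>auto split: if_splits\<close>)
  qed simp
  from this[of False] show ?thesis by simp
qed

lemma wt_sec: "wt (sec False w) + wt (sec True w) + count_list w LA = wt w + count_list w LB"
proof (induction w)
  case (Cons x w) then show ?case by (cases x) auto
qed simp

text \<open>Between consecutive letters a lies an alternating word in b and c. It has no b only if
  it is c, which is a window aca; otherwise its letters b exceed its windows bcb by one. The blocks
  before the first and after the last a cause the error term, and a word starting with a or ca has
  no b in its first block.\<close>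

lemma count_b:
  assumes "distinct_adj w"
  shows "count_list w LB + cnt (win [LA, LC, LA]) w \<le>
    count_list w LA + cnt (win [LB, LC, LB]) w + (if win [LA] w \<or> win [LC, LA] w then 0 else 1)"
  using assms
proof (induction w)
  case (Cons x w)
  then have "distinct_adj w" by (auto dest: distinct_adj_ConsD)
  note IH = Cons.IH[OF this]
  obtain y z v where w: "w = [] \<or> w = [y] \<or> w = y # z # v" by (cases w; cases "tl w") auto
  show ?case using IH w Cons.prems by (cases x; cases y; cases z) auto
qed simp

text \<open>A letter \<open>b\<close> of \<open>w\<close> raises the total weight of the two sections by one, a letter \<open>a\<close>
  lowers it by one. The \<open>b\<close>s outnumber the \<open>a\<close>s only through windows \<open>bcb\<close>, and each of
  these causes a cancellation of two letters \<open>c\<close> in a section.\<close>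

lemma wt_step:
  assumes "distinct_adj w"
  shows "2 * (wt (red (sec False w)) + wt (red (sec True w))) + cnt win_lossy w
     + (length (sec False w) + length (sec True w)) \<le> 2 * wt w + 2
     + (length (red (sec False w)) + length (red (sec True w)))"
proof -
  have "cnt win_lossy w \<le> cnt (win [LA, LC, LA]) w + cnt (win [LB, LC, LB]) w"
    by (rule cnt_disj)
  then show ?thesis
    using wt_sec[of w] count_b[OF assms] cnt_bcb[of w]
      wt_red_cc[of "sec False w"] wt_red_cc[of "sec True w"]
      wt_red_length[of "sec False w"] wt_red_length[of "sec True w"]
    by (simp split: if_splits)
qed

text \<open>In state \<open>False\<close> both b and c contribute a letter; in state
  \<open>True\<close> only b does; a switches the state. Without aca, the state \<open>True\<close>
  entered by a is not left before b has contributed c, so three letters of \<open>w\<close>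
  suffice.\<close>

lemma sec_False_ConsD:
  assumes "sec False w = y # r" "distinct_adj w" "\<not> win [LA, LC, LA] w"
  shows "(\<exists>w'. (w = LB # w' \<and> y = LA \<or> w = LC # w' \<and> y = LB) \<and> r = sec False w') \<or>
    (\<exists>w'. (w = LA # LB # w' \<or> w = LA # LC # LB # w') \<and> y = LC \<and> r = sec True w')"
proof -
  obtain x1 x2 x3 v where w: "w = [] \<or> w = [x1] \<or> w = [x1, x2] \<or> w = x1 # x2 # x3 # v"
    by (metis list.exhaust)
  show ?thesis using assms w by (cases x1; cases x2; cases x3) (auto split: if_splits)
qed

lemma sec_True_ConsD:
  assumes "sec True w = y # r" "distinct_adj w" "\<not> win [LA, LC, LA] w"
  shows "(\<exists>w'. (w = LB # w' \<or> w = LC # LB # w') \<and> y = LC \<and> r = sec True w') \<or>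
    (\<exists>w'. (w = LA # LB # w' \<or> w = LC # LA # LB # w') \<and> y = LA \<and> r = sec False w') \<or>
    (\<exists>w'. (w = LA # LC # w' \<or> w = LC # LA # LC # w') \<and> y = LB \<and> r = sec False w')"
proof -
  obtain x1 x2 x3 v where w: "w = [] \<or> w = [x1] \<or> w = [x1, x2] \<or> w = x1 # x2 # x3 # v"
    by (metis list.exhaust)
  show ?thesis using assms w by (cases x1; cases x2; cases x3) (auto split: if_splits)
qed

lemma ex_less_3: "(\<exists>j<3. P j) \<longleftrightarrow> P 0 \<or> P 1 \<or> P (2::nat)"
  by (auto simp: numeral_3_eq_3 numeral_2_eq_2 less_Suc_eq)

lemma win_iff: "win p s \<longleftrightarrow> (\<exists>r. s = p @ r)"
  by (metis append_eq_conv_conj)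

lemma sec_out:
  assumes "x \<noteq> LA" "sec p (x # w) = y # sec p w"
  shows "x = LB \<and> p \<and> y = LC \<or> x = LB \<and> \<not> p \<and> y = LA \<or> x = LC \<and> \<not> p \<and> y = LB"
proof -
  have "sec p w \<noteq> y # sec p w" by (metis not_Cons_self2)
  then show ?thesis using assms by (cases x) (auto split: if_splits)
qed

text \<open>Suppose there is no aca. Then aba in a section can only be spelled by bcb. For cbc, the
  state must switch from \<open>True\<close> to \<open>False\<close> for the letter b and back
  immediately after it, which produces aca after all.\<close>

lemma near_local:
  assumes "win_near (y # sec p w)" "x \<noteq> LA" "sec p (x # w) = y # sec p w" "distinct_adj (x # w)"
  shows "\<exists>j<3. win_lossy (drop j (x # w))"
proof (rule ccontr)
  assume n: "\<not> ?thesis"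
  have d: "distinct_adj w" using assms(4) by (rule distinct_adj_ConsD)
  have n0: "\<not> win_lossy (x # w)" and n1: "\<not> win [LA, LC, LA] w" and n2: "\<not> win [LA, LC, LA] (tl w)"
    using n by (auto simp: ex_less_3 drop_Suc numeral_2_eq_2)
  from assms(1) consider r where "y = LA" "sec p w = LB # LA # r" | r where "y = LC" "sec p w = LB # LC # r"
    unfolding win_iff by auto
  then show False
  proof cases
    case 1
    then have x: "x = LB" "\<not> p" using sec_out[OF assms(2,3)] by auto
    with 1 obtain w' where w': "w = LC # w'" "sec False w' = LA # r"
      using sec_False_ConsD[of w, OF _ d n1] by auto
    moreover have "distinct_adj w'" using d w'(1) by (auto dest: distinct_adj_ConsD)
    ultimately obtain w'' where "w' = LB # w''"
      using sec_False_ConsD[of w' LA r] n2 by auto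
    then show False using n0 x w' by simp
  next
    case 2
    then have x: "x = LB" "p" using sec_out[OF assms(2,3)] by auto
    with 2 obtain w' where w': "w = LA # LC # w' \<or> w = LC # LA # LC # w'" "sec False w' = LC # r"
      using sec_True_ConsD[of w, OF _ d n1] by auto
    then obtain w'' where "w' = LA # w''"
      by (cases w' rule: list.exhaust; cases "hd w'") auto
    then show False using n1 n2 w'(1) by auto
  qed
qed

text \<open>Without aca, bab in a section is spelled by cbc, and cac requires two switches around a
  single b, that is, a window aba.\<close>

lemma third_local:
  assumes "win_third (y # sec p w)" "x \<noteq> LA" "sec p (x # w) = y # sec p w" "distinct_adj (x # w)"
  shows "\<exists>j<3. win_lossy (drop j (x # w)) \<or> win_near (drop j (x # w))"
proof (rule ccontr)
  assume n: "\<not> ?thesis"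
  have d: "distinct_adj w" using assms(4) by (rule distinct_adj_ConsD)
  have n0: "\<not> win_near (x # w)" and n1: "\<not> win [LA, LC, LA] w" "\<not> win_near w"
    and n2: "\<not> win [LA, LC, LA] (tl w)" "\<not> win_near (tl w)"
    using n by (auto simp: ex_less_3 drop_Suc numeral_2_eq_2)
  from assms(1) consider r where "y = LB" "sec p w = LA # LB # r" | r where "y = LC" "sec p w = LA # LC # r"
    unfolding win_iff by auto
  then show False
  proof cases
    case 1
    then have x: "x = LC" "\<not> p" using sec_out[OF assms(2,3)] by auto
    with 1 obtain w' where w': "w = LB # w'" "sec False w' = LB # r"
      using sec_False_ConsD[of w, OF _ d n1(1)] by auto
    moreover have "distinct_adj w'" using d w'(1) by (auto dest: distinct_adj_ConsD)
    ultimately obtain w'' where "w' = LC # w''"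
      using sec_False_ConsD[of w' LB r] n2 by auto
    then show False using n0 x w' by simp
  next
    case 2
    then have x: "x = LB" "p" using sec_out[OF assms(2,3)] by auto
    with 2 obtain w' where w': "w = LA # LB # w' \<or> w = LC # LA # LB # w'" "sec False w' = LC # r"
      using sec_True_ConsD[of w, OF _ d n1(1)] by auto
    then obtain w'' where "w' = LA # w''"
      by (cases w' rule: list.exhaust; cases "hd w'") auto
    then show False using n1 n2 w'(1) by auto
  qed
qed

text \<open>A window of the section is charged to a window of \<open>w\<close> at most two letters
  beyond the letter that spells its beginning, so no window of \<open>w\<close> is charged more than
  three times.\<close>

lemma cnt_sec_le:
  assumes loc: "\<And>x w p y. P (y # sec p w) \<Longrightarrow> x \<noteq> LA \<Longrightarrow> sec p (x # w) = y # sec p w \<Longrightarrow> distinct_adj (x # w) \<Longrightarrow>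
      \<exists>j<3. Q (drop j (x # w))"
    and "\<not> Q []" "distinct_adj w"
  shows "cnt P (sec p w) \<le> 3 * cnt Q w"
proof -
  have "cnt P (sec p w) \<le> cnt (\<lambda>s. \<exists>j<3. Q (drop j s)) w"
    using assms(3)
  proof (induction w arbitrary: p)
    case (Cons x w)
    have d: "distinct_adj w" using Cons.prems by (rule distinct_adj_ConsD)
    consider q where "sec p (x # w) = sec q w" | y where "x \<noteq> LA" "sec p (x # w) = y # sec p w"
      by (cases x; cases p) auto
    then show ?case
    proof cases
      case 1 then show ?thesis using Cons.IH[OF d] by (simp add: trans_le_add2)
    next
      case 2 then show ?thesis using Cons.IH[OF d, of p] loc[OF _ 2 Cons.prems] by auto
    qed
  qed simp
  also have "\<dots> \<le> 3 * cnt Q w"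
    by (rule cnt_nearby) fact
  finally show ?thesis .
qed

section \<open>Reduced sections and sums over the levels of the tree\<close>

abbreviation nxt :: "bool \<Rightarrow> letter list \<Rightarrow> letter list" where
  "nxt p w \<equiv> red (sec p w)"

lemma cnt_nxt_near:
  assumes "distinct_adj w"
  shows "cnt win_near (nxt p w) + length (nxt p w) \<le> 3 * cnt win_lossy w + length (sec p w)"
proof -
  have "cnt win_near (sec p w) \<le> 3 * cnt win_lossy w"
    by (rule cnt_sec_le[OF _ _ assms], rule near_local) simp_all
  moreover have "cnt win_near (nxt p w) + length (nxt p w) \<le> cnt win_near (sec p w) + length (sec p w)"
    by (rule cnt_red) (simp add: min_def)
  ultimately show ?thesis by linarith
qed

lemma cnt_nxt_third:
  assumes "distinct_adj w"
  shows "cnt win_third (nxt p w) + length (nxt p w) \<le>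
    3 * (cnt win_lossy w + cnt win_near w) + length (sec p w)"
proof -
  have "cnt win_third (sec p w) \<le> 3 * cnt (\<lambda>s. win_lossy s \<or> win_near s) w"
    by (rule cnt_sec_le[OF _ _ assms], rule third_local) simp_all
  moreover have "cnt win_third (nxt p w) + length (nxt p w) \<le> cnt win_third (sec p w) + length (sec p w)"
    by (rule cnt_red) (simp add: min_def)
  moreover have "cnt (\<lambda>s. win_lossy s \<or> win_near s) w \<le> cnt win_lossy w + cnt win_near w"
    by (rule cnt_disj)
  moreover have "x \<le> 3 * a \<Longrightarrow> y + l \<le> x + m \<Longrightarrow> a \<le> b + c \<Longrightarrow> y + l \<le> 3 * (b + c) + m"
    for x a y l m b c :: nat by simp
  ultimately show ?thesis by blast
qed

text \<open>Nesting it k times sums over the vertices of level k, with a reduction after every step.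
  It is additive and monotone on reduced words, so an inequality for one word can be summed over a
  level.\<close>

definition sections_sum :: "(letter list \<Rightarrow> nat) \<Rightarrow> letter list \<Rightarrow> nat" where
  "sections_sum f w = f (nxt False w) + f (nxt True w)"

definition pal :: "letter list \<Rightarrow> nat" where
  "pal w = cnt win_lossy w + cnt win_near w + cnt win_third w"

lemma sections_sum_add: "sections_sum (\<lambda>w. f w + g w) w = sections_sum f w + sections_sum g w"
  by (simp add: sections_sum_def)

lemma sections_sum_mult: "sections_sum (\<lambda>w. k * f w) w = k * sections_sum f w"
  by (simp add: sections_sum_def algebra_simps)

lemma sections_sum_const: "sections_sum (\<lambda>w. k) w = 2 * k"
  by (simp add: sections_sum_def)

lemma sections_sum_mono:
  assumes "\<And>v. distinct_adj v \<Longrightarrow> f v \<le> g v"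
  shows "sections_sum f w \<le> sections_sum g w"
  unfolding sections_sum_def by (intro add_mono assms distinct_adj_red)

definition cancelled :: "letter list \<Rightarrow> nat" where
  "cancelled w = (length (sec False w) - length (nxt False w)) + (length (sec True w) - length (nxt True w))"

lemma wt_step': "distinct_adj w \<Longrightarrow> 2 * sections_sum wt w + cnt win_lossy w + cancelled w \<le> 2 * wt w + 2"
  using wt_step[of w] length_red[of "sec False w"] length_red[of "sec True w"]
  by (simp add: cancelled_def sections_sum_def)

lemma near_step: "distinct_adj w \<Longrightarrow> sections_sum (cnt win_near) w \<le> 6 * cnt win_lossy w + cancelled w"
  using cnt_nxt_near[of w False] cnt_nxt_near[of w True]
  by (simp add: cancelled_def sections_sum_def)

lemma third_step:
  "distinct_adj w \<Longrightarrow> sections_sum (cnt win_third) w \<le> 6 * cnt win_lossy w + 6 * cnt win_near w + cancelled w"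
  using cnt_nxt_third[of w False] cnt_nxt_third[of w True]
  by (simp add: cancelled_def sections_sum_def)

text \<open>A word of which no weight is lost in three steps has sections at level two in which any
  three consecutive letters are distinct; such sections are determined by their first two letters.\<close>

lemma wt_three_steps:
  assumes "distinct_adj w"
  shows "84 * sections_sum (sections_sum (sections_sum wt)) w + sections_sum (sections_sum pal) w
    \<le> 84 * wt w + 588"
proof -
  let ?S = sections_sum
  define X0 X1 X2 where "X0 = cnt win_lossy w" "X1 = ?S (cnt win_lossy) w" "X2 = ?S (?S (cnt win_lossy)) w"
  define Y1 Y2 Z2 where "Y1 = ?S (cnt win_near) w" "Y2 = ?S (?S (cnt win_near)) w" "Z2 = ?S (?S (cnt win_third)) w"
  define R0 R1 R2 where "R0 = cancelled w" "R1 = ?S cancelled w" "R2 = ?S (?S cancelled) w"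
  define W0 W1 W2 W3 where "W0 = wt w" "W1 = ?S wt w" "W2 = ?S (?S wt) w" "W3 = ?S (?S (?S wt)) w"
  note defs = X0_X1_X2_def Y1_Y2_Z2_def R0_R1_R2_def W0_W1_W2_W3_def
  note lin = sections_sum_add sections_sum_mult sections_sum_const
  have w0: "2 * W1 + X0 + R0 \<le> 2 * W0 + 2"
    unfolding defs by (rule wt_step'[OF assms])
  have w1: "2 * W2 + X1 + R1 \<le> 2 * W1 + 4"
  proof -
    have "?S (\<lambda>v. 2 * ?S wt v + cnt win_lossy v + cancelled v) w \<le> ?S (\<lambda>v. 2 * wt v + 2) w"
      by (intro sections_sum_mono wt_step')
    then show ?thesis unfolding defs lin by simp
  qed
  have w2: "2 * W3 + X2 + R2 \<le> 2 * W2 + 8"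
  proof -
    have "?S (?S (\<lambda>v. 2 * ?S wt v + cnt win_lossy v + cancelled v)) w \<le> ?S (?S (\<lambda>v. 2 * wt v + 2)) w"
      by (intro sections_sum_mono wt_step')
    then show ?thesis unfolding defs lin by simp
  qed
  have y1: "Y1 \<le> 6 * X0 + R0"
    unfolding defs by (rule near_step[OF assms])
  have y2: "Y2 \<le> 6 * X1 + R1"
  proof -
    have "?S (?S (cnt win_near)) w \<le> ?S (\<lambda>v. 6 * cnt win_lossy v + cancelled v) w"
      by (intro sections_sum_mono near_step)
    then show ?thesis unfolding defs lin by simp
  qed
  have z2: "Z2 \<le> 6 * X1 + 6 * Y1 + R1"
  proof -
    have "?S (?S (cnt win_third)) w \<le> ?S (\<lambda>v. 6 * cnt win_lossy v + 6 * cnt win_near v + cancelled v) w"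
      by (intro sections_sum_mono third_step)
    then show ?thesis unfolding defs lin by simp
  qed
  have "?S (?S pal) w = X2 + Y2 + Z2"
    unfolding defs pal_def[abs_def] lin by simp
  \<comment> \<open>The windows number at most X2 + 12 X1 + 2 R1 + 36 X0 + 6 R0. All coefficients
    are below 42, and 42 times the sum of the three weight inequalities gives 84 = 2 x 42 and 588 =
    42 x 14, where 14 = 2 + 4 + 8.\<close>
  then show ?thesis using w0 w1 w2 y1 y2 z2 unfolding W0_W1_W2_W3_def[symmetric] by linarith
qed

section \<open>Subexponential growth of the automaton group\<close>

definition evset :: "(letter list \<Rightarrow> nat) \<Rightarrow> nat \<Rightarrow> (vertex \<Rightarrow> vertex) set" where
  "evset f n = ev ` {w. distinct_adj w \<and> f w \<le> n}"

text \<open>Finiteness is demanded separately because \<open>card\<close> is 0 on infinite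
  sets.\<close>

definition grow :: "(nat \<Rightarrow> 'a set) \<Rightarrow> real \<Rightarrow> bool" where
  "grow X t \<longleftrightarrow> (\<forall>n. finite (X n)) \<and> (\<exists>C. \<forall>n. real (card (X n)) \<le> C * exp (t * n))"

lemma growE:
  assumes "grow X t"
  obtains C where "C \<ge> 0" "\<And>n. finite (X n)" "\<And>n. real (card (X n)) \<le> C * exp (t * n)"
proof -
  obtain C where C: "\<And>n. real (card (X n)) \<le> C * exp (t * n)" and "\<And>n. finite (X n)"
    using assms by (auto simp: grow_def)
  moreover have "0 \<le> C" using C[of 0] by (simp add: order_trans[OF of_nat_0_le_iff])
  ultimately show ?thesis using that by blast
qed

lemma grow_mono:
  assumes "grow X t" "t \<le> t'"
  shows "grow X t'"
proof -
  obtain C where C: "C \<ge> 0" "\<And>n. finite (X n)" "\<And>n. real (card (X n)) \<le> C * exp (t * n)"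
    using growE[OF assms(1)] by blast
  have "real (card (X n)) \<le> C * exp (t' * n)" for n
  proof -
    have "C * exp (t * n) \<le> C * exp (t' * n)"
      using C(1) assms(2) by (intro mult_left_mono) (auto intro: mult_right_mono)
    then show ?thesis using C(3)[of n] by linarith
  qed
  then show ?thesis using C(2) by (auto simp: grow_def)
qed

lemma grow_subset:
  assumes "grow Y t" "\<And>n. X n \<subseteq> Y n"
  shows "grow X t"
proof -
  obtain C where C: "\<And>n. finite (Y n)" "\<And>n. real (card (Y n)) \<le> C * exp (t * n)"
    using growE[OF assms(1)] by blast
  have "card (X n) \<le> card (Y n)" for n using C(1) assms(2) by (intro card_mono)
  then have "real (card (X n)) \<le> C * exp (t * n)" for n using C(2)[of n] by (meson of_nat_mono order_trans)
  moreover have "finite (X n)" for n using C(1) assms(2) by (rule finite_subset[rotated])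
  ultimately show ?thesis by (auto simp: grow_def)
qed

lemma Suc_le_exp:
  fixes s :: real
  assumes "s > 0"
  obtains D where "D > 0" "\<And>n :: nat. real n + 1 \<le> D * exp (s * n)"
proof
  show "1 / min 1 s > 0" using assms by simp
  fix n :: nat
  have "min 1 s * (real n + 1) \<le> 1 + s * n"
  proof -
    have "min 1 s * real n \<le> s * n" by (intro mult_right_mono) auto
    then show ?thesis by (simp add: algebra_simps)
  qed
  also have "\<dots> \<le> exp (s * n)" by simp
  finally show "real n + 1 \<le> 1 / min 1 s * exp (s * n)"
    using assms by (simp add: field_simps)
qed

text \<open>An element is determined by its sections and its action on the first level. A bound n on
  the sum splits in n + 1 ways between the sections; \<open>t1\<close> strictly between
  \<open>l\<close> and \<open>t\<close> leaves room to absorb this factor.\<close>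

lemma grow_sections:
  assumes "\<And>t. t > l \<Longrightarrow> grow (evset f) t" "t > l"
  shows "grow (evset (sections_sum f)) t"
proof -
  define t1 where "t1 = (l + t) / 2"
  have t1: "t1 > l" "t1 < t" using assms(2) by (auto simp: t1_def)
  obtain C where C: "C \<ge> 0" "\<And>n. finite (evset f n)" "\<And>n. real (card (evset f n)) \<le> C * exp (t1 * n)"
    using growE[OF assms(1)[OF t1(1)]] by blast
  obtain D where D: "D > 0" "\<And>n :: nat. real n + 1 \<le> D * exp ((t - t1) * n)"
    using Suc_le_exp[of "t - t1"] t1 by auto
  define U where "U n = (\<Union>i\<le>n. evset f i \<times> evset f (n - i) \<times> {id, Not})" for n
  have sub: "evset (sections_sum f) n \<subseteq> (\<lambda>(g0, g1, p). wreath g0 g1 p) ` U n" for n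
  proof
    fix g assume "g \<in> evset (sections_sum f) n"
    then obtain w where w: "g = ev w" "sections_sum f w \<le> n" by (auto simp: evset_def)
    let ?i = "f (nxt False w)"
    have "ev (nxt False w) \<in> evset f ?i" "ev (nxt True w) \<in> evset f (n - ?i)" "?i \<le> n"
      using w(2) distinct_adj_red by (auto simp: evset_def sections_sum_def intro!: imageI)
    moreover have "g = wreath (ev (nxt False w)) (ev (nxt True w)) (if flips w then Not else id)"
      unfolding w(1) ev_red by (rule ev_eq_wreath)
    ultimately show "g \<in> (\<lambda>(g0, g1, p). wreath g0 g1 p) ` U n"
      unfolding U_def by (auto intro!: image_eqI[of _ _ "(ev (nxt False w), ev (nxt True w), if flips w then Not else id)"] bexI[of _ ?i])
  qed
  have finU: "finite (U n)" for n using C(2) by (auto simp: U_def)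
  have cardU: "real (card (U n)) \<le> (2 * C\<^sup>2 * D) * exp (t * n)" for n
  proof -
    have "card (U n) \<le> (\<Sum>i\<le>n. card (evset f i \<times> evset f (n - i) \<times> {id :: bool \<Rightarrow> bool, Not}))"
      unfolding U_def by (rule card_UN_le) simp
    then have "real (card (U n)) \<le> (\<Sum>i\<le>n. real (card (evset f i \<times> evset f (n - i) \<times> {id :: bool \<Rightarrow> bool, Not})))"
      unfolding of_nat_sum[symmetric] of_nat_le_iff .
    also have "\<dots> \<le> (\<Sum>i\<le>n. 2 * C\<^sup>2 * exp (t1 * n))"
    proof (rule sum_mono)
      fix i assume i: "i \<in> {..n}"
      have "card {id :: bool \<Rightarrow> bool, Not} \<le> 2" by (simp add: card_insert_le_m1)
      then have "real (card (evset f i \<times> evset f (n - i) \<times> {id :: bool \<Rightarrow> bool, Not}))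
          \<le> real (card (evset f i)) * (real (card (evset f (n - i))) * 2)"
        unfolding card_cartesian_product of_nat_mult
        by (intro mult_left_mono) auto
      also have "\<dots> \<le> (C * exp (t1 * i)) * (C * exp (t1 * real (n - i)) * 2)"
        using C by (intro mult_mono) auto
      also have "\<dots> = 2 * C\<^sup>2 * (exp (t1 * i) * exp (t1 * real (n - i)))"
        by (simp add: power2_eq_square)
      also have "exp (t1 * i) * exp (t1 * real (n - i)) = exp (t1 * n)"
        using i by (simp add: exp_add[symmetric] of_nat_diff algebra_simps)
      finally show "real (card (evset f i \<times> evset f (n - i) \<times> {id :: bool \<Rightarrow> bool, Not})) \<le> 2 * C\<^sup>2 * exp (t1 * n)" .
    qed
    also have "\<dots> = 2 * C\<^sup>2 * exp (t1 * n) * (real n + 1)" by simp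
    also have "\<dots> \<le> 2 * C\<^sup>2 * exp (t1 * n) * (D * exp ((t - t1) * n))"
      by (intro mult_left_mono D) auto
    also have "\<dots> = (2 * C\<^sup>2 * D) * (exp (t1 * n) * exp ((t - t1) * n))" by simp
    also have "exp (t1 * n) * exp ((t - t1) * n) = exp (t * n)"
      by (simp add: exp_add[symmetric] algebra_simps)
    finally show ?thesis .
  qed
  have "grow (\<lambda>n. (\<lambda>(g0, g1, p). wreath g0 g1 p) ` U n) t"
    unfolding grow_def
  proof (intro conjI exI[of _ "2 * C\<^sup>2 * D"] allI)
    fix n
    have "card ((\<lambda>(g0, g1, p). wreath g0 g1 p) ` U n) \<le> card (U n)" by (rule card_image_le[OF finU])
    then show "real (card ((\<lambda>(g0, g1, p). wreath g0 g1 p) ` U n)) \<le> 2 * C\<^sup>2 * D * exp (t * n)"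
      using cardU[of n] by linarith
  qed (use finU in auto)
  then show ?thesis by (rule grow_subset) (rule sub)
qed

section \<open>Reduced words counted by their windows xyx\<close>

definition rwords :: "nat \<Rightarrow> letter list set" where
  "rwords l = {w. distinct_adj w \<and> length w = l}"

lemma finite_letters: "finite (UNIV :: letter set)"
  by (simp add: UNIV_letter)

lemma finite_rwords: "finite (rwords l)" and card_rwords: "card (rwords l) \<le> 3 ^ l"
proof -
  have fin: "finite {w :: letter list. set w \<subseteq> UNIV \<and> length w = l}"
    by (rule finite_lists_length_eq) (simp add: UNIV_letter)
  have sub: "rwords l \<subseteq> {w. set w \<subseteq> UNIV \<and> length w = l}" by (auto simp: rwords_def)
  show "finite (rwords l)" by (rule finite_subset[OF sub fin])
  have "card {w :: letter list. set w \<subseteq> UNIV \<and> length w = l} = card (UNIV :: letter set) ^ l"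
    by (rule card_lists_length_eq) (simp add: UNIV_letter)
  moreover have "card (UNIV :: letter set) = 3" by (simp add: UNIV_letter)
  ultimately show "card (rwords l) \<le> 3 ^ l" using card_mono[OF fin sub] by metis
qed

lemma pal_Cons3: "x \<noteq> y \<Longrightarrow> y \<noteq> z \<Longrightarrow> pal (x # y # z # v) = of_bool (x = z) + pal (y # z # v)"
  by (cases x; cases y; cases z) (auto simp: pal_def)

text \<open>A reduced word of at least two letters has two reduced extensions by one letter in
  front; exactly one of them creates a window xyx. Hence the factor 1 + z per letter. The constant 9
  covers the words of length at most two.\<close>

lemma sum_pal:
  fixes z :: real
  assumes z: "0 \<le> z" "z \<le> 1"
  shows "(\<Sum>w\<in>rwords l. z ^ pal w) \<le> 9 * (1 + z) ^ l"
proof (induction l)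
  case 0
  have "rwords 0 = {[]}" by (auto simp: rwords_def)
  then show ?case by (simp add: pal_def)
next
  case (Suc l)
  show ?case
  proof (cases "l < 2")
    case True
    have "(\<Sum>w\<in>rwords (Suc l). z ^ pal w) \<le> (\<Sum>w\<in>rwords (Suc l). 1)"
      using z by (intro sum_mono power_le_one)
    also have "\<dots> \<le> real (3 ^ Suc l)" using card_rwords[of "Suc l"] by (simp del: power_Suc)
    also have "\<dots> \<le> 9" using True by (cases l) auto
    also have "\<dots> \<le> 9 * (1 + z) ^ Suc l" using z one_le_power[of "1 + z" "Suc l"] by simp
    finally show ?thesis .
  next
    case False
    have eq: "rwords (Suc l) = (\<lambda>(w, x). x # w) ` Sigma (rwords l) (\<lambda>w. {x. x \<noteq> hd w})"
    proof
      show "rwords (Suc l) \<subseteq> (\<lambda>(w, x). x # w) ` Sigma (rwords l) (\<lambda>w. {x. x \<noteq> hd w})"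
      proof
        fix w assume "w \<in> rwords (Suc l)"
        then obtain x v where "w = x # v" "length v = l" "distinct_adj (x # v)"
          by (auto simp: rwords_def length_Suc_conv)
        then show "w \<in> (\<lambda>(w, x). x # w) ` Sigma (rwords l) (\<lambda>w. {x. x \<noteq> hd w})"
          using False by (auto simp: rwords_def distinct_adj_Cons intro!: image_eqI[of _ _ "(v, x)"])
      qed
    qed (auto simp: rwords_def distinct_adj_Cons)
    have "(\<Sum>w\<in>rwords (Suc l). z ^ pal w) = (\<Sum>(w, x)\<in>Sigma (rwords l) (\<lambda>w. {x. x \<noteq> hd w}). z ^ pal (x # w))"
      unfolding eq by (subst sum.reindex) (auto simp: inj_on_def intro!: sum.cong)
    also have "\<dots> = (\<Sum>w\<in>rwords l. \<Sum>x\<in>{x. x \<noteq> hd w}. z ^ pal (x # w))"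
      by (rule sum.Sigma[symmetric]) (auto simp: finite_rwords intro: finite_subset[OF subset_UNIV] finite_letters)
    also have "\<dots> = (\<Sum>w\<in>rwords l. z ^ pal w * (1 + z))"
    proof (rule sum.cong)
      fix w assume w: "w \<in> rwords l"
      obtain x y v where xy: "w = x # y # v" using w False by (cases w; cases "tl w") (auto simp: rwords_def)
      have "x \<noteq> y" using w xy by (auto simp: rwords_def)
      define u where "u = (if LA \<notin> {x, y} then LA else if LB \<notin> {x, y} then LB else LC)"
      have "x' \<noteq> x \<longleftrightarrow> x' = y \<or> x' = u" for x'
        using \<open>x \<noteq> y\<close> by (cases x; cases y; cases x') (auto simp: u_def)
      moreover have "u \<noteq> x" "u \<noteq> y"
        using \<open>x \<noteq> y\<close> by (cases x; cases y; auto simp: u_def)+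
      ultimately have u: "u \<noteq> x" "u \<noteq> y" "{x'. x' \<noteq> x} = {y, u}" by auto
      show "(\<Sum>x\<in>{x. x \<noteq> hd w}. z ^ pal (x # w)) = z ^ pal w * (1 + z)"
        using u \<open>x \<noteq> y\<close> by (simp add: xy pal_Cons3 algebra_simps)
    qed simp
    also have "\<dots> = (\<Sum>w\<in>rwords l. z ^ pal w) * (1 + z)" by (simp add: sum_distrib_right)
    also have "\<dots> \<le> 9 * (1 + z) ^ l * (1 + z)" using Suc z by (intro mult_right_mono) auto
    finally show ?thesis by (simp add: mult_ac)
  qed
qed

text \<open>An exponential Markov bound: every word counted has exp (t (n - length - M pal)) at
  least 1. By \<open>sum_pal\<close> and the choice of \<open>M\<close>, the sum of these terms over
  each length is at most 9 exp (t n); the n + 1 lengths cost the step from \<open>t\<close> to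
  \<open>t'\<close>.\<close>

lemma grow_pal:
  assumes t: "t > 0" and M: "1 + exp (- t * real M) \<le> exp t" and t': "t < t'"
  shows "grow (evset (\<lambda>w. length w + M * pal w)) t'"
proof -
  define W where "W n = {w. distinct_adj w \<and> length w + M * pal w \<le> n}" for n
  define z where "z = exp (- t * real M)"
  have z: "0 \<le> z" "z \<le> 1" using t by (auto simp: z_def)
  obtain D where D: "D > 0" "\<And>n :: nat. real n + 1 \<le> D * exp ((t' - t) * n)"
    using Suc_le_exp[of "t' - t"] t' by auto
  have sub: "W n \<subseteq> (\<Union>l\<le>n. rwords l)" for n by (auto simp: W_def rwords_def)
  have fin: "finite (W n)" for n by (rule finite_subset[OF sub]) (auto simp: finite_rwords)
  have card: "real (card (W n)) \<le> 9 * D * exp (t' * n)" for n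
  proof -
    let ?f = "\<lambda>w. exp (t * n) * (exp (- t) ^ length w * z ^ pal w)"
    have "real (card (W n)) = (\<Sum>w\<in>W n. 1)" by simp
    also have "\<dots> \<le> (\<Sum>w\<in>W n. ?f w)"
    proof (rule sum_mono)
      fix w assume "w \<in> W n"
      then have "real (length w + M * pal w) \<le> real n"
        by (simp only: W_def mem_Collect_eq of_nat_le_iff)
      then have "0 \<le> t * (real n - (real (length w) + real M * real (pal w)))" using t by simp
      then have "1 \<le> exp (t * (real n - (real (length w) + real M * real (pal w))))" by simp
      also have "\<dots> = ?f w"
        unfolding z_def exp_of_nat_mult[symmetric] exp_add[symmetric] by (simp add: algebra_simps)
      finally show "1 \<le> ?f w" .
    qed
    also have "\<dots> \<le> (\<Sum>w\<in>(\<Union>l\<le>n. rwords l). ?f w)"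
      using z by (intro sum_mono2 sub) (auto simp: finite_rwords)
    also have "\<dots> = (\<Sum>l\<le>n. \<Sum>w\<in>rwords l. ?f w)"
      by (rule sum.UNION_disjoint) (auto simp: finite_rwords, auto simp: rwords_def)
    also have "\<dots> = (\<Sum>l\<le>n. exp (t * n) * exp (- t) ^ l * (\<Sum>w\<in>rwords l. z ^ pal w))"
      unfolding sum_distrib_left by (intro sum.cong refl) (auto simp: rwords_def)
    also have "\<dots> \<le> (\<Sum>l\<le>n. exp (t * n) * 9)"
    proof (rule sum_mono)
      fix l
      have "exp (- t) * (1 + z) \<le> exp (- t) * exp t" using M unfolding z_def by (intro mult_left_mono) auto
      then have "exp (- t) * (1 + z) \<le> 1" by (simp add: exp_minus)
      then have "(exp (- t) * (1 + z)) ^ l \<le> 1" using z by (intro power_le_one) auto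
      then have *: "exp (- t) ^ l * (1 + z) ^ l \<le> 1" by (simp add: power_mult_distrib)
      have "exp (- t) ^ l * (\<Sum>w\<in>rwords l. z ^ pal w) \<le> exp (- t) ^ l * (9 * (1 + z) ^ l)"
        by (intro mult_left_mono sum_pal z) auto
      then have "exp (- t) ^ l * (\<Sum>w\<in>rwords l. z ^ pal w) \<le> 9" using * by linarith
      then show "exp (t * n) * exp (- t) ^ l * (\<Sum>w\<in>rwords l. z ^ pal w) \<le> exp (t * n) * 9"
        unfolding mult.assoc by (intro mult_left_mono) auto
    qed
    also have "\<dots> = 9 * exp (t * n) * (real n + 1)" by simp
    also have "\<dots> \<le> 9 * exp (t * n) * (D * exp ((t' - t) * n))" by (intro mult_left_mono D) auto
    also have "\<dots> = 9 * D * (exp (t * n) * exp ((t' - t) * n))" by simp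
    also have "exp (t * n) * exp ((t' - t) * n) = exp (t' * n)"
      by (simp add: exp_add[symmetric] algebra_simps)
    finally show ?thesis .
  qed
  show ?thesis unfolding grow_def
  proof (intro conjI exI[of _ "9 * D"] allI)
    fix n
    have e: "evset (\<lambda>w. length w + M * pal w) n = ev ` W n" by (simp add: evset_def W_def)
    show "finite (evset (\<lambda>w. length w + M * pal w) n)" unfolding e using fin by simp
    have "card (ev ` W n) \<le> card (W n)" by (rule card_image_le[OF fin])
    then show "real (card (evset (\<lambda>w. length w + M * pal w) n)) \<le> 9 * D * exp (t' * n)"
      unfolding e using card[of n] by linarith
  qed
qed

text \<open>If the level-two sections have at most n / M windows, their penalty is at most n and
  their total length at most n + 3. Otherwise more than n / M is lost in
  \<open>wt_three_steps\<close>, and the weight shrinks by a factor of about 1 - 1 / (84 M).\<close>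

lemma weight_or_pal:
  assumes w: "distinct_adj w" "wt w \<le> n" and M: "M \<ge> 1"
  shows "sections_sum (sections_sum (\<lambda>w. length w + M * pal w)) w \<le> 2 * n + 3 \<or>
    84 * M * sections_sum (sections_sum (sections_sum wt)) w \<le> (84 * M - 1) * n + 588 * M"
proof (cases "M * sections_sum (sections_sum pal) w \<le> n")
  case True
  have "sections_sum wt w \<le> n + 1" using wt_step'[OF w(1)] w(2) by linarith
  moreover have "2 * sections_sum (sections_sum wt) w \<le> 2 * sections_sum wt w + 4"
  proof -
    have "sections_sum (\<lambda>v. 2 * sections_sum wt v) w \<le> sections_sum (\<lambda>v. 2 * wt v + 2) w"
      by (intro sections_sum_mono) (use wt_step' in fastforce)
    then show ?thesis unfolding sections_sum_add sections_sum_mult sections_sum_const by simp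
  qed
  moreover have "sections_sum (sections_sum length) w \<le> sections_sum (sections_sum wt) w"
    by (intro sections_sum_mono length_le_wt)
  moreover have "sections_sum (sections_sum (\<lambda>w. length w + M * pal w)) w
      = sections_sum (sections_sum length) w + M * sections_sum (sections_sum pal) w"
    unfolding sections_sum_add sections_sum_mult by simp
  ultimately show ?thesis using True by linarith
next
  case False
  let ?W = "sections_sum (sections_sum (sections_sum wt)) w" and ?e = "sections_sum (sections_sum pal) w"
  have "84 * ?W + ?e \<le> 84 * n + 588" using wt_three_steps[OF w(1)] w(2) by linarith
  then have "M * (84 * ?W + ?e) \<le> M * (84 * n + 588)" by (rule mult_le_mono2)
  then have "84 * M * ?W + M * ?e \<le> 84 * M * n + 588 * M" by (simp add: algebra_simps)
  moreover have "(84 * M - 1) * n + n = 84 * M * n" using M by (simp add: algebra_simps)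
  ultimately show ?thesis using False by linarith
qed

text \<open>By \<open>weight_or_pal\<close> an element of weight at most n is either counted at a
  rate just above \<open>l\<close> with argument (1 - 1 / q) n + 7, or at the rate l / 5 with
  argument 2 n + 3. Both products stay below l n up to a constant.\<close>

lemma grow_step:
  assumes "l > 0" "\<And>t. t > l \<Longrightarrow> grow (evset wt) t"
  shows "\<exists>t. 0 < t \<and> t < l \<and> grow (evset wt) t"
proof -
  have "exp (- (l / 8)) < 1" "0 < exp (l / 8) - 1" using assms(1) by auto
  \<comment> \<open>The penalty must be large enough to push the rate of \<open>grow_pal\<close>
    down to l / 8, since this rate has to survive the doubling of n.\<close>
  then obtain M0 where M0: "exp (- (l / 8)) ^ M0 < exp (l / 8) - 1"
    using real_arch_pow_inv by blast
  define M where "M = Suc M0"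
  have M1: "M \<ge> 1" by (simp add: M_def)
  have "exp (- (l / 8)) ^ M \<le> exp (- (l / 8)) ^ M0"
    unfolding M_def using assms(1) by (intro power_decreasing) auto
  moreover have "exp (- (l / 8) * real M) = exp (- (l / 8)) ^ M" by (rule exp_of_nat2_mult)
  ultimately have M: "1 + exp (- (l / 8) * real M) \<le> exp (l / 8)" using M0 by linarith
  have g2: "grow (evset (sections_sum (sections_sum (\<lambda>w. length w + M * pal w)))) t" if "t > l / 8" for t
    using that by (intro grow_sections[of "l / 8"] grow_pal[OF _ M]) (use assms(1) in auto)
  have g3: "grow (evset (sections_sum (sections_sum (sections_sum wt)))) t" if "t > l" for t
    using that by (intro grow_sections[of l] assms(2))
  define q where "q = 84 * real M"
  have q: "q > 1" using M1 by (simp add: q_def)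
  \<comment> \<open>The rate must exceed \<open>l\<close> for \<open>g3\<close> to apply, but r (1 -
    1 / q) must stay below \<open>l\<close>; the denominator q - 1 / 2 lies between q - 1 and
    q.\<close>
  define r where "r = l * q / (q - 1 / 2)"
  have r: "r > l" "r * (1 - 1 / q) < l"
    using q assms(1) by (simp_all add: r_def field_simps)
  then have r0: "r > 0" using assms(1) by linarith
  define t where "t = max (r * (1 - 1 / q)) (2 * l / 5)"
  have t: "0 < t" "t < l" using r assms(1) by (auto simp: t_def)
  define A where "A = evset (sections_sum (sections_sum (sections_sum wt)))"
  define B where "B = evset (sections_sum (sections_sum (\<lambda>w. length w + M * pal w)))"
  define m where "m n = ((84 * M - 1) * n + 588 * M) div (84 * M)" for n
  obtain C1 where C1: "C1 \<ge> 0" "\<And>n. finite (A n)" "\<And>n. real (card (A n)) \<le> C1 * exp (r * n)"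
    using growE[OF g3[OF r(1)]] unfolding A_def by blast
  obtain C2 where C2: "C2 \<ge> 0" "\<And>n. finite (B n)" "\<And>n. real (card (B n)) \<le> C2 * exp (l / 5 * n)"
    using growE[OF g2[of "l / 5"]] assms(1) unfolding B_def by auto
  have sub: "evset wt n \<subseteq> A (m n) \<union> B (2 * n + 3)" for n
  proof
    fix g assume "g \<in> evset wt n"
    then obtain w where w: "g = ev w" "distinct_adj w" "wt w \<le> n" by (auto simp: evset_def)
    have "84 * M > 0" using M1 by simp
    then have "84 * M * v \<le> (84 * M - 1) * n + 588 * M \<Longrightarrow> v \<le> m n" for v
      unfolding m_def by (simp add: less_eq_div_iff_mult_less_eq mult.commute)
    then show "g \<in> A (m n) \<union> B (2 * n + 3)"
      using weight_or_pal[OF w(2,3) M1] w(1,2) unfolding A_def B_def evset_def by blast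
  qed
  have m: "real (m n) \<le> (1 - 1 / q) * n + 7" for n
  proof -
    have "real (m n) \<le> real ((84 * M - 1) * n + 588 * M) / real (84 * M)"
      unfolding m_def by (rule of_nat_div_le_of_nat)
    also have "real (84 * M - 1) = q - 1" using M1 by (simp add: q_def of_nat_diff)
    then have "real ((84 * M - 1) * n + 588 * M) / real (84 * M) = ((q - 1) * n + 7 * q) / q"
      by (simp only: of_nat_add of_nat_mult) (simp add: q_def)
    also have "\<dots> = (1 - 1 / q) * n + 7" using q by (simp add: field_simps)
    finally show ?thesis .
  qed
  have "real (card (evset wt n)) \<le> (C1 * exp (7 * r) + C2 * exp (3 * l / 5)) * exp (t * n)" for n
  proof -
    have "card (evset wt n) \<le> card (A (m n) \<union> B (2 * n + 3))"
      using C1(2) C2(2) sub by (intro card_mono) auto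
    also have "\<dots> \<le> card (A (m n)) + card (B (2 * n + 3))" by (rule card_Un_le)
    finally have "real (card (evset wt n)) \<le> real (card (A (m n))) + real (card (B (2 * n + 3)))" by linarith
    also have "\<dots> \<le> C1 * exp (r * m n) + C2 * exp (l / 5 * real (2 * n + 3))"
      by (intro add_mono C1 C2)
    also have "C1 * exp (r * m n) \<le> C1 * exp (7 * r + t * n)"
    proof -
      have "r * real (m n) \<le> r * ((1 - 1 / q) * n + 7)" using m[of n] r0 by (intro mult_left_mono) auto
      also have "\<dots> = r * (1 - 1 / q) * n + 7 * r" by (simp add: algebra_simps)
      also have "r * (1 - 1 / q) * n \<le> t * n" unfolding t_def by (intro mult_right_mono) auto
      finally have "r * real (m n) \<le> 7 * r + t * n" by simp
      then show ?thesis using C1(1) by (intro mult_left_mono) auto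
    qed
    also have "C2 * exp (l / 5 * real (2 * n + 3)) \<le> C2 * exp (3 * l / 5 + t * n)"
    proof -
      have "2 * l / 5 * n \<le> t * n" unfolding t_def by (intro mult_right_mono) auto
      then have "l / 5 * real (2 * n + 3) \<le> 3 * l / 5 + t * n" by (simp add: algebra_simps)
      then show ?thesis using C2(1) by (intro mult_left_mono) auto
    qed
    finally show ?thesis by (simp add: exp_add algebra_simps)
  qed
  moreover have "finite (evset wt n)" for n
    by (rule finite_subset[OF sub]) (simp add: C1(2) C2(2))
  ultimately have "grow (evset wt) t" unfolding grow_def by blast
  then show ?thesis using t by blast
qed

text \<open>Otherwise the admissible positive rates have a positive infimum. All rates above the
  infimum are admissible, so \<open>grow_step\<close> yields one below it.\<close>

theorem subexponential_growth:
  assumes "t > 0"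
  shows "grow (evset wt) t"
proof (rule ccontr)
  assume n: "\<not> grow (evset wt) t"
  define S where "S = {s. s > 0 \<and> grow (evset wt) s}"
  have tS: "t \<le> s" if "s \<in> S" for s
    using that n grow_mono[of "evset wt" s t] by (cases "s \<le> t") (auto simp: S_def)
  \<comment> \<open>With penalty 0, \<open>grow_pal\<close> merely counts reduced words and provides
    a first admissible rate, because 2 is at most e.\<close>
  have "1 + exp (- 1 * real 0) \<le> exp (1 :: real)" using exp_ge_add_one_self[of 1] by simp
  then have "grow (evset (\<lambda>w. length w + 0 * pal w)) 2" by (rule grow_pal[rotated]) auto
  moreover have "evset wt n \<subseteq> evset (\<lambda>w. length w + 0 * pal w) n" for n
    by (auto simp: evset_def intro!: imageI order_trans[OF length_le_wt])
  ultimately have "grow (evset wt) 2" by (rule grow_subset)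
  then have "2 \<in> S" by (simp add: S_def)
  then have ne: "S \<noteq> {}" by blast
  have bdd: "bdd_below S" using tS by (intro bdd_belowI)
  have pos: "Inf S > 0" using cInf_greatest[OF ne tS] assms by linarith
  have "grow (evset wt) s" if s: "s > Inf S" for s
  proof -
    obtain x where "x \<in> S" "x < s" using cInf_lessD[OF ne s] by blast
    then show ?thesis using grow_mono[of "evset wt" x s] by (simp add: S_def)
  qed
  from grow_step[OF pos this] obtain x where "x \<in> S" "x < Inf S" by (auto simp: S_def)
  then show False using cInf_lower[OF _ bdd] by fastforce
qed

section \<open>Balls with small boundary\<close>

lemma finite_evset: "finite (evset wt n)"
  using subexponential_growth[of 1] by (auto simp: grow_def)

lemma evset_mono: "m \<le> n \<Longrightarrow> evset wt m \<subseteq> evset wt n"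
  by (auto simp: evset_def)

lemma card_evset_pos: "card (evset wt n) > 0"
proof -
  have "ev [] \<in> evset wt n" unfolding evset_def by (intro imageI) auto
  then show ?thesis using finite_evset card_gt_0_iff by blast
qed

text \<open>Otherwise balls would grow by the factor 1 + e in every \<open>k\<close> steps, hence
  exponentially. The gap \<open>k\<close> is arbitrary because it will bound the weights of the
  words theta^i(x), not only of single letters.\<close>

lemma folner_evset:
  assumes "e > 0"
  obtains n where "real (card (evset wt (n + k))) \<le> (1 + e) * real (card (evset wt n))"
proof (rule ccontr)
  assume "\<not> thesis"
  then have n: "real (card (evset wt (n + k))) > (1 + e) * real (card (evset wt n))" for n
    using that by (meson not_le)
  have lower: "(1 + e) ^ j \<le> real (card (evset wt (j * k)))" for j
  proof (induction j)
    case 0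
    then show ?case using card_evset_pos[of 0] by simp
  next
    case (Suc j)
    have "(1 + e) ^ Suc j \<le> (1 + e) * real (card (evset wt (j * k)))"
      using Suc assms by simp
    also have "\<dots> \<le> real (card (evset wt (j * k + k)))" using n[of "j * k"] by simp
    finally show ?case by (simp add: add.commute)
  qed
  \<comment> \<open>This makes exp (t k) at most the square root x of 1 + e, so that x^(2 j) is at
    most C x^j and the powers of x are bounded.\<close>
  define t where "t = ln (1 + e) / (2 * (real k + 1))"
  have t: "t > 0" using assms by (simp add: t_def)
  obtain C where C: "C \<ge> 0" "\<And>n. real (card (evset wt n)) \<le> C * exp (t * n)"
    using growE[OF subexponential_growth[OF t]] by metis
  define x where "x = exp (ln (1 + e) / 2)"
  have x: "x > 1" "x * x = 1 + e" using assms by (auto simp: x_def exp_add[symmetric])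
  have "x ^ j \<le> C" for j
  proof -
    have "t * real k \<le> ln (1 + e) / 2" using assms by (simp add: t_def field_simps)
    then have "exp (t * real k) \<le> x" by (simp add: x_def)
    then have "exp (t * real k) ^ j \<le> x ^ j" by (intro power_mono) auto
    moreover have "exp (t * real (j * k)) = exp (t * real k) ^ j"
      by (simp add: exp_of_nat_mult[symmetric] mult_ac)
    ultimately have "C * exp (t * real (j * k)) \<le> C * x ^ j"
      using C(1) by (simp add: mult_left_mono)
    then have "x ^ j * x ^ j \<le> C * x ^ j"
      using lower[of j] C(2)[of "j * k"] by (simp add: x(2)[symmetric] power_mult_distrib)
    then show ?thesis using x(1) by (simp add: mult_le_cancel_right)
  qed
  moreover obtain j where "C < x ^ j" using real_arch_pow[OF x(1)] by blast
  ultimately show False by (meson not_le)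
qed

section \<open>Relations in the finitely presented group\<close>

lemma gwords_UNIV [simp]: "w \<in> gwords UNIV"
  by (simp add: gwords_def)

definition gteq :: "gen gword \<Rightarrow> gen gword \<Rightarrow> bool" where
  "gteq u v \<longleftrightarrow> (u, v) \<in> pres_rel UNIV gt_relations"

lemma gteq_refl [simp]: "gteq u u" by (simp add: gteq_def pres_rel.refl)
lemma gteq_sym: "gteq u v \<Longrightarrow> gteq v u" unfolding gteq_def by (rule pres_rel.sym)
lemma gteq_trans [trans]: "gteq u v \<Longrightarrow> gteq v w \<Longrightarrow> gteq u w" unfolding gteq_def by (rule pres_rel.trans)
lemma gteq_append: "gteq u u' \<Longrightarrow> gteq v v' \<Longrightarrow> gteq (u @ v) (u' @ v')"
  unfolding gteq_def by (rule pres_rel_append)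
lemma gteq_relation: "(p, q) \<in> gt_relations \<Longrightarrow> gteq p q"
  unfolding gteq_def using pres_rel.relation[of "[]" UNIV "[]" p q] by simp
lemma gteq_cancel: "gteq [(x, e), (x, \<not> e)] []"
  unfolding gteq_def using pres_rel.cancel[of "[]" UNIV "[]" x e] by simp
lemma gteq_cancel': "gteq [(x, False), (x, True)] []" "gteq [(x, True), (x, False)] []"
  using gteq_cancel[of x False] gteq_cancel[of x True] by simp_all

fun gl :: "letter \<Rightarrow> gen" where
  "gl LA = Ga" | "gl LB = Gb" | "gl LC = Gc"

definition gw :: "letter list \<Rightarrow> gen gword" where
  "gw w = map (\<lambda>x. (gl x, True)) w"

lemma gw_simps [simp]: "gw [] = []" "gw (x # w) = (gl x, True) # gw w" "gw (u @ v) = gw u @ gw v"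
  by (auto simp: gw_def)

text \<open>The letters \<open>a\<close>, \<open>b\<close>, \<open>c\<close> are involutions, so signs can be ignored in words without \<open>s\<close>.\<close>

fun strip :: "gen gword \<Rightarrow> letter list" where
  "strip [] = []"
| "strip ((Ga, e) # w) = LA # strip w"
| "strip ((Gb, e) # w) = LB # strip w"
| "strip ((Gc, e) # w) = LC # strip w"
| "strip ((Gs, e) # w) = strip w"

subsection \<open>Soundness\<close>

text \<open>\<open>lift n W\<close> spells \<open>s\<^sup>-\<^sup>n W s\<^sup>m\<close>, where \<open>m\<close> balances the exponents of \<open>s\<close>, after all letters
  \<open>s\<close> have been moved out. It is meaningful if \<open>n\<close> is large, so that no prefix of \<open>W\<close> exhausts it.\<close>

fun lift :: "int \<Rightarrow> gen gword \<Rightarrow> letter list" where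
  "lift n [] = []"
| "lift n ((Ga, e) # w) = (subst ^^ nat n) [LA] @ lift n w"
| "lift n ((Gb, e) # w) = (subst ^^ nat n) [LB] @ lift n w"
| "lift n ((Gc, e) # w) = (subst ^^ nat n) [LC] @ lift n w"
| "lift n ((Gs, e) # w) = lift (if e then n - 1 else n + 1) w"

fun sexp :: "gen gword \<Rightarrow> int" where
  "sexp [] = 0"
| "sexp ((x, e) # w) = (if x = Gs then if e then 1 else - 1 else 0) + sexp w"

lemma sexp_append [simp]: "sexp (u @ v) = sexp u + sexp v"
  by (induction u rule: sexp.induct) auto

lemma sexp_gw [simp]: "sexp (gw w) = 0"
proof (induction w)
  case (Cons x w) then show ?case by (cases x) auto
qed simp

lemma lift_append: "lift n (u @ v) = lift n u @ lift (n - sexp u) v"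
  by (induction n u rule: lift.induct) (auto simp: algebra_simps)

lemma subst_pow_append [simp]: "(subst ^^ k) (u @ v) = (subst ^^ k) u @ (subst ^^ k) v"
  by (induction k) auto

lemma subst_pow_Cons: "(subst ^^ k) (x # v) = (subst ^^ k) [x] @ (subst ^^ k) v"
  using subst_pow_append[of k "[x]" v] by simp

lemma subst_pow_Nil [simp]: "(subst ^^ k) [] = []"
  by (induction k) auto

lemma ev_subst_pow_cong: "ev ((subst ^^ k) u) = ev ((subst ^^ k) v) \<longleftrightarrow> ev u = ev v"
  by (induction k arbitrary: u v) (auto simp: ev_subst_cong)

lemma lift_strip: "Gs \<notin> fst ` set w \<Longrightarrow> lift n w = (subst ^^ nat n) (strip w)"
  by (induction w rule: strip.induct) (auto simp: subst_pow_Cons[of _ _ "_ # _"] subst_pow_Cons[of _ _ "strip _"])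

lemma sexp_strip: "Gs \<notin> fst ` set w \<Longrightarrow> sexp w = 0"
  by (induction w rule: sexp.induct) auto

lemma strip_gw: "strip (gw w) = w" "Gs \<notin> fst ` set (gw w)"
proof (induction w)
  case (Cons x w)
  { case 1 show ?case using Cons by (cases x) auto }
  { case 2 show ?case using Cons by (cases x) auto }
qed auto

lemma lift_gw: "lift n (gw w) = (subst ^^ nat n) w"
  using lift_strip[of "gw w"] strip_gw by simp

lemma ev_eq_id_by_red: "\<not> flips w \<Longrightarrow> red (sec False w) = [] \<Longrightarrow> red (sec True w) = [] \<Longrightarrow> ev w = id"
  using ev_red[of "sec False w"] ev_red[of "sec True w"] by (simp add: ev_eq_id_iff[of w])

text \<open>Both first-level sections of every relator cancel freely, so no deeper level has to be
  inspected.\<close>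

lemma relators_sound:
  assumes "r \<in> gt_relators"
  shows "Gs \<notin> fst ` set r" "ev (strip r) = id"
proof -
  have n: "wpow w 2 = w @ w" "wpow w 4 = w @ w @ w @ w" for w :: "gen gword"
    by (simp_all add: wpow_def numeral_eq_Suc)
  show "Gs \<notin> fst ` set r"
    using assms by (auto simp: gt_relators_def Let_def n gletter_def wcomm_def winv_def)
  show "ev (strip r) = id"
    using assms
    by (auto simp: gt_relators_def Let_def n gletter_def wcomm_def winv_def simp del: ev.simps
        intro!: ev_eq_id_by_red)
qed

text \<open>The relation for x becomes theta^(n + 1)(x) = theta^n(theta(x)). This needs
  \<open>n\<close> nonnegative, because \<open>nat\<close> truncates the exponent.\<close>

lemma relation_sound:
  assumes "(p, q) \<in> gt_relations" "n \<ge> 0"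
  shows "sexp p = sexp q \<and> ev (lift n p) = ev (lift n q)"
proof -
  have "(subst ^^ nat (n + 1)) u = (subst ^^ nat n) (subst u)" for u
    using assms(2) by (simp add: nat_add_distrib funpow_swap1)
  moreover have "ev ((subst ^^ nat n) (strip r)) = id" "sexp r = 0" "lift n r = (subst ^^ nat n) (strip r)"
    if "r \<in> gt_relators" for r
    using relators_sound[OF that] ev_subst_pow_cong[of "nat n" "strip r" "[]"]
    by (auto simp: lift_strip sexp_strip)
  ultimately show ?thesis
    using assms(1) by (auto simp: gt_relations_def Let_def gletter_def wconj_def winv_def subst_pow_Cons[of _ _ "_ # _"])
qed

lemma gteq_sound:
  assumes "gteq u v"
  shows "sexp u = sexp v" "\<exists>N. \<forall>n\<ge>N. ev (lift n u) = ev (lift n v)"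
proof -
  have "sexp u = sexp v \<and> (\<exists>N. \<forall>n\<ge>N. ev (lift n u) = ev (lift n v))"
    using assms unfolding gteq_def
  proof (induction rule: pres_rel.induct)
    case (sym u v)
    then obtain N where "\<forall>n\<ge>N. ev (lift n u) = ev (lift n v)" by blast
    then have "\<forall>n\<ge>N. ev (lift n v) = ev (lift n u)" by simp
    then show ?case using sym by auto
  next
    case (trans u v w)
    then obtain N M where "\<forall>n\<ge>N. ev (lift n u) = ev (lift n v)" "\<forall>n\<ge>M. ev (lift n v) = ev (lift n w)"
      by blast
    then have "\<forall>n\<ge>max N M. ev (lift n u) = ev (lift n w)" by simp
    moreover have "sexp u = sexp w" using trans by simp
    ultimately show ?case by blast
  next
    case (cancel u v x e)
    have "ev ((subst ^^ k) [y] @ (subst ^^ k) [y] @ w) = ev w" for k y w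
    proof -
      have "ev ((subst ^^ k) [y, y]) = id"
        using ev_subst_pow_cong[of k "[y, y]" "[]"] by (auto simp: fun_eq_iff)
      then show ?thesis by (simp add: subst_pow_Cons[of _ _ "[_]"] ev_append o_assoc[symmetric])
    qed
    then have "ev (lift n ([(x, e), (x, \<not> e)] @ v)) = ev (lift n v)" "sexp [(x, e), (x, \<not> e)] = 0" for n
      by (cases x; simp)+
    then show ?case by (simp add: lift_append[of _ u] ev_append)
  next
    case (relation u v p q)
    \<comment> \<open>After \<open>u\<close> the exponent has become n - sexp u, which the bound on
      \<open>n\<close> keeps nonnegative.\<close>
    have "ev (lift n (u @ p @ v)) = ev (lift n (u @ q @ v))" if "n \<ge> sexp u" for n
      using relation_sound[OF relation(5), of "n - sexp u"] that by (simp add: lift_append ev_append)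
    moreover have "sexp p = sexp q" using relation_sound[OF relation(5), of 0] by simp
    ultimately show ?case by auto
  qed (auto intro: exI[of _ 0])
  then show "sexp u = sexp v" "\<exists>N. \<forall>n\<ge>N. ev (lift n u) = ev (lift n v)" by auto
qed

lemma lift_s_pow: "lift n (replicate k (Gs, True) @ w) = lift (n - int k) w"
  "sexp (replicate k (Gs, True)) = int k"
  by (induction k arbitrary: n) (auto simp: algebra_simps)

text \<open>For large N, soundness gives an equality after a power of theta has been applied, and
  theta is injective. The exponent 0 gives the embedding, the others uniqueness of the normal forms
  s^k g.\<close>

lemma gteq_normal_form:
  assumes "gteq (replicate j (Gs, True) @ gw u) (replicate k (Gs, True) @ gw v)"
  shows "j = k" "ev u = ev v"
proof -
  show "j = k" using gteq_sound(1)[OF assms] by (simp add: lift_s_pow)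
  obtain N where "\<forall>n\<ge>N. ev (lift n (replicate j (Gs, True) @ gw u)) = ev (lift n (replicate k (Gs, True) @ gw v))"
    using gteq_sound(2)[OF assms] by blast
  then have "ev ((subst ^^ nat (N - int j)) u) = ev ((subst ^^ nat (N - int j)) v)"
    using \<open>j = k\<close> by (simp add: lift_s_pow lift_gw)
  then show "ev u = ev v" by (simp add: ev_subst_pow_cong)
qed

subsection \<open>Completeness\<close>

definition leq :: "letter list \<Rightarrow> letter list \<Rightarrow> bool" (infix "\<doteq>" 50) where
  "u \<doteq> v \<longleftrightarrow> gteq (gw u) (gw v)"

lemma leq_refl [simp]: "u \<doteq> u" by (simp add: leq_def)
lemma leq_sym: "u \<doteq> v \<Longrightarrow> v \<doteq> u" unfolding leq_def by (rule gteq_sym)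
lemma leq_trans [trans]: "u \<doteq> v \<Longrightarrow> v \<doteq> w \<Longrightarrow> u \<doteq> w" unfolding leq_def by (rule gteq_trans)
lemma leq_append: "u \<doteq> u' \<Longrightarrow> v \<doteq> v' \<Longrightarrow> u @ v \<doteq> u' @ v'" unfolding leq_def by (simp add: gteq_append)
lemma leq_Cons: "u \<doteq> v \<Longrightarrow> x # u \<doteq> x # v" using leq_append[of "[x]" "[x]"] by simp

lemma leq_sound: "u \<doteq> v \<Longrightarrow> ev u = ev v"
  unfolding leq_def using gteq_normal_form(2)[of 0 u 0 v] by simp

lemma conj_subst: "gteq ([(Gs, False)] @ gw u @ [(Gs, True)]) (gw (subst u))"
proof (induction u)
  case Nil
  then show ?case by (simp add: gteq_cancel'[of Gs])
next
  case (Cons x u)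
  have x: "gteq [(Gs, False), (gl x, True), (Gs, True)] (gw (subst1 x))"
    by (rule gteq_relation) (cases x; simp add: gt_relations_def Let_def wconj_def winv_def gletter_def)
  have "gteq ([(Gs, False), (gl x, True)] @ [] @ gw u @ [(Gs, True)])
     ([(Gs, False), (gl x, True)] @ [(Gs, True), (Gs, False)] @ gw u @ [(Gs, True)])"
    by (intro gteq_append gteq_refl gteq_sym[OF gteq_cancel'(2)])
  also have "gteq \<dots> (gw (subst1 x) @ gw (subst u))"
    using gteq_append[OF x Cons] by simp
  finally show ?case by simp
qed

lemma leq_subst: "u \<doteq> v \<Longrightarrow> subst u \<doteq> subst v"
proof -
  assume "u \<doteq> v"
  then have "gteq ([(Gs, False)] @ gw u @ [(Gs, True)]) ([(Gs, False)] @ gw v @ [(Gs, True)])"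
    unfolding leq_def by (intro gteq_append gteq_refl)
  then show ?thesis unfolding leq_def
    by (rule gteq_trans[OF gteq_sym[OF conj_subst] gteq_trans[OF _ conj_subst]])
qed

text \<open>Only the square of a is a relator; conjugation by s carries it to b and then to
  c.\<close>

lemma leq_sq: "[x, x] \<doteq> []"
proof -
  have "(gw [LA, LA], []) \<in> gt_relations"
    by (simp add: gt_relations_def gt_relators_def Let_def wpow_def gletter_def numeral_eq_Suc)
  then have a: "[LA, LA] \<doteq> []" unfolding leq_def using gteq_relation by simp
  have b: "[LB, LB] \<doteq> []" using leq_subst[OF a] by simp
  have c: "[LC, LC] \<doteq> []" using leq_subst[OF b] by simp
  show ?thesis using a b c by (cases x) auto
qed

lemma leq_red: "red w \<doteq> w"
proof (induction w)
  case (Cons x w)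
  have "push x r \<doteq> x # r" for r
    using leq_append[OF leq_sym[OF leq_sq[of x]] leq_refl] by (cases r) auto
  also have "x # red w \<doteq> x # w" using Cons by (rule leq_Cons)
  finally show ?case by simp
qed simp

lemma leq_of_red_eq: "red u = red v \<Longrightarrow> u \<doteq> v"
  using leq_trans[OF leq_sym[OF leq_red[of u]]] leq_red[of v] by simp

lemma leq_rev_cancel: "w @ rev w \<doteq> []" "rev w @ w \<doteq> []"
proof -
  have *: "v @ rev v \<doteq> []" for v
  proof (induction v)
    case (Cons x v)
    have "[x] @ (v @ rev v) @ [x] \<doteq> [x] @ [] @ [x]" by (intro leq_append Cons leq_refl)
    also have "\<dots> \<doteq> []" using leq_sq by simp
    finally show ?case by simp
  qed simp
  show "w @ rev w \<doteq> []" "rev w @ w \<doteq> []" using *[of w] *[of "rev w"] by auto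
qed

lemma leq_rev: "u \<doteq> v \<Longrightarrow> rev u \<doteq> rev v"
proof -
  assume uv: "u \<doteq> v"
  have "rev u @ [] \<doteq> rev u @ (v @ rev v)" by (intro leq_append leq_refl leq_sym[OF leq_rev_cancel(1)])
  also have "\<dots> \<doteq> rev u @ (u @ rev v)" by (intro leq_append leq_refl leq_sym[OF uv])
  also have "\<dots> \<doteq> [] @ rev v" using leq_append[OF leq_rev_cancel(2)[of u] leq_refl[of "rev v"]] by simp
  finally show ?thesis by simp
qed

lemma leq_rev_of_square: "r @ r \<doteq> [] \<Longrightarrow> r \<doteq> rev r"
proof -
  assume "r @ r \<doteq> []"
  then have 1: "(r @ r) @ rev r \<doteq> [] @ rev r" by (intro leq_append leq_refl)
  have "r @ (r @ rev r) \<doteq> r @ []" by (intro leq_append leq_refl leq_rev_cancel)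
  from leq_trans[OF leq_sym[OF this]] 1 show ?thesis by simp
qed

lemma gteq_strip: "Gs \<notin> fst ` set w \<Longrightarrow> gteq w (gw (strip w))"
proof (induction w)
  case (Cons y w)
  obtain x e where y: "y = (x, e)" by (cases y)
  have "x \<noteq> Gs" using Cons.prems y by auto
  then obtain l where l: "x = gl l" by (cases x) (metis gl.simps)+
  have "gteq [(x, e)] [(x, True)]"
  proof (cases e)
    case False
    have "gteq ([(x, False)] @ []) ([(x, False)] @ [(x, True), (x, True)])"
      using leq_sq[of l] unfolding leq_def l by (intro gteq_append gteq_refl) (simp add: gteq_sym)
    also have "gteq \<dots> ([] @ [(x, True)])"
      using gteq_append[OF gteq_cancel'(1)[of x] gteq_refl[of "[(x, True)]"]] by simp
    finally show ?thesis using False by simp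
  qed simp
  then have "gteq ([(x, e)] @ w) ([(x, True)] @ gw (strip w))"
    using Cons by (intro gteq_append) auto
  then show ?case by (cases l) (simp_all add: y l)
qed simp

lemma leq_relator: "r \<in> gt_relators \<Longrightarrow> strip r \<doteq> []"
proof -
  assume r: "r \<in> gt_relators"
  then have "(r, []) \<in> gt_relations" by (simp add: gt_relations_def Let_def)
  then have "gteq r []" by (rule gteq_relation)
  then show ?thesis
    using gteq_strip[OF relators_sound(1)[OF r]] unfolding leq_def by (metis gteq_sym gteq_trans gw_simps(1))
qed

section \<open>Commutation of c with the conjugates of aca\<close>

lemma dih_leq: "dih u v \<Longrightarrow> u \<doteq> v"
proof (induction rule: dih.induct)
  case (dih_sq x u v)
  show ?case using leq_append[OF leq_refl leq_append[OF leq_sq[of x] leq_refl], of u v] by simp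
next
  case (dih_ac u v)
  have "wpow (gletter Ga @ gletter Gc) 4 \<in> gt_relators" by (simp add: gt_relators_def Let_def)
  from leq_relator[OF this] have "[LA, LC, LA, LC, LA, LC, LA, LC] \<doteq> []"
    by (simp add: wpow_def gletter_def numeral_eq_Suc)
  from leq_append[OF leq_refl leq_append[OF this leq_refl], of u v] show ?case by simp
qed (auto intro: leq_sym leq_trans)

text \<open>This is theta(b^x)^a, the conjugate of aca by theta(x)^a. Since theta(a)^a = aba and
  theta(c)^a = b, words x in a and c produce the conjugates by the group generated by b and
  aba.\<close>

definition zword :: "letter list \<Rightarrow> letter list" where
  "zword x = [LA] @ subst (rev x @ LB # x) @ [LA]"

text \<open>Conjugation by the inverse of \<open>y\<close>, which is \<open>rev y\<close> for
  involutions. It serves the two conjugates whose conjugating word is inverse to one in the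
  relators.\<close>

lemma leq_conj_rev:
  assumes "[LC] @ rev y @ LC # y \<doteq> (rev y @ LC # y) @ [LC]"
  shows "[LC] @ y @ LC # rev y \<doteq> (y @ LC # rev y) @ [LC]"
proof -
  have 1: "y @ ([LC] @ rev y @ LC # y) @ rev y \<doteq> y @ ((rev y @ LC # y) @ [LC]) @ rev y"
    by (intro leq_append leq_refl assms)
  have "(y @ [LC] @ rev y @ [LC]) @ (y @ rev y) \<doteq> (y @ [LC] @ rev y @ [LC]) @ []"
    by (intro leq_append leq_refl leq_rev_cancel)
  moreover have "(y @ rev y) @ ([LC] @ y @ [LC] @ rev y) \<doteq> [] @ ([LC] @ y @ [LC] @ rev y)"
    by (intro leq_append leq_refl leq_rev_cancel)
  ultimately show ?thesis using leq_trans[OF leq_sym leq_trans[OF leq_sym[OF 1]]]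
    by (simp only: append_assoc append_Cons append_Nil append_Nil2)
qed

text \<open>The commutator [c, y] equals c c^y, a product of two involutions; its square is trivial
  exactly if they commute.\<close>

lemma wcomm_commute:
  assumes "wpow (wcomm (gletter Gc) (map (\<lambda>x. (gl x, True)) y)) 2 \<in> gt_relators"
  shows "[LC] @ rev y @ LC # y \<doteq> (rev y @ LC # y) @ [LC]"
proof -
  have app: "strip (u @ v) = strip u @ strip v" for u v
    by (induction u rule: strip.induct) auto
  have r: "strip (rev (map (\<lambda>x. (gl x, False)) y)) = rev y"
  proof (induction y)
    case (Cons x y) then show ?case by (cases x) (auto simp: app)
  qed simp
  have m: "map (\<lambda>(x, e). (x, \<not> e)) (map (\<lambda>x. (gl x, True)) y) = map (\<lambda>x. (gl x, False)) y"
    by simp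
  define d where "d = LC # rev y @ LC # y"
  have "strip (wpow (wcomm (gletter Gc) (map (\<lambda>x. (gl x, True)) y)) 2) = d @ d"
    using strip_gw(1)[of y]
    by (simp add: wpow_def numeral_eq_Suc wcomm_def gletter_def winv_def app m r d_def gw_def del: map_map)
  then have "d @ d \<doteq> []" using leq_relator[OF assms] by simp
  from leq_rev_of_square[OF this] show ?thesis by (simp add: d_def)
qed

text \<open>This is where the relators come from. Of the eight elements \<open>q\<close>, the
  identity uses (ac)^4, five use the commutator relators directly, and a and aca use the inverses of
  ab and ababab.\<close>

lemma zword_commute_forms:
  assumes "q \<in> dih_forms"
  shows "[LC] @ zword q \<doteq> zword q @ [LC]"
proof -
  have rel: "wpow (wcomm (gletter Gc) (map (\<lambda>x. (gl x, True)) y)) 2 \<in> gt_relators"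
    if "y \<in> {[LA, LB], [LB, LA, LB], [LA, LB, LA, LB, LA], [LA, LB, LA, LB, LA, LB], [LB, LA, LB, LA, LB, LA, LB]}" for y
    using that by (auto simp: gt_relators_def Let_def gletter_def)
  note c = wcomm_commute[OF rel]
  have conj: "[LC] @ zword q \<doteq> zword q @ [LC]"
    if "[LC] @ rev y @ LC # y \<doteq> (rev y @ LC # y) @ [LC]" "red (zword q) = red (rev y @ LC # y)" for y
  proof -
    have z: "zword q \<doteq> rev y @ LC # y" by (rule leq_of_red_eq[OF that(2)])
    have "[LC] @ zword q \<doteq> [LC] @ rev y @ LC # y" by (intro leq_append leq_refl z)
    also have "\<dots> \<doteq> (rev y @ LC # y) @ [LC]" by (rule that(1))
    also have "\<dots> \<doteq> zword q @ [LC]" by (intro leq_append leq_refl leq_sym[OF z])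
    finally show ?thesis .
  qed
  have a: "[LC] @ rev [LA] @ LC # [LA] \<doteq> (rev [LA] @ LC # [LA]) @ [LC]"
  proof -
    have "[LC, LA, LC, LA] @ [LC, LA, LC, LA] \<doteq> [LC] @ [LA, LC, LA, LC, LA, LC, LA, LC] @ [LC]"
      by (rule leq_of_red_eq) simp
    also have "\<dots> \<doteq> [LC] @ [] @ [LC]"
      using dih_leq[OF dih_ac[of "[]" "[]"]] by (intro leq_append leq_refl) simp
    also have "\<dots> \<doteq> []" using leq_sq by simp
    finally show ?thesis using leq_rev_of_square[of "[LC, LA, LC, LA]"] by simp
  qed
  from assms consider "q = []" | "q = [LA]" | "q = [LC]" | "q = [LA, LC]" | "q = [LC, LA]"
    | "q = [LA, LC, LA]" | "q = [LC, LA, LC]" | "q = [LA, LC, LA, LC]"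
    by (auto simp: dih_forms_def)
  then show ?thesis
  proof cases
    case 1 show ?thesis by (rule conj[OF a]) (simp add: 1 zword_def)
  next
    case 2
    have "[LC] @ rev [LB, LA] @ LC # [LB, LA] \<doteq> (rev [LB, LA] @ LC # [LB, LA]) @ [LC]"
      using leq_conj_rev[OF c[of "[LA, LB]"]] by simp
    then show ?thesis by (rule conj) (simp add: 2 zword_def)
  next
    case 3 show ?thesis by (rule conj[OF c[of "[LA, LB]"]]) (simp_all add: 3 zword_def)
  next
    case 4 show ?thesis by (rule conj[OF c[of "[LB, LA, LB]"]]) (simp_all add: 4 zword_def)
  next
    case 5 show ?thesis by (rule conj[OF c[of "[LA, LB, LA, LB, LA]"]]) (simp_all add: 5 zword_def)
  next
    case 6
    let ?y = "[LB, LA, LB, LA, LB, LA]"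
    have "[LC] @ rev ?y @ LC # ?y \<doteq> (rev ?y @ LC # ?y) @ [LC]"
      using leq_conj_rev[OF c[of "[LA, LB, LA, LB, LA, LB]"]] by simp
    then show ?thesis by (rule conj) (simp add: 6 zword_def)
  next
    case 7 show ?thesis by (rule conj[OF c[of "[LA, LB, LA, LB, LA, LB]"]]) (simp_all add: 7 zword_def)
  next
    case 8 show ?thesis by (rule conj[OF c[of "[LB, LA, LB, LA, LB, LA, LB]"]]) (simp_all add: 8 zword_def)
  qed
qed

lemma zword_cong: "x \<doteq> y \<Longrightarrow> zword x \<doteq> zword y"
proof -
  assume xy: "x \<doteq> y"
  have "rev x @ [LB] @ x \<doteq> rev y @ [LB] @ y" by (intro leq_append leq_refl leq_rev xy)
  then have "subst (rev x @ LB # x) \<doteq> subst (rev y @ LB # y)" using leq_subst[of "rev x @ [LB] @ x" "rev y @ [LB] @ y"] by simp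
  then show ?thesis unfolding zword_def by (intro leq_append leq_refl)
qed

lemma zword_commute:
  assumes "LB \<notin> set x"
  shows "zword x @ [LC] \<doteq> [LC] @ zword x"
proof -
  obtain q where q: "q \<in> dih_forms" "dih x q" using dih_forms_ex[OF assms] .
  have z: "zword x \<doteq> zword q" by (rule zword_cong) (rule dih_leq[OF q(2)])
  have "zword x @ [LC] \<doteq> zword q @ [LC]" by (intro leq_append leq_refl z)
  also have "\<dots> \<doteq> [LC] @ zword q" by (rule leq_sym) (rule zword_commute_forms[OF q(1)])
  also have "\<dots> \<doteq> [LC] @ zword x" by (intro leq_append leq_refl leq_sym[OF z])
  finally show ?thesis .
qed

text \<open>Conjugating theta(b^x)^a by theta(a) = b = theta(c)^a appends c to \<open>x\<close>, and
  conjugating by theta(c) = aba = theta(a)^a appends a; this is the exchange in pi. For theta(b) = c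
  the conjugation is trivial by commutation.\<close>

lemma zword_subst1:
  assumes "LB \<notin> set x"
  shows "zword x @ subst1 y \<doteq> subst1 y @ zword (x @ swp1 y)"
proof (cases y)
  case LB
  then show ?thesis using zword_commute[OF assms] by simp
next
  case LA
  let ?M = "subst (rev x @ LB # x)"
  have "zword x @ subst1 y = [LA] @ ?M @ [LA, LB]" by (simp add: LA zword_def)
  also have "\<dots> \<doteq> [LB, LA, LA, LB, LA] @ ?M @ [LA, LB, LA, LA]"
    by (intro leq_append leq_refl leq_of_red_eq) simp_all
  also have "\<dots> = subst1 y @ zword (x @ swp1 y)" by (simp add: LA zword_def)
  finally show ?thesis .
next
  case LC
  let ?M = "subst (rev x @ LB # x)"
  have "zword x @ subst1 y = [LA] @ ?M @ [LA, LA, LB, LA]" by (simp add: LC zword_def)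
  also have "\<dots> \<doteq> [LA, LB, LA, LA, LB] @ ?M @ [LB, LA]"
    by (intro leq_append leq_refl leq_of_red_eq) simp_all
  also have "\<dots> = subst1 y @ zword (x @ swp1 y)" by (simp add: LC zword_def)
  finally show ?thesis .
qed

lemma zword_subst:
  assumes "LB \<notin> set x"
  shows "zword x @ subst u \<doteq> subst u @ zword (x @ swp u)"
  using assms
proof (induction u arbitrary: x)
  case (Cons y u)
  have "LB \<notin> set (x @ swp1 y)" using Cons.prems by (cases y) auto
  note IH = Cons.IH[OF this]
  have "(zword x @ subst1 y) @ subst u \<doteq> (subst1 y @ zword (x @ swp1 y)) @ subst u"
    by (intro leq_append leq_refl zword_subst1 Cons.prems)
  also have "\<dots> = subst1 y @ zword (x @ swp1 y) @ subst u" by simp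
  also have "\<dots> \<doteq> subst1 y @ subst u @ zword ((x @ swp1 y) @ swp u)"
    by (intro leq_append leq_refl IH)
  finally show ?case by simp
qed simp

text \<open>An element fixing the first level is a product \<open>\<theta>(u) \<theta>(v)\<^sup>a\<close>: the generators \<open>b\<close>, \<open>c\<close>, \<open>aba\<close> of the
  stabilizer are \<open>\<theta>(a)\<close>, \<open>\<theta>(b)\<close>, \<open>\<theta>(c)\<close>, and the conjugates of \<open>aca = \<theta>(b)\<^sup>a\<close> can be moved to the
  right. Both sections of the element can be read off \<open>u\<close> and \<open>v\<close>.\<close>

lemma stabilizer_form:
  defines "ev' \<equiv> \<lambda>w. if flips w then LA # w else w"
  shows "\<exists>u v. ev' w \<doteq> subst u @ [LA] @ subst v @ [LA] \<and> sec False (ev' w) \<doteq> u \<and> sec True (ev' w) \<doteq> swp u @ v"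
proof (induction w)
  case Nil
  have "[] \<doteq> subst [] @ [LA] @ subst [] @ [LA]" by (rule leq_of_red_eq) simp
  then show ?case unfolding ev'_def by (intro exI[of _ "[]"]) simp
next
  case (Cons x w)
  then obtain u v where uv: "ev' w \<doteq> subst u @ [LA] @ subst v @ [LA]"
      "sec False (ev' w) \<doteq> u" "sec True (ev' w) \<doteq> swp u @ v" by blast
  have step: ?case if "ev' (x # w) \<doteq> subst1 y @ ev' w"
      "sec False (ev' (x # w)) = y # sec False (ev' w)" "sec True (ev' (x # w)) = swp1 y @ sec True (ev' w)" for y
  proof (intro exI conjI)
    have "subst1 y @ ev' w \<doteq> subst1 y @ subst u @ [LA] @ subst v @ [LA]"
      by (intro leq_append leq_refl uv)
    from leq_trans[OF that(1) this] show "ev' (x # w) \<doteq> subst (y # u) @ [LA] @ subst v @ [LA]"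
      by simp
    show "sec False (ev' (x # w)) \<doteq> y # u" unfolding that(2) by (rule leq_Cons[OF uv(2)])
    have "swp1 y @ sec True (ev' w) \<doteq> swp1 y @ swp u @ v" by (intro leq_append leq_refl uv)
    then show "sec True (ev' (x # w)) \<doteq> swp (y # u) @ v" unfolding that(3) by simp
  qed
  show ?case
  proof (cases x)
    case LA
    have "[LA, LA] @ w \<doteq> [] @ w" by (intro leq_append leq_sq leq_refl)
    then have "ev' (x # w) \<doteq> ev' w" by (simp add: LA ev'_def)
    note leq_trans[OF this uv(1)]
    moreover have "sec p (ev' (x # w)) = sec p (ev' w)" for p by (simp add: LA ev'_def)
    ultimately show ?thesis using uv(2,3) by (intro exI[of _ u] exI[of _ v]) simp
  next
    case LB
    show ?thesis
    proof (cases "flips w")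
      case False
      show ?thesis by (rule step[of LA]) (simp_all add: LB False ev'_def)
    next
      case True
      have "[LA, LB] @ [] @ w \<doteq> [LA, LB] @ [LA, LA] @ w"
        by (intro leq_append leq_refl leq_sym[OF leq_sq])
      then show ?thesis by (intro step[of LC]) (simp_all add: LB True ev'_def)
    qed
  next
    case LC
    show ?thesis
    proof (cases "flips w")
      case False
      show ?thesis by (rule step[of LB]) (simp_all add: LC False ev'_def)
    next
      case True
      define t where "t = swp u"
      have t: "LB \<notin> set t" unfolding t_def
      proof (induction u)
        case (Cons y u) then show ?case by (cases y) auto
      qed simp
      \<comment> \<open>Moving the new factor theta(b)^a to the right past theta(u) conjugates its b
        by t = pi(u). The second section agrees because b t v = t (t^-1 b t) v.\<close>
      let ?v = "(rev t @ LB # t) @ v"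
      have "ev' (x # w) = [LA, LC] @ [] @ w" by (simp add: LC True ev'_def)
      also have "\<dots> \<doteq> [LA, LC] @ [LA, LA] @ w" by (intro leq_append leq_refl leq_sym[OF leq_sq])
      also have "\<dots> = zword [] @ ev' w" by (simp add: True ev'_def zword_def)
      also have "\<dots> \<doteq> zword [] @ (subst u @ [LA] @ subst v @ [LA])" by (intro leq_append leq_refl uv)
      also have "\<dots> = (zword [] @ subst u) @ [LA] @ subst v @ [LA]" by simp
      also have "\<dots> \<doteq> (subst u @ zword ([] @ t)) @ [LA] @ subst v @ [LA]"
        unfolding t_def by (intro leq_append leq_refl zword_subst) simp
      also have "\<dots> = (subst u @ [LA] @ subst (rev t @ LB # t)) @ [LA, LA] @ subst v @ [LA]"
        by (simp add: zword_def)
      also have "\<dots> \<doteq> (subst u @ [LA] @ subst (rev t @ LB # t)) @ [] @ subst v @ [LA]"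
        by (intro leq_append leq_refl leq_sq)
      also have "\<dots> = subst u @ [LA] @ subst ?v @ [LA]" by simp
      finally have 1: "ev' (x # w) \<doteq> subst u @ [LA] @ subst ?v @ [LA]" .
      have 2: "sec False (ev' (x # w)) \<doteq> u"
        using uv(2) by (simp add: LC True ev'_def)
      have "sec True (ev' (x # w)) = [LB] @ sec True (ev' w)" by (simp add: LC True ev'_def)
      also have "\<dots> \<doteq> [] @ [LB] @ t @ v" using uv(3) unfolding t_def by (simp add: leq_Cons)
      also have "\<dots> \<doteq> (t @ rev t) @ [LB] @ t @ v"
        by (intro leq_append leq_refl leq_sym[OF leq_rev_cancel(1)])
      also have "\<dots> = swp u @ ?v" by (simp add: t_def)
      finally show ?thesis using 1 2 by blast
    qed
  qed
qed

text \<open>In theta(u) theta(v)^a the first section kills \<open>u\<close>. Soundness then makes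
  pi(u) trivial by the dihedral relations, which hold in the presented group, and so the second
  section kills \<open>v\<close>.\<close>

lemma leq_Nil_of_sections:
  assumes "ev w = id" "sec False w \<doteq> []" "sec True w \<doteq> []"
  shows "w \<doteq> []"
proof -
  have "\<not> flips w" using assms(1) ev_eq_id_iff by blast
  then obtain u v where uv: "w \<doteq> subst u @ [LA] @ subst v @ [LA]" "sec False w \<doteq> u" "sec True w \<doteq> swp u @ v"
    using stabilizer_form[of w] by auto
  have u: "u \<doteq> []" by (rule leq_trans[OF leq_sym[OF uv(2)] assms(2)])
  then have su: "subst u \<doteq> []" using leq_subst[OF u] by simp
  have "ev u = id" using leq_sound[OF u] by simp
  then have pu: "swp u \<doteq> []" using dih_leq[OF dih_swp_Nil] by blast
  have "[] @ v \<doteq> swp u @ v" by (intro leq_append leq_refl leq_sym[OF pu])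
  also have "swp u @ v \<doteq> []" by (rule leq_trans[OF leq_sym[OF uv(3)] assms(3)])
  finally have v: "subst v \<doteq> []" using leq_subst[of v "[]"] by simp
  note uv(1)
  also have "subst u @ [LA] @ subst v @ [LA] \<doteq> [] @ [LA] @ [] @ [LA]"
    by (intro leq_append leq_refl su v)
  also have "\<dots> \<doteq> []" using leq_sq by simp
  finally show ?thesis .
qed

section \<open>Descent along sections solves the word problem\<close>

lemma leq_Nil_only_c:
  assumes "set w \<subseteq> {LC}" "ev w = id"
  shows "w \<doteq> []"
proof -
  have "red w = [] \<or> red w = [LC]"
    using assms(1) by (induction w) auto
  moreover have "ev [LC] \<noteq> id"
  proof
    assume "ev [LC] = id"
    then have "ev [LC] [False, False, False] = id [False, False, False]" by (rule fun_cong)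
    then show False by (simp add: img_a_def)
  qed
  then have "red w \<noteq> [LC]" using ev_red[of w] assms(2) by auto
  ultimately show ?thesis using leq_red[of w] leq_sym by metis
qed

lemma set_sec_no_a:
  assumes "LA \<notin> set w"
  shows "LB \<in> set w \<Longrightarrow> LA \<in> set (sec False w)" "set (sec True w) \<subseteq> {LC}"
  using assms
proof (induction w)
  case (Cons x w)
  { case 1 then show ?case using Cons.IH(1) by (cases x) auto }
  { case 2 then show ?case using Cons.IH(2) by (cases x) auto }
qed auto

text \<open>Sections are shorter only if the word contains an a. If it has no a but some b, the
  section at 0 contains an a and the next descent is strict, while the section at 1 is a power of c.
  Powers of c are settled directly.\<close>

theorem leq_complete: "ev w = id \<Longrightarrow> w \<doteq> []"
proof (induction "length w" arbitrary: w rule: less_induct)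
  case less
  \<comment> \<open>Stated for all words not longer than \<open>w\<close>, since it is also applied
    to a section that may be as long as \<open>w\<close>.\<close>
  have with_a: "v \<doteq> []" if "LA \<in> set v" "length v \<le> length w" "ev v = id" for v
  proof -
    have "count_list v LA > 0" using that(1) by (metis count_list_0_iff gr0I)
    then have "length (sec p v) < length w" for p using length_sec[of p v] that(2) by linarith
    then have "sec p v \<doteq> []" for p
      using that(3) ev_eq_id_iff[of v] by (cases p) (auto intro: less.hyps)
    with that(3) show ?thesis by (intro leq_Nil_of_sections[of v])
  qed
  show ?case
  proof (cases "LA \<in> set w")
    case True then show ?thesis using with_a less.prems by simp
  next
    case a: False
    show ?thesis
    proof (cases "LB \<in> set w")
      case True
      have "LA \<in> set (sec False w)" "set (sec True w) \<subseteq> {LC}"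
        using set_sec_no_a[OF a] True by simp_all
      moreover have "length (sec False w) \<le> length w" using length_sec[of False w] by simp
      ultimately show ?thesis
        using less.prems ev_eq_id_iff[of w]
        by (intro leq_Nil_of_sections[of w] with_a[of "sec False w"] leq_Nil_only_c[of "sec True w"]) auto
    next
      case False
      have "x = LC" if "x \<in> set w" for x using a False that by (cases x) auto
      then have "set w \<subseteq> {LC}" by blast
      then show ?thesis using less.prems by (rule leq_Nil_only_c)
    qed
  qed
qed

corollary leq_iff: "u \<doteq> v \<longleftrightarrow> ev u = ev v"
proof
  assume "ev u = ev v"
  then have "rev u @ v \<doteq> []" using ev_eq_iff[of u v] by (intro leq_complete) simp
  then have 1: "u @ (rev u @ v) \<doteq> u @ []" by (intro leq_append leq_refl)
  have "(u @ rev u) @ v \<doteq> [] @ v" by (intro leq_append leq_refl leq_rev_cancel)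
  from leq_trans[OF leq_sym[OF this]] 1 have "v \<doteq> u" by simp
  then show "u \<doteq> v" by (rule leq_sym)
qed (rule leq_sound)

section \<open>Homomorphisms from presented groups\<close>

definition wval :: "('b, 'c) monoid_scheme \<Rightarrow> ('a \<Rightarrow> 'b) \<Rightarrow> 'a gword \<Rightarrow> 'b" where
  "wval H f w = foldr (\<lambda>(x, e) y. (if e then f x else inv\<^bsub>H\<^esub> (f x)) \<otimes>\<^bsub>H\<^esub> y) w \<one>\<^bsub>H\<^esub>"

lemma wval_simps [simp]:
  "wval H f [] = \<one>\<^bsub>H\<^esub>"
  "wval H f ((x, e) # w) = (if e then f x else inv\<^bsub>H\<^esub> (f x)) \<otimes>\<^bsub>H\<^esub> wval H f w"
  by (simp_all add: wval_def)

lemma wval_map: "wval H f (map (map_prod e id) w) = wval H (f \<circ> e) w"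
  by (induction w) auto

lemma wval_cong: "w \<in> gwords S \<Longrightarrow> (\<And>x. x \<in> S \<Longrightarrow> f x = g x) \<Longrightarrow> wval H f w = wval H g w"
  by (induction w) auto

context group begin

lemma wval_closed: "f \<in> S \<rightarrow> carrier G \<Longrightarrow> w \<in> gwords S \<Longrightarrow> wval G f w \<in> carrier G"
  by (induction w) (auto simp: Pi_iff)

lemma wval_append:
  "f \<in> S \<rightarrow> carrier G \<Longrightarrow> u \<in> gwords S \<Longrightarrow> v \<in> gwords S \<Longrightarrow> wval G f (u @ v) = wval G f u \<otimes> wval G f v"
proof (induction u)
  case (Cons y u)
  then have "f (fst y) \<in> carrier G" by (cases y) auto
  then show ?case using Cons wval_closed[OF Cons.prems(1)] by (cases y) (auto simp: m_assoc)
qed (simp add: wval_closed)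

lemma wval_pres_rel:
  assumes f: "f \<in> S \<rightarrow> carrier G"
    and R: "\<And>p q. (p, q) \<in> R \<Longrightarrow> p \<in> gwords S \<Longrightarrow> q \<in> gwords S \<Longrightarrow> wval G f p = wval G f q"
    and uv: "(u, v) \<in> pres_rel S R"
  shows "wval G f u = wval G f v"
  using uv
proof (induction rule: pres_rel.induct)
  case (cancel u v x e)
  have "f x \<in> carrier G" using f cancel by auto
  moreover have "wval G f v \<in> carrier G" using wval_closed[OF f] cancel by auto
  ultimately have "wval G f ([(x, e), (x, \<not> e)] @ v) = wval G f v"
    by (auto simp: m_assoc[symmetric])
  then show ?case using cancel wval_append[OF f, of u v] wval_append[OF f, of u "[(x, e), (x, \<not> e)] @ v"]
    by simp
next
  case (relation u v p q)
  then show ?case using R[OF relation(5,3,4)] by (simp add: wval_append[OF f])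
qed auto

lemma von_dyck:
  assumes f: "f \<in> S \<rightarrow> carrier G"
    and R: "\<And>p q. (p, q) \<in> R \<Longrightarrow> p \<in> gwords S \<Longrightarrow> q \<in> gwords S \<Longrightarrow> wval G f p = wval G f q"
  obtains h where "h \<in> hom (presented_group S R) G"
    "\<And>w. w \<in> gwords S \<Longrightarrow> h (pres_class S R w) = wval G f w"
proof
  define h where "h A = wval G f (SOME w. w \<in> A)" for A
  show h: "h (pres_class S R w) = wval G f w" if "w \<in> gwords S" for w
  proof -
    have "w \<in> pres_class S R w" using that by (simp add: pres_class_def pres_rel.refl)
    then have "(SOME v. v \<in> pres_class S R w) \<in> pres_class S R w" by (rule someI)
    then have "(w, SOME v. v \<in> pres_class S R w) \<in> pres_rel S R" by (simp add: pres_class_def)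
    then show ?thesis unfolding h_def using wval_pres_rel[OF f R] by metis
  qed
  show "h \<in> hom (presented_group S R) G"
  proof (rule homI)
    fix x assume "x \<in> carrier (presented_group S R)"
    then show "h x \<in> carrier G" using h wval_closed[OF f] by (auto simp: carrier_presented_group)
  next
    fix x y assume "x \<in> carrier (presented_group S R)" "y \<in> carrier (presented_group S R)"
    then show "h (x \<otimes>\<^bsub>presented_group S R\<^esub> y) = h x \<otimes> h y"
      using h wval_append[OF f] by (auto simp: carrier_presented_group mult_presented_group)
  qed
qed

lemma hom_wval:
  assumes "group H" "h \<in> hom G H" "f \<in> S \<rightarrow> carrier G" "w \<in> gwords S"
  shows "h (wval G f w) = wval H (h \<circ> f) w"
  using assms(4)
proof (induction w)
  case Nil
  then show ?case using hom_one[OF assms(2) is_group assms(1)] by simp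
next
  case (Cons y w)
  obtain x e where y: "y = (x, e)" by (cases y)
  have x: "f x \<in> carrier G" "w \<in> gwords S" using Cons.prems assms(3) by (auto simp: y)
  have c: "wval G f w \<in> carrier G" using wval_closed[OF assms(3) x(2)] .
  interpret group_hom G H h
    using assms group_axioms by (simp add: group_hom_def group_hom_axioms_def)
  show ?case using Cons.IH[OF x(2)] x c by (auto simp: y)
qed

end

lemma wval_presented_group:
  "w \<in> gwords S \<Longrightarrow> wval (presented_group S R) (\<lambda>x. pres_class S R (gletter x)) w = pres_class S R w"
proof (induction w)
  case Nil
  then show ?case by (simp add: one_presented_group)
next
  case (Cons y w)
  obtain x e where y: "y = (x, e)" by (cases y)
  have x: "x \<in> S" "w \<in> gwords S" using Cons.prems by (auto simp: y)
  interpret group "presented_group S R" by (rule group_presented_group)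
  have g: "[(x, e')] \<in> gwords S" for e' using x by simp
  have "pres_class S R [(x, False)] \<otimes>\<^bsub>presented_group S R\<^esub> pres_class S R [(x, True)] = \<one>\<^bsub>presented_group S R\<^esub>"
    using winv_cancel[OF g[of True], of R] x
    by (simp add: mult_presented_group one_presented_group pres_class_eq_iff winv_def)
  then have "inv\<^bsub>presented_group S R\<^esub> (pres_class S R [(x, True)]) = pres_class S R [(x, False)]"
    using g by (intro inv_equality) (auto simp: carrier_presented_group)
  then show ?case using Cons.IH[OF x(2)] x
    by (simp add: y gletter_def mult_presented_group)
qed

lemma iso_of_inverse_homs:
  assumes "h \<in> hom G H" "k \<in> hom H G"
    "\<And>x. x \<in> carrier G \<Longrightarrow> k (h x) = x" "\<And>y. y \<in> carrier H \<Longrightarrow> h (k y) = y"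
  shows "h \<in> iso G H"
proof -
  have "bij_betw h (carrier G) (carrier H)"
    using assms by (intro bij_betw_byWitness[of _ k]) (auto simp: hom_def)
  then show ?thesis using assms(1) by (simp add: iso_def)
qed

lemma hom_presented_group_id:
  assumes "group H" "h \<in> hom (presented_group S R) H" "k \<in> hom H (presented_group S R)"
    and gen: "\<And>x. x \<in> S \<Longrightarrow> k (h (pres_class S R (gletter x))) = pres_class S R (gletter x)"
    and x: "x \<in> carrier (presented_group S R)"
  shows "k (h x) = x"
proof -
  let ?P = "presented_group S R" and ?c = "\<lambda>x. pres_class S R (gletter x)"
  obtain w where w: "w \<in> gwords S" "x = pres_class S R w" using x by (auto simp: carrier_presented_group)
  have c: "?c \<in> S \<rightarrow> carrier ?P" by (auto simp: carrier_presented_group gletter_def)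
  have kh: "k \<circ> h \<in> hom ?P ?P" using assms(2,3) by (rule hom_compose)
  have "k (h x) = (k \<circ> h) (wval ?P ?c w)" using w wval_presented_group[OF w(1), of R] by simp
  also have "\<dots> = wval ?P ((k \<circ> h) \<circ> ?c) w"
    by (rule group.hom_wval[OF group_presented_group group_presented_group kh c w(1)])
  also have "\<dots> = wval ?P ?c w" using gen by (intro wval_cong[OF w(1)]) simp
  also have "\<dots> = x" using w wval_presented_group[OF w(1), of R] by simp
  finally show ?thesis .
qed

text \<open>\<open>finitely_presented\<close> asks for natural numbers as generators; relabelling
  generators and relations by \<open>code\<close> provides them.\<close>

lemma finitely_presented_presented_group:
  fixes R :: "('g gword \<times> 'g gword) set" and code :: "'g \<Rightarrow> nat"
  assumes inj: "inj_on code S" and fin: "finite S" "finite R" "R \<subseteq> gwords S \<times> gwords S"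
  shows "finitely_presented (presented_group S R)"
proof -
  let ?m = "map (map_prod code id) :: 'g gword \<Rightarrow> nat gword"
  define dec where "dec = inv_into S code"
  define R' where "R' = map_prod ?m ?m ` R"
  have dec: "dec (code x) = x" if "x \<in> S" for x using inj that by (simp add: dec_def)
  have m: "?m w \<in> gwords (code ` S) \<longleftrightarrow> True" if "w \<in> gwords S" for w
    using that by (induction w) auto
  let ?P = "presented_group (code ` S) R'" and ?Q = "presented_group S R"
  let ?c = "\<lambda>x. pres_class S R (gletter x)" and ?d = "\<lambda>n. pres_class (code ` S) R' (gletter n)"
  interpret P: group ?P by (rule group_presented_group)
  interpret Q: group ?Q by (rule group_presented_group)
  have c: "?c \<in> S \<rightarrow> carrier ?Q" by (auto simp: carrier_presented_group gletter_def)
  have d: "?d \<in> code ` S \<rightarrow> carrier ?P" by (auto simp: carrier_presented_group gletter_def)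
  have cd: "?c \<circ> dec \<in> code ` S \<rightarrow> carrier ?Q" using c dec by (auto simp: Pi_iff)
  have dd: "?d \<circ> code \<in> S \<rightarrow> carrier ?P" using d by (auto simp: Pi_iff)
  have wv: "wval ?Q (?c \<circ> dec) (?m w) = pres_class S R w" if "w \<in> gwords S" for w
  proof -
    have "wval ?Q (?c \<circ> dec) (?m w) = wval ?Q ?c w"
      unfolding wval_map using dec by (intro wval_cong[OF that]) simp
    then show ?thesis using wval_presented_group[OF that] by simp
  qed
  have wd: "wval ?P (?d \<circ> code) w = pres_class (code ` S) R' (?m w)" if "w \<in> gwords S" for w
    using wval_presented_group[of "?m w" "code ` S" R'] m[OF that] by (simp add: wval_map)
  have relP: "wval ?Q (?c \<circ> dec) p = wval ?Q (?c \<circ> dec) q" if pq: "(p, q) \<in> R'" for p q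
  proof -
    obtain p' q' where pq': "(p', q') \<in> R" "p = ?m p'" "q = ?m q'" using pq by (auto simp: R'_def)
    then have g: "p' \<in> gwords S" "q' \<in> gwords S" using fin by auto
    show ?thesis using wv[OF g(1)] wv[OF g(2)] pres_class_relation[OF pq'(1) g] by (simp add: pq')
  qed
  have relQ: "wval ?P (?d \<circ> code) p = wval ?P (?d \<circ> code) q"
    if "(p, q) \<in> R" "p \<in> gwords S" "q \<in> gwords S" for p q
  proof -
    have "(?m p, ?m q) \<in> R'" using that(1) by (force simp: R'_def)
    then show ?thesis using wd that(2,3) pres_class_relation m by metis
  qed
  obtain h where h: "h \<in> hom ?P ?Q" "\<And>w. w \<in> gwords (code ` S) \<Longrightarrow> h (pres_class (code ` S) R' w) = wval ?Q (?c \<circ> dec) w"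
    using Q.von_dyck[OF cd relP] by blast
  obtain k where k: "k \<in> hom ?Q ?P" "\<And>w. w \<in> gwords S \<Longrightarrow> k (pres_class S R w) = wval ?P (?d \<circ> code) w"
    using P.von_dyck[OF dd relQ] by blast
  have hd: "h (?d n) = ?c (dec n)" if n: "n \<in> code ` S" for n
  proof -
    obtain x where x: "x \<in> S" "n = code x" using n by blast
    have g: "gletter x \<in> gwords S" "gletter n \<in> gwords (code ` S)" using x by (auto simp: gletter_def)
    have "?m (gletter x) = gletter n" by (simp add: gletter_def x)
    then show ?thesis using h(2)[OF g(2)] wv[OF g(1)] dec[OF x(1)] by (simp add: x(2))
  qed
  have kc: "k (?c x) = ?d (code x)" if "x \<in> S" for x
    using k(2)[of "gletter x"] that wd[of "gletter x"] by (simp add: gletter_def)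
  have "h \<in> iso ?P ?Q"
  proof (rule iso_of_inverse_homs[OF h(1) k(1)])
    show "k (h x) = x" if "x \<in> carrier ?P" for x
      using hd kc dec by (intro hom_presented_group_id[OF Q.is_group h(1) k(1) _ that]) auto
    show "h (k y) = y" if "y \<in> carrier ?Q" for y
      using hd kc dec by (intro hom_presented_group_id[OF P.is_group k(1) h(1) _ that]) auto
  qed
  then have "?P \<cong> ?Q" by (auto simp: is_iso_def)
  moreover have "R' \<subseteq> gwords (code ` S) \<times> gwords (code ` S)"
    using fin(3) m unfolding R'_def by fastforce
  moreover have "finite R'" "finite (code ` S)" using fin by (auto simp: R'_def)
  ultimately show ?thesis unfolding finitely_presented_def by blast
qed

section \<open>Amenability and growth\<close>

context group begin

lemma inj_on_mult_left: "g \<in> carrier G \<Longrightarrow> inj_on (\<lambda>x. g \<otimes> x) (carrier G)"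
  by (intro inj_onI) simp

lemma l_coset_image: "g <# A = (\<lambda>x. g \<otimes> x) ` A"
  by (auto simp: l_coset_def)

lemma card_l_coset:
  assumes "g \<in> carrier G" "A \<subseteq> carrier G"
  shows "card (g <# A) = card A"
  unfolding l_coset_image using inj_on_mult_left[OF assms(1)] assms(2)
  by (intro card_image) (rule inj_on_subset)

lemma l_coset_Int:
  assumes "g \<in> carrier G" "A \<subseteq> carrier G" "B \<subseteq> carrier G"
  shows "g <# (A \<inter> B) = (g <# A) \<inter> (g <# B)"
  unfolding l_coset_image using inj_on_image_Int[OF inj_on_mult_left] assms by blast

lemma finite_l_coset: "finite A \<Longrightarrow> finite (g <# A)"
  by (simp add: l_coset_def)

text \<open>Translation identifies the part of B in A with the part of gB in gA. Exchanging gA for A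
  changes the count by at most the size of gA - A in either direction, because gA and A have equal
  size.\<close>

lemma folner_translate:
  assumes g: "g \<in> carrier G" and A: "finite A" "A \<subseteq> carrier G" and B: "B \<subseteq> carrier G"
    and e: "real (card ((g <# A) - A)) \<le> e * real (card A)"
  shows "\<bar>real (card ((g <# B) \<inter> A)) - real (card (B \<inter> A))\<bar> \<le> e * real (card A)"
proof -
  let ?gA = "g <# A" and ?gB = "g <# B"
  have fin: "finite ?gA" by (rule finite_l_coset[OF A(1)])
  have c1: "card (?gB \<inter> ?gA) = card (B \<inter> A)"
    using l_coset_Int[OF g B A(2)] card_l_coset[OF g, of "B \<inter> A"] B by auto
  have "card ?gA = card A" by (rule card_l_coset[OF g A(2)])
  moreover have "card (A - ?gA) + card (A \<inter> ?gA) = card A"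
    using card_Diff_subset_Int[of A ?gA] A(1) card_mono[of A "A \<inter> ?gA"] by simp
  moreover have "card (?gA - A) + card (A \<inter> ?gA) = card ?gA"
    using card_Diff_subset_Int[of ?gA A] fin card_mono[of ?gA "A \<inter> ?gA"] by (simp add: Int_commute)
  ultimately have c2: "card (A - ?gA) = card (?gA - A)" by linarith
  have "?gB \<inter> A \<subseteq> (?gB \<inter> ?gA) \<union> (A - ?gA)" by blast
  then have "card (?gB \<inter> A) \<le> card ((?gB \<inter> ?gA) \<union> (A - ?gA))"
    using A(1) fin by (intro card_mono) auto
  also have "\<dots> \<le> card (?gB \<inter> ?gA) + card (A - ?gA)" by (rule card_Un_le)
  finally have u: "card (?gB \<inter> A) \<le> card (B \<inter> A) + card (?gA - A)" using c1 c2 by simp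
  have "?gB \<inter> ?gA \<subseteq> (?gB \<inter> A) \<union> (?gA - A)" by blast
  then have "card (?gB \<inter> ?gA) \<le> card ((?gB \<inter> A) \<union> (?gA - A))"
    using A(1) fin by (intro card_mono) auto
  also have "\<dots> \<le> card (?gB \<inter> A) + card (?gA - A)" by (rule card_Un_le)
  finally have "card (B \<inter> A) \<le> card (?gB \<inter> A) + card (?gA - A)" using c1 by simp
  then show ?thesis using u e by linarith
qed

text \<open>A cluster point of the normalized counting measures of a Folner sequence, which exists by
  Tychonoff's theorem, is invariant under the generators and therefore under the group.\<close>

lemma amenable_of_folner:
  assumes S: "S \<subseteq> carrier G" "generate G S = carrier G"
    and folner: "\<And>e :: real. e > 0 \<Longrightarrow> \<exists>A. finite A \<and> A \<noteq> {} \<and> A \<subseteq> carrier G \<and>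
      (\<forall>x\<in>S. real (card ((x <# A) - A)) \<le> e * real (card A))"
  shows "amenable G"
proof -
  have "\<exists>A. finite A \<and> A \<noteq> {} \<and> A \<subseteq> carrier G \<and>
      (\<forall>x\<in>S. real (card ((x <# A) - A)) \<le> inverse (real (Suc n)) * real (card A))" for n
    by (rule folner) simp
  then obtain A where A: "\<And>n. finite (A n)" "\<And>n. A n \<noteq> {}" "\<And>n. A n \<subseteq> carrier G"
    "\<And>n x. x \<in> S \<Longrightarrow> real (card ((x <# A n) - A n)) \<le> inverse (real (Suc n)) * real (card (A n))"
    by metis
  have cpos: "real (card (A n)) > 0" for n using A(1,2) by (simp add: card_gt_0_iff)
  define \<mu> where "\<mu> n B = real (card (B \<inter> A n)) / real (card (A n))" for n B
  define K where "K = (PiE UNIV (\<lambda>_. {0..1}) :: ('a set \<Rightarrow> real) set)"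
  have "compactin (product_topology (\<lambda>_ :: 'a set. euclidean :: real topology) UNIV) K"
    unfolding K_def compactin_PiE by (simp add: compact_Icc)
  then have K: "compact K" by (simp add: euclidean_product_topology)
  have \<mu>K: "\<mu> n \<in> K" for n
  proof -
    have "card (B \<inter> A n) \<le> card (A n)" for B using A(1) by (intro card_mono) auto
    then show ?thesis using cpos by (auto simp: K_def \<mu>_def PiE_iff divide_le_eq_1)
  qed
  have "eventually (\<lambda>\<nu>. \<nu> \<in> K) (filtermap \<mu> sequentially)"
    by (simp add: eventually_filtermap \<mu>K)
  moreover have "filtermap \<mu> sequentially \<noteq> bot" by (simp add: filtermap_bot_iff)
  ultimately obtain m where m: "m \<in> K" "inf (nhds m) (filtermap \<mu> sequentially) \<noteq> bot"
    using K unfolding compact_filter by blast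
  let ?L = "inf (nhds m) (filtermap \<mu> sequentially)"
  have coord: "((\<lambda>\<nu>. \<nu> B) \<longlongrightarrow> m B) ?L" for B
  proof -
    have "((\<lambda>\<nu>. \<nu> B) \<longlongrightarrow> m B) (nhds m)"
    proof (rule topological_tendstoI)
      fix U :: "real set" assume U: "open U" "m B \<in> U"
      have "open ((\<lambda>\<nu> :: 'a set \<Rightarrow> real. \<nu> B) -` U)"
        by (rule open_vimage[OF U(1) continuous_on_product_coordinates])
      then show "eventually (\<lambda>\<nu>. \<nu> B \<in> U) (nhds m)"
        using U(2) unfolding eventually_nhds by (intro exI[of _ "(\<lambda>\<nu>. \<nu> B) -` U"]) auto
    qed
    then show ?thesis by (rule tendsto_mono[rotated]) simp
  qed
  \<comment> \<open>Along \<open>?L\<close> every coordinate tends to that of \<open>m\<close>, and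
    since \<open>?L\<close> is finer than the image of the sequence, sequential limits persist.
    Identities for the averages thus pass to \<open>m\<close> without a convergent
    subsequence.\<close>
  have lim: "c = d" if "(g \<longlongrightarrow> c) ?L" "(\<lambda>n. g (\<mu> n)) \<longlonglongrightarrow> d" for g and c d :: real
  proof -
    have "(g \<longlongrightarrow> d) (filtermap \<mu> sequentially)" using that(2) by (simp add: filterlim_filtermap)
    then have "(g \<longlongrightarrow> d) ?L" by (rule tendsto_mono[rotated]) simp
    then show ?thesis using tendsto_unique[OF m(2) that(1)] by simp
  qed
  have pos: "0 \<le> m B" for B using m(1) by (auto simp: K_def PiE_iff)
  have tot: "m (carrier G) = 1"
  proof (rule lim[OF coord])
    have "\<mu> n (carrier G) = 1" for n using A(3) cpos[of n] by (simp add: \<mu>_def Int_absorb1)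
    then show "(\<lambda>n. \<mu> n (carrier G)) \<longlonglongrightarrow> 1" by simp
  qed
  have add: "m (B \<union> C) = m B + m C" if "B \<inter> C = {}" for B C
  proof -
    have "m (B \<union> C) - m B - m C = 0"
    proof (rule lim)
      show "((\<lambda>\<nu>. \<nu> (B \<union> C) - \<nu> B - \<nu> C) \<longlongrightarrow> m (B \<union> C) - m B - m C) ?L"
        by (intro tendsto_diff coord)
      have "card ((B \<union> C) \<inter> A n) = card (B \<inter> A n) + card (C \<inter> A n)" for n
        using that A(1) by (subst card_Un_disjoint[symmetric]) (auto simp: Int_Un_distrib2)
      then have "\<mu> n (B \<union> C) - \<mu> n B - \<mu> n C = 0" for n by (simp add: \<mu>_def add_divide_distrib)
      then show "(\<lambda>n. \<mu> n (B \<union> C) - \<mu> n B - \<mu> n C) \<longlonglongrightarrow> 0" by simp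
    qed
    then show ?thesis by simp
  qed
  have gen: "m (x <# B) = m B" if x: "x \<in> S" and B: "B \<subseteq> carrier G" for x B
  proof -
    have "m (x <# B) - m B = 0"
    proof (rule lim)
      show "((\<lambda>\<nu>. \<nu> (x <# B) - \<nu> B) \<longlongrightarrow> m (x <# B) - m B) ?L" by (intro tendsto_diff coord)
      have "\<bar>\<mu> n (x <# B) - \<mu> n B\<bar> \<le> inverse (real (Suc n))" for n
      proof -
        have "\<bar>real (card ((x <# B) \<inter> A n)) - real (card (B \<inter> A n))\<bar> \<le> inverse (real (Suc n)) * real (card (A n))"
          using x S(1) by (intro folner_translate A B) auto
        moreover have "\<mu> n (x <# B) - \<mu> n B = (real (card ((x <# B) \<inter> A n)) - real (card (B \<inter> A n))) / real (card (A n))"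
          by (simp add: \<mu>_def diff_divide_distrib)
        ultimately show ?thesis using cpos[of n] by (simp add: abs_divide pos_divide_le_eq)
      qed
      then show "(\<lambda>n. \<mu> n (x <# B) - \<mu> n B) \<longlonglongrightarrow> 0"
        by (intro tendsto_0_le[OF LIMSEQ_inverse_real_of_nat, of _ 1]) (simp add: always_eventually)
    qed
    then show ?thesis by simp
  qed
  have inv: "\<forall>B \<subseteq> carrier G. m (g <# B) = m B" if "g \<in> carrier G" for g
  proof -
    have "g \<in> generate G S" using that S(2) by simp
    then show ?thesis
    proof induction
      case one
      then show ?case by (simp add: lcos_mult_one)
    next
      case (incl h)
      then show ?case using gen by blast
    next
      case (inv h)
      then have h: "h \<in> carrier G" using S(1) by blast
      show ?case
      proof (intro allI impI)
        fix B assume B: "B \<subseteq> carrier G"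
        have iB: "inv h <# B \<subseteq> carrier G" using h B by (auto simp: l_coset_def)
        have "h <# (inv h <# B) = B" using h B by (simp add: lcos_m_assoc lcos_mult_one)
        then show "m (inv h <# B) = m B" using gen[OF inv iB] by simp
      qed
    next
      case (eng h1 h2)
      then have h: "h1 \<in> carrier G" "h2 \<in> carrier G" using generate_in_carrier[OF S(1)] by auto
      show ?case
      proof (intro allI impI)
        fix B assume B: "B \<subseteq> carrier G"
        have iB: "h2 <# B \<subseteq> carrier G" using h B by (auto simp: l_coset_def)
        have "m (h1 \<otimes> h2 <# B) = m (h1 <# (h2 <# B))" using h B by (simp add: lcos_m_assoc)
        then show "m (h1 \<otimes> h2 <# B) = m B" using eng.IH iB B by simp
      qed
    qed
  qed
  show ?thesis unfolding amenable_def
    using pos tot add inv is_group by (intro conjI exI[of _ m]) auto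
qed

section \<open>Word balls and free semigroups\<close>

lemma foldr_closed: "set xs \<subseteq> carrier G \<Longrightarrow> foldr (\<lambda>x y. x \<otimes> y) xs \<one> \<in> carrier G"
  by (induction xs) auto

lemma foldr_append_mult:
  "set xs \<subseteq> carrier G \<Longrightarrow> set ys \<subseteq> carrier G \<Longrightarrow>
    foldr (\<lambda>x y. x \<otimes> y) (xs @ ys) \<one> = foldr (\<lambda>x y. x \<otimes> y) xs \<one> \<otimes> foldr (\<lambda>x y. x \<otimes> y) ys \<one>"
  by (induction xs) (auto simp: m_assoc foldr_closed)

lemma word_ball_mult:
  assumes "S \<subseteq> carrier G" "x \<in> word_ball G S m" "y \<in> word_ball G S n"
  shows "x \<otimes> y \<in> word_ball G S (m + n)"
proof -
  obtain xs ys where xs: "x = foldr (\<lambda>x y. x \<otimes> y) xs \<one>" "set xs \<subseteq> S \<union> m_inv G ` S" "length xs \<le> m"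
    and ys: "y = foldr (\<lambda>x y. x \<otimes> y) ys \<one>" "set ys \<subseteq> S \<union> m_inv G ` S" "length ys \<le> n"
    using assms(2,3) by (auto simp: word_ball_def)
  have "S \<union> m_inv G ` S \<subseteq> carrier G" using assms(1) by auto
  then have "set xs \<subseteq> carrier G" "set ys \<subseteq> carrier G" using xs ys by blast+
  then have "x \<otimes> y = foldr (\<lambda>x y. x \<otimes> y) (xs @ ys) \<one>"
    by (simp only: xs(1) ys(1) foldr_append_mult)
  then show ?thesis
    using xs ys unfolding word_ball_def by (intro CollectI exI[of _ "xs @ ys"]) auto
qed

lemma word_ball_mono: "m \<le> n \<Longrightarrow> word_ball G S m \<subseteq> word_ball G S n"
  by (force simp: word_ball_def)

lemma one_in_word_ball: "\<one> \<in> word_ball G S n"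
  unfolding word_ball_def by (intro CollectI exI[of _ "[]"]) auto

lemma generator_in_word_ball:
  assumes "S \<subseteq> carrier G" "x \<in> S \<union> m_inv G ` S"
  shows "x \<in> word_ball G S 1"
proof -
  have "x = foldr (\<lambda>x y. x \<otimes> y) [x] \<one>" using assms by auto
  then show ?thesis using assms(2) unfolding word_ball_def by (intro CollectI exI[of _ "[x]"]) auto
qed

lemma finite_word_ball:
  assumes "finite S"
  shows "finite (word_ball G S n)"
proof -
  have "word_ball G S n = (\<lambda>xs. foldr (\<lambda>x y. x \<otimes> y) xs \<one>) ` {xs. set xs \<subseteq> S \<union> m_inv G ` S \<and> length xs \<le> n}"
    by (auto simp: word_ball_def)
  moreover have "finite {xs. set xs \<subseteq> S \<union> m_inv G ` S \<and> length xs \<le> n}"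
    using assms by (intro finite_lists_length_le) auto
  ultimately show ?thesis by simp
qed

lemma generate_in_word_ball:
  assumes "S \<subseteq> carrier G" "x \<in> generate G S"
  shows "\<exists>n. x \<in> word_ball G S n"
  using assms(2)
proof induction
  case one
  then show ?case using one_in_word_ball by blast
next
  case (incl h)
  then show ?case using generator_in_word_ball[OF assms(1)] by blast
next
  case (inv h)
  then show ?case using generator_in_word_ball[OF assms(1)] by blast
next
  case (eng h1 h2)
  then show ?case using word_ball_mult[OF assms(1)] by blast
qed

text \<open>Letters are multiplied on the right, so that a normal form s^k g is updated by moving
  one s through g.\<close>

primrec semigroup_word :: "'a \<Rightarrow> 'a \<Rightarrow> bool list \<Rightarrow> 'a" where
  "semigroup_word x y [] = \<one>"
| "semigroup_word x y (b # l) = semigroup_word x y l \<otimes> (if b then y else x)"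

text \<open>Distinctness is needed only for words of equal length: they give 2^k elements in the
  ball of radius L k, where \<open>L\<close> bounds the lengths of \<open>x\<close> and
  \<open>y\<close> in the given generators.\<close>

lemma exponential_growth_of_free_semigroup:
  assumes gen: "finite_generating_set G S0" and xy: "x \<in> carrier G" "y \<in> carrier G"
    and inj: "\<And>n. inj_on (semigroup_word x y) {l. length l = n}"
  shows "exponential_growth G"
  unfolding exponential_growth_def
proof (intro conjI allI impI)
  show "\<exists>S. finite_generating_set G S" using gen by blast
  fix S assume S: "finite_generating_set G S"
  then have S': "finite S" "S \<subseteq> carrier G" "generate G S = carrier G"
    by (auto simp: finite_generating_set_def)
  obtain p q where pq: "x \<in> word_ball G S p" "y \<in> word_ball G S q"
    using generate_in_word_ball[OF S'(2)] xy S'(3) by metis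
  define L where "L = Suc (max p q)"
  have L: "L \<ge> 1" "x \<in> word_ball G S L" "y \<in> word_ball G S L"
  proof -
    show "L \<ge> 1" by (simp add: L_def)
    have "p \<le> L" "q \<le> L" by (simp_all add: L_def)
    then show "x \<in> word_ball G S L" "y \<in> word_ball G S L" using pq word_ball_mono by blast+
  qed
  have sw: "semigroup_word x y l \<in> word_ball G S (L * length l)" for l
  proof (induction l)
    case (Cons b l)
    have "semigroup_word x y l \<otimes> (if b then y else x) \<in> word_ball G S (L * length l + L)"
      using L by (intro word_ball_mult[OF S'(2) Cons]) auto
    then show ?case by (simp add: add.commute)
  qed (simp add: one_in_word_ball)
  have big: "2 ^ k \<le> card (word_ball G S (L * k))" for k
  proof -
    have "card {l :: bool list. set l \<subseteq> UNIV \<and> length l = k} = card (UNIV :: bool set) ^ k"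
      by (rule card_lists_length_eq) simp
    then have "card {l :: bool list. length l = k} = 2 ^ k" by simp
    then have "2 ^ k = card (semigroup_word x y ` {l. length l = k})" using inj by (simp add: card_image)
    also have "\<dots> \<le> card (word_ball G S (L * k))"
      using sw by (intro card_mono finite_word_ball S'(1)) auto
    finally show ?thesis .
  qed
  have two: "2 \<le> card (word_ball G S n)" if "n \<ge> 1" for n
  proof -
    have "\<exists>z\<in>S. z \<noteq> \<one>"
    proof (rule ccontr)
      assume "\<not> ?thesis"
      then have "S \<subseteq> {\<one>}" by blast
      then have "carrier G \<subseteq> {\<one>}" using S'(3) mono_generate[of S "{\<one>}"] generate_one by auto
      then have "x = y" using xy by auto
      then have "semigroup_word x y [True] = semigroup_word x y [False]" by simp
      from inj_onD[OF inj[of 1] this] show False by simp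
    qed
    then obtain z where z: "z \<in> S" "z \<noteq> \<one>" by blast
    have "{\<one>, z} \<subseteq> word_ball G S n"
      using one_in_word_ball generator_in_word_ball[OF S'(2), of z] word_ball_mono[OF that] z by auto
    then have "card {\<one>, z} \<le> card (word_ball G S n)" by (intro card_mono finite_word_ball S'(1))
    then show ?thesis using z by simp
  qed
  \<comment> \<open>For n at least L and k = n div L, the radius n is at most 2 L k. For 1 <= n < L
    the power r^n is at most 2, and the ball contains a nontrivial generator besides the
    identity.\<close>
  define r where "r = root (2 * L) 2"
  have r: "r > 1" "r ^ (2 * L) = 2" using L(1) by (auto simp: r_def real_root_gt_1_iff)
  show "\<exists>r::real. r > 1 \<and> (\<forall>n. r ^ n \<le> real (card (word_ball G S n)))"
  proof (intro exI[of _ r] conjI allI)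
    fix n
    consider "n = 0" | "1 \<le> n" "n < L" | "L \<le> n" by linarith
    then show "r ^ n \<le> real (card (word_ball G S n))"
    proof cases
      case 1
      have "card (word_ball G S n) > 0" using one_in_word_ball[of S n] finite_word_ball[OF S'(1), of n]
        by (auto simp: card_gt_0_iff)
      then show ?thesis using 1 by simp
    next
      case 2
      have "r ^ n \<le> r ^ (2 * L)" using r(1) 2 by (intro power_increasing) auto
      then show ?thesis using r(2) two[OF 2(1)] by simp
    next
      case 3
      define k where "k = n div L"
      have k: "k \<ge> 1" using 3 L(1) by (simp add: k_def div_greater_zero_iff Suc_leI)
      have "n < L * k + L"
        using L(1) mult_div_mod_eq[of L n] mod_less_divisor[of L n] unfolding k_def by linarith
      moreover have "L \<le> L * k" using k by simp
      ultimately have "n \<le> (2 * L) * k" by linarith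
      then have "r ^ n \<le> r ^ ((2 * L) * k)" using r(1) by (intro power_increasing) auto
      also have "\<dots> = 2 ^ k" by (subst power_mult[of r "2 * L" k]) (simp only: r(2))
      also have "\<dots> \<le> real (card (word_ball G S (L * k)))" using big[of k] by (simp add: numeral_power_le_of_nat_cancel_iff)
      also have "\<dots> \<le> real (card (word_ball G S n))"
        using word_ball_mono[of "L * k" n S] by (simp add: k_def card_mono finite_word_ball S'(1))
      finally show ?thesis .
    qed
  qed (rule r(1))
qed (rule is_group)

end

section \<open>The embedding and the HNN extension\<close>

abbreviation gt_cls :: "gen gword \<Rightarrow> gen gword set" where
  "gt_cls \<equiv> pres_class UNIV gt_relations"

lemma gt_cls_eq_iff: "gt_cls u = gt_cls v \<longleftrightarrow> gteq u v"
  by (simp add: pres_class_eq_iff gteq_def)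

lemma carrier_gt_group: "carrier gt_group = range gt_cls"
proof -
  have "gwords UNIV = (UNIV :: gen gword set)" by auto
  then show ?thesis by (simp add: gt_group_def carrier_presented_group)
qed

lemma gt_cls_carrier [simp]: "gt_cls w \<in> carrier gt_group"
  by (simp add: carrier_gt_group)

lemma mult_gt_group: "gt_cls u \<otimes>\<^bsub>gt_group\<^esub> gt_cls v = gt_cls (u @ v)"
  by (simp add: gt_group_def mult_presented_group)

lemma one_gt_group: "\<one>\<^bsub>gt_group\<^esub> = gt_cls []"
  by (simp add: gt_group_def one_presented_group)

lemma group_gt_group: "group gt_group"
  unfolding gt_group_def by (rule group_presented_group)

lemma wval_gt_elem: "wval gt_group gt_elem w = gt_cls w"
  using wval_presented_group[of w UNIV gt_relations] by (simp add: gt_group_def gt_elem_def[abs_def])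

lemma ev_Cons_comp: "ev (x # w) = ev w \<circ> lact x"
  by (simp add: fun_eq_iff)

lemma mult_img_group: "g \<otimes>\<^bsub>img_group\<^esub> h = h \<circ> g"
  by (simp add: img_group_def tree_aut_group_def)

lemma one_img_group: "\<one>\<^bsub>img_group\<^esub> = id"
  by (simp add: img_group_def tree_aut_group_def)

text \<open>The generators are involutions, so words without inverse letters reach the whole
  group.\<close>

lemma carrier_img_group_ev: "carrier img_group = range ev"
proof
  interpret T: group tree_aut_group by (rule group_tree_aut_group)
  have mult: "g \<otimes>\<^bsub>tree_aut_group\<^esub> h = h \<circ> g" "\<one>\<^bsub>tree_aut_group\<^esub> = id" for g h
    by (simp_all add: tree_aut_group_def)
  have inv: "inv\<^bsub>tree_aut_group\<^esub> h = h" "h \<in> range ev" if h: "h \<in> {img_a, img_b, img_c}" for h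
  proof -
    obtain x where x: "h = lact x" using h by (auto intro: that[of LA] that[of LB] that[of LC])
    have "h \<in> carrier tree_aut_group" using h tree_automorphism_img by (auto simp: tree_aut_group_def)
    then show "inv\<^bsub>tree_aut_group\<^esub> h = h" by (intro T.inv_equality) (auto simp: mult x fun_eq_iff)
    show "h \<in> range ev" using x by (intro range_eqI[of _ _ "[x]"]) simp
  qed
  show "carrier img_group \<subseteq> range ev"
  proof
    fix g assume "g \<in> carrier img_group"
    then have "g \<in> generate tree_aut_group {img_a, img_b, img_c}" by (simp add: carrier_img_group)
    then show "g \<in> range ev"
    proof induction
      case one
      then show ?case by (intro range_eqI[of _ _ "[]"]) (simp add: mult)
    next
      case (eng g h)
      then obtain u v where "g = ev u" "h = ev v" by blast
      then show ?case by (intro range_eqI[of _ _ "u @ v"]) (simp add: mult ev_append)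
    qed (use inv in auto)
  qed
  show "range ev \<subseteq> carrier img_group"
  proof
    fix g assume "g \<in> range ev"
    then obtain w where "g = ev w" by blast
    moreover have "ev w \<in> generate tree_aut_group {img_a, img_b, img_c}"
    proof (induction w)
      case Nil
      show ?case using generate.one[of tree_aut_group] unfolding mult(2) ev.simps .
    next
      case (Cons x w)
      have "lact x \<in> generate tree_aut_group {img_a, img_b, img_c}"
        by (rule generate.incl) (cases x; simp)
      from generate.eng[OF this Cons] show ?case unfolding mult(1) ev_Cons_comp .
    qed
    ultimately show "g \<in> carrier img_group" by (simp add: carrier_img_group)
  qed
qed

definition word_of :: "(vertex \<Rightarrow> vertex) \<Rightarrow> letter list" where
  "word_of g = (SOME w. ev w = g)"

lemma ev_word_of: "ev (word_of (ev w)) = ev w"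
  unfolding word_of_def by (rule someI[of _ w]) simp

definition img_emb :: "(vertex \<Rightarrow> vertex) \<Rightarrow> gen gword set" where
  "img_emb g = gt_cls (gw (word_of g))"

definition img_theta :: "(vertex \<Rightarrow> vertex) \<Rightarrow> vertex \<Rightarrow> vertex" where
  "img_theta g = ev (subst (word_of g))"

text \<open>Completeness of the relators makes the class independent of the spelling chosen by
  \<open>word_of\<close>; soundness will give injectivity.\<close>

lemma img_emb_ev: "img_emb (ev w) = gt_cls (gw w)"
  using leq_iff[of "word_of (ev w)" w] ev_word_of[of w] by (simp add: img_emb_def gt_cls_eq_iff leq_def)

lemma img_theta_ev: "img_theta (ev w) = ev (subst w)"
  using ev_subst_cong[of "word_of (ev w)" w] ev_word_of[of w] by (simp add: img_theta_def)

lemma img_emb_hom: "img_emb \<in> hom img_group gt_group"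
  by (rule homI) (auto simp: carrier_img_group_ev carrier_gt_group img_emb_ev mult_img_group
      ev_append[symmetric] mult_gt_group)

lemma inj_on_img_emb: "inj_on img_emb (carrier img_group)"
  using leq_iff by (auto simp: inj_on_def carrier_img_group_ev img_emb_ev gt_cls_eq_iff leq_def)

lemma img_theta_hom: "img_theta \<in> hom img_group img_group"
  by (rule homI) (auto simp: carrier_img_group_ev img_theta_ev mult_img_group ev_append[symmetric])

lemma inj_on_img_theta: "inj_on img_theta (carrier img_group)"
  by (auto simp: inj_on_def carrier_img_group_ev img_theta_ev ev_subst_cong)

lemma img_gens: "img_a = ev [LA]" "img_b = ev [LB]" "img_c = ev [LC]"
  by simp_all

lemma img_emb_gens: "img_emb img_a = gt_elem Ga" "img_emb img_b = gt_elem Gb" "img_emb img_c = gt_elem Gc"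
  unfolding img_gens img_emb_ev by (simp_all add: gt_elem_def gletter_def)

lemma gt_relations_eq: "gt_relations = (\<lambda>r. (r, [])) ` gt_relators \<union>
    range (\<lambda>x. (wconj (gletter (gl x)) (gletter Gs), gw (subst1 x)))"
  unfolding gt_relations_def Let_def UNIV_letter by (simp add: gletter_def)

lemma gt_inv_s: "inv\<^bsub>gt_group\<^esub> (gt_cls [(Gs, True)]) = gt_cls [(Gs, False)]"
  by (rule group.inv_equality[OF group_gt_group])
    (simp_all add: mult_gt_group one_gt_group gt_cls_eq_iff gteq_cancel')

text \<open>Mutually inverse maps are given on generators. The multiplication table is respected
  because the embedding is a homomorphism. Conversely, a relator contains no s and is trivial in
  \<open>img_group\<close>, so it holds in the HNN-extension, where the whole multiplication table
  is available.\<close>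

lemma ascending_HNN_gt_group:
  "ascending_HNN_extension gt_group img_group img_theta img_emb (gt_elem Gs)"
proof -
  let ?S = "hnn_gens img_group" and ?R = "hnn_relations img_group img_theta"
  let ?H = "presented_group ?S ?R"
  define kappa where "kappa g = pres_class ?S ?R (gletter (Some g))" for g
  define t where "t = pres_class ?S ?R (gletter None)"
  interpret P: group gt_group by (rule group_gt_group)
  interpret H: group ?H by (rule group_presented_group)
  interpret I: group img_group by (rule group_img_group)
  have gS: "gletter (Some g) \<in> gwords ?S" if "g \<in> carrier img_group" for g
    using that by (simp add: gletter_def hnn_gens_def)
  have gN: "gletter None \<in> gwords ?S" by (simp add: gletter_def hnn_gens_def)
  have kc: "kappa g \<in> carrier ?H" if "g \<in> carrier img_group" for g
    using gS[OF that] by (simp add: kappa_def carrier_presented_group)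
  have tc: "t \<in> carrier ?H" using gN by (simp add: t_def carrier_presented_group)
  have kmult: "kappa (g \<otimes>\<^bsub>img_group\<^esub> h) = kappa g \<otimes>\<^bsub>?H\<^esub> kappa h"
    if "g \<in> carrier img_group" "h \<in> carrier img_group" for g h
  proof -
    have "(gletter (Some g) @ gletter (Some h), gletter (Some (g \<otimes>\<^bsub>img_group\<^esub> h))) \<in> ?R"
      using that by (auto simp: hnn_relations_def)
    then show ?thesis
      using pres_class_relation[of "gletter (Some g) @ gletter (Some h)" _ ?R ?S] that gS
      by (simp add: kappa_def mult_presented_group)
  qed
  have khom: "kappa \<in> hom img_group ?H" using kc kmult by (intro homI)
  have kone: "kappa \<one>\<^bsub>img_group\<^esub> = \<one>\<^bsub>?H\<^esub>"
    using hom_one[OF khom I.is_group H.is_group] .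
  have ktheta: "inv\<^bsub>?H\<^esub> t \<otimes>\<^bsub>?H\<^esub> (kappa g \<otimes>\<^bsub>?H\<^esub> t) = kappa (img_theta g)"
    if g: "g \<in> carrier img_group" for g
  proof -
    let ?w = "wconj (gletter (Some g)) (gletter None)"
    have "(?w, gletter (Some (img_theta g))) \<in> ?R" using g by (auto simp: hnn_relations_def)
    moreover have w: "?w \<in> gwords ?S" using gS[OF g] gN by (simp add: wconj_def winv_gwords)
    moreover have "img_theta g \<in> carrier img_group" using g img_theta_hom by (auto simp: hom_def)
    ultimately have "pres_class ?S ?R ?w = kappa (img_theta g)"
      unfolding kappa_def using gS by (intro pres_class_relation)
    moreover have "wval ?H (\<lambda>x. pres_class ?S ?R (gletter x)) ?w = pres_class ?S ?R ?w"
      by (rule wval_presented_group[OF w])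
    ultimately show ?thesis
      using tc by (simp add: wconj_def winv_def gletter_def kappa_def t_def)
  qed
  define f where "f x = (case x of Some g \<Rightarrow> img_emb g | None \<Rightarrow> gt_elem Gs)" for x
  have elem: "gt_elem x \<in> carrier gt_group" for x by (simp add: gt_elem_def carrier_gt_group)
  have ec: "img_emb g \<in> carrier gt_group" if "g \<in> carrier img_group" for g
    using that img_emb_hom by (auto simp: hom_def)
  have f: "f \<in> ?S \<rightarrow> carrier gt_group"
    using ec elem by (auto simp: f_def hnn_gens_def)
  have fR: "wval gt_group f p = wval gt_group f q" if pq: "(p, q) \<in> ?R" for p q
  proof -
    consider g h where "g \<in> carrier img_group" "h \<in> carrier img_group"
      "p = gletter (Some g) @ gletter (Some h)" "q = gletter (Some (g \<otimes>\<^bsub>img_group\<^esub> h))"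
      | g where "g \<in> carrier img_group" "p = wconj (gletter (Some g)) (gletter None)" "q = gletter (Some (img_theta g))"
      using pq by (auto simp: hnn_relations_def)
    then show ?thesis
    proof cases
      case 1
      then have "img_emb (g \<otimes>\<^bsub>img_group\<^esub> h) = img_emb g \<otimes>\<^bsub>gt_group\<^esub> img_emb h"
        using img_emb_hom by (auto simp: hom_def)
      then show ?thesis using 1 ec by (simp add: f_def gletter_def)
    next
      case 2
      then obtain w where w: "g = ev w" by (auto simp: carrier_img_group_ev)
      have "inv\<^bsub>gt_group\<^esub> (gt_elem Gs) \<otimes>\<^bsub>gt_group\<^esub> (img_emb g \<otimes>\<^bsub>gt_group\<^esub> gt_elem Gs) = img_emb (img_theta g)"
        using conj_subst[of w]
        by (simp add: gt_inv_s w img_theta_ev img_emb_ev gt_elem_def gletter_def mult_gt_group gt_cls_eq_iff)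
      moreover have "img_emb (img_theta g) \<in> carrier gt_group"
        using 2(1) img_theta_hom ec by (auto simp: hom_def)
      ultimately show ?thesis using 2 ec elem by (simp add: f_def gletter_def wconj_def winv_def)
    qed
  qed
  obtain h where h: "h \<in> hom ?H gt_group" "\<And>w. w \<in> gwords ?S \<Longrightarrow> h (pres_class ?S ?R w) = wval gt_group f w"
    using P.von_dyck[OF f fR] by blast
  have hk: "h (kappa g) = img_emb g" if "g \<in> carrier img_group" for g
    using h(2)[OF gS[OF that]] ec[OF that] by (simp add: kappa_def gletter_def f_def)
  have ht: "h t = gt_elem Gs"
    using h(2)[OF gN] elem by (simp add: t_def gletter_def f_def)
  define k0 where "k0 x = (case x of Ga \<Rightarrow> kappa img_a | Gb \<Rightarrow> kappa img_b | Gc \<Rightarrow> kappa img_c | Gs \<Rightarrow> t)" for x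
  have evc: "ev w \<in> carrier img_group" for w by (simp add: carrier_img_group_ev)
  have k0l: "k0 (gl x) = kappa (lact x)" "lact x \<in> carrier img_group" for x
  proof -
    show "k0 (gl x) = kappa (lact x)" by (cases x) (simp_all add: k0_def)
    have "lact x = ev [x]" by simp
    then show "lact x \<in> carrier img_group" using evc by metis
  qed
  have k0: "k0 \<in> UNIV \<rightarrow> carrier ?H"
  proof
    fix x show "k0 x \<in> carrier ?H"
      using k0l[of LA] k0l[of LB] k0l[of LC] kc tc by (cases x) (auto simp: k0_def)
  qed
  \<comment> \<open>The relators contain inverse letters, whereas \<open>ev\<close> reads positive
    words only; the multiplication table makes the letters involutions here too.\<close>
  have k0inv: "inv\<^bsub>?H\<^esub> (k0 (gl x)) = k0 (gl x)" for x
  proof -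
    have "kappa (lact x) \<otimes>\<^bsub>?H\<^esub> kappa (lact x) = kappa (lact x \<otimes>\<^bsub>img_group\<^esub> lact x)"
      using kmult k0l(2) by simp
    also have "lact x \<otimes>\<^bsub>img_group\<^esub> lact x = \<one>\<^bsub>img_group\<^esub>"
      by (simp add: mult_img_group one_img_group fun_eq_iff)
    finally show ?thesis using kone kc k0l by (intro H.inv_equality) auto
  qed
  have k0w: "wval ?H k0 w = kappa (ev (strip w))" if "Gs \<notin> fst ` set w" for w
    using that
  proof (induction w)
    case Nil
    show ?case unfolding strip.simps ev.simps wval_simps one_img_group[symmetric] by (rule kone[symmetric])
  next
    case (Cons y w)
    obtain x e where y: "y = (x, e)" by (cases y)
    have "x \<noteq> Gs" using Cons.prems y by auto
    then obtain l where l: "x = gl l" by (cases x) (metis gl.simps)+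
    have "strip (y # w) = l # strip w" by (cases l) (simp_all add: y l)
    moreover have "kappa (ev (l # strip w)) = kappa (lact l) \<otimes>\<^bsub>?H\<^esub> kappa (ev (strip w))"
      using kmult[OF k0l(2)[of l] evc[of "strip w"]] unfolding mult_img_group ev_Cons_comp .
    moreover have "wval ?H k0 (y # w) = kappa (lact l) \<otimes>\<^bsub>?H\<^esub> wval ?H k0 w"
      unfolding y l wval_simps k0inv k0l(1)[symmetric] by simp
    ultimately show ?case using Cons by (simp del: ev.simps)
  qed
  have k0R: "wval ?H k0 p = wval ?H k0 q" if pq: "(p, q) \<in> gt_relations" for p q
  proof -
    have "p \<in> gt_relators \<and> q = [] \<or> (\<exists>x. p = wconj (gletter (gl x)) (gletter Gs) \<and> q = gw (subst1 x))"
      using pq unfolding gt_relations_eq by blast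
    then consider "p \<in> gt_relators" "q = []"
      | x where "p = wconj (gletter (gl x)) (gletter Gs)" "q = gw (subst1 x)" by blast
    then show ?thesis
    proof cases
      case 1
      have "wval ?H k0 p = \<one>\<^bsub>?H\<^esub>"
        unfolding k0w[OF relators_sound(1)[OF 1(1)]] relators_sound(2)[OF 1(1)]
          one_img_group[symmetric] by (rule kone)
      then show ?thesis by (simp add: 1(2))
    next
      case 2
      have "img_theta (lact x) = ev (subst1 x)" using img_theta_ev[of "[x]"] by simp
      then have "inv\<^bsub>?H\<^esub> t \<otimes>\<^bsub>?H\<^esub> (kappa (lact x) \<otimes>\<^bsub>?H\<^esub> t) = kappa (ev (subst1 x))"
        using ktheta[OF k0l(2)[of x]] by simp
      moreover have "wval ?H k0 q = kappa (ev (subst1 x))"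
        using k0w[of q] strip_gw[of "subst1 x"] 2(2) by simp
      moreover have "k0 Gs = t" by (simp add: k0_def)
      then have "wval ?H k0 p = inv\<^bsub>?H\<^esub> t \<otimes>\<^bsub>?H\<^esub> (kappa (lact x) \<otimes>\<^bsub>?H\<^esub> t)"
        using tc k0l(1)[of x] unfolding 2(1) wconj_def winv_def gletter_def by simp
      ultimately show ?thesis by metis
    qed
  qed
  obtain k where k1: "k \<in> hom (presented_group UNIV gt_relations) ?H"
    and k2: "\<And>w. w \<in> gwords UNIV \<Longrightarrow> k (gt_cls w) = wval ?H k0 w"
    using H.von_dyck[OF k0 k0R] by blast
  have k: "k \<in> hom gt_group ?H" "k (gt_cls w) = wval ?H k0 w" for w
    using k1 k2[of w] by (simp_all add: gt_group_def)
  have kt: "k (gt_elem Gs) = t"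
    using k(2)[of "[(Gs, True)]"] tc by (simp add: gt_elem_def gletter_def k0_def)
  have kemb: "k (img_emb g) = kappa g" if g: "g \<in> carrier img_group" for g
  proof -
    obtain w where w: "g = ev w" using g by (auto simp: carrier_img_group_ev)
    show ?thesis using k(2)[of "gw w"] k0w[of "gw w"] strip_gw[of w] by (simp add: w img_emb_ev)
  qed
  have "h \<in> iso ?H gt_group"
  proof (rule iso_of_inverse_homs[OF h(1) k(1)])
    show "k (h x) = x" if "x \<in> carrier ?H" for x
    proof (rule hom_presented_group_id[OF P.is_group h(1) k(1) _ that])
      fix y assume "y \<in> ?S"
      then show "k (h (pres_class ?S ?R (gletter y))) = pres_class ?S ?R (gletter y)"
        using hk kemb ht kt by (auto simp: hnn_gens_def kappa_def t_def)
    qed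
    show "h (k y) = y" if y: "y \<in> carrier gt_group" for y
    proof (rule hom_presented_group_id[OF H.is_group k1 h(1)[unfolded gt_group_def] _ y[unfolded gt_group_def]])
      fix x :: gen
      have "h (k (gt_elem x)) = gt_elem x"
      proof (cases "x = Gs")
        case True then show ?thesis using kt ht by simp
      next
        case False
        have "\<exists>l. x = gl l" using False by (cases x) (metis gl.simps)+
        then obtain l where "gt_elem x = img_emb (lact l)"
          using img_emb_ev[of "[l]" for l] by (auto simp: gt_elem_def gletter_def)
        then show ?thesis using hk[OF k0l(2)[of l]] kemb[OF k0l(2)[of l]] by simp
      qed
      then show "h (k (gt_cls (gletter x))) = gt_cls (gletter x)" by (simp add: gt_elem_def)
    qed
  qed
  then show ?thesis
    unfolding ascending_HNN_extension_def hnn_group_def hnn_elem_def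
    using img_theta_hom inj_on_img_theta hk[unfolded kappa_def] ht[unfolded t_def]
    by (intro conjI bexI[of _ h] ballI)
qed

section \<open>Growth and amenability of the finitely presented group\<close>

text \<open>Only nonnegative powers of s occur. These elements do not exhaust the group, but left
  multiplication by the four generators preserves them, and they contain both the free semigroup and
  the Folner sets.\<close>

definition nf :: "nat \<Rightarrow> (vertex \<Rightarrow> vertex) \<Rightarrow> gen gword set" where
  "nf k g = gt_cls (replicate k (Gs, True) @ gw (word_of g))"

lemma nf_ev: "nf k (ev w) = gt_cls (replicate k (Gs, True) @ gw w)"
  using leq_iff[of "word_of (ev w)" w] ev_word_of[of w]
  by (auto simp: nf_def gt_cls_eq_iff leq_def intro: gteq_append)

lemma nf_eq_iff: "nf j (ev u) = nf k (ev v) \<longleftrightarrow> j = k \<and> ev u = ev v"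
proof
  assume "nf j (ev u) = nf k (ev v)"
  then have "gteq (replicate j (Gs, True) @ gw u) (replicate k (Gs, True) @ gw v)"
    by (simp only: nf_ev gt_cls_eq_iff)
  then show "j = k \<and> ev u = ev v" using gteq_normal_form by blast
qed simp

lemma gteq_move_s: "gteq (gw u @ [(Gs, True)]) ([(Gs, True)] @ gw (subst u))"
proof -
  have "gteq ([] @ gw u @ [(Gs, True)]) ([(Gs, True), (Gs, False)] @ gw u @ [(Gs, True)])"
    by (intro gteq_append gteq_refl gteq_sym[OF gteq_cancel'(2)])
  also have "gteq ([(Gs, True), (Gs, False)] @ gw u @ [(Gs, True)]) ([(Gs, True)] @ gw (subst u))"
    using gteq_append[OF gteq_refl[of "[(Gs, True)]"] conj_subst[of u]] by simp
  finally show ?thesis by simp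
qed

lemma gteq_move_s_pow:
  "gteq (gw u @ replicate k (Gs, True)) (replicate k (Gs, True) @ gw ((subst ^^ k) u))"
proof (induction k)
  case (Suc k)
  let ?s = "replicate k (Gs, True)"
  have "gteq ((gw u @ ?s) @ [(Gs, True)]) ((?s @ gw ((subst ^^ k) u)) @ [(Gs, True)])"
    by (intro gteq_append gteq_refl Suc)
  also have "(?s @ gw ((subst ^^ k) u)) @ [(Gs, True)] = ?s @ (gw ((subst ^^ k) u) @ [(Gs, True)])" by simp
  also have "gteq \<dots> (?s @ [(Gs, True)] @ gw (subst ((subst ^^ k) u)))"
    by (intro gteq_append gteq_refl gteq_move_s)
  finally show ?case by (simp add: replicate_append_same[symmetric] del: replicate_append_same)
qed simp

lemma nf_left_mult: "gt_cls (gw u) \<otimes>\<^bsub>gt_group\<^esub> nf k (ev v) = nf k (ev ((subst ^^ k) u @ v))"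
proof -
  have "gteq ((gw u @ replicate k (Gs, True)) @ gw v) ((replicate k (Gs, True) @ gw ((subst ^^ k) u)) @ gw v)"
    by (intro gteq_append gteq_refl gteq_move_s_pow)
  then show ?thesis by (simp add: nf_ev mult_gt_group gt_cls_eq_iff del: ev_append)
qed

lemma nf_s_left_mult: "gt_elem Gs \<otimes>\<^bsub>gt_group\<^esub> nf k (ev v) = nf (Suc k) (ev v)"
  by (simp add: nf_ev gt_elem_def gletter_def mult_gt_group)

lemma nf_carrier: "nf k g \<in> carrier gt_group"
  by (simp add: nf_def carrier_gt_group)

lemma generate_gt_group: "generate gt_group (range gt_elem) = carrier gt_group"
proof
  interpret P: group gt_group by (rule group_gt_group)
  have sub: "range gt_elem \<subseteq> carrier gt_group" by (auto simp: gt_elem_def carrier_gt_group)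
  show "generate gt_group (range gt_elem) \<subseteq> carrier gt_group"
    by (rule P.generate_incl[OF sub])
  show "carrier gt_group \<subseteq> generate gt_group (range gt_elem)"
  proof
    fix x assume "x \<in> carrier gt_group"
    then obtain w where "x = gt_cls w" by (auto simp: carrier_gt_group)
    then have "x = wval gt_group gt_elem w" by (simp add: wval_gt_elem)
    moreover have "wval gt_group gt_elem w \<in> generate gt_group (range gt_elem)"
    proof (induction w)
      case (Cons y w)
      then show ?case
        by (cases y) (auto intro!: generate.eng intro: generate.incl generate.inv)
    qed (simp add: generate.one)
    ultimately show "x \<in> generate gt_group (range gt_elem)" by simp
  qed
qed

lemma UNIV_gen: "UNIV = {Ga, Gb, Gc, Gs}"
  using gen.exhaust by blast

lemma range_gt_elem: "range gt_elem = {gt_elem Ga, gt_elem Gb, gt_elem Gc, gt_elem Gs}"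
  by (simp add: UNIV_gen)

lemma exponential_growth_gt_group: "exponential_growth gt_group"
proof -
  interpret P: group gt_group by (rule group_gt_group)
  let ?x = "gt_elem Gs" and ?y = "gt_elem Gs \<otimes>\<^bsub>gt_group\<^esub> gt_elem Ga"
  have elem: "gt_elem x \<in> carrier gt_group" for x by (simp add: gt_elem_def carrier_gt_group)
  define T where "T = rec_list [] (\<lambda>b l r. subst r @ (if b then [LA] else []))"
  have T: "T [] = []" "T (b # l) = subst (T l) @ (if b then [LA] else [])" for b l
    by (simp_all add: T_def)
  have form: "P.semigroup_word ?x ?y l = nf (length l) (ev (T l))" for l
  proof (induction l)
    case Nil
    then show ?case by (simp add: T nf_ev one_gt_group del: ev.simps)
  next
    case (Cons b l)
    let ?s = "replicate (length l) (Gs, True)" and ?a = "gw (if b then [LA] else [])"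
    have "(if b then ?y else ?x) = gt_cls ([(Gs, True)] @ ?a)"
      by (simp add: gt_elem_def gletter_def mult_gt_group)
    then have "P.semigroup_word ?x ?y (b # l) = gt_cls ((?s @ gw (T l)) @ [(Gs, True)] @ ?a)"
      using Cons by (simp only: P.semigroup_word.simps nf_ev mult_gt_group)
    moreover have "gteq (?s @ (gw (T l) @ [(Gs, True)]) @ ?a) (?s @ ([(Gs, True)] @ gw (subst (T l))) @ ?a)"
      by (intro gteq_append gteq_refl gteq_move_s)
    moreover have "?s @ ([(Gs, True)] @ gw (subst (T l))) @ ?a = replicate (length (b # l)) (Gs, True) @ gw (T (b # l))"
      by (simp add: T replicate_app_Cons_same)
    ultimately show ?case by (simp add: nf_ev gt_cls_eq_iff)
  qed
  have "l = l'" if "length l = length l'" "ev (T l) = ev (T l')" for l l'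
    using that
  proof (induction l l' rule: list_induct2)
    case (Cons b l b' l')
    \<comment> \<open>The last factor is read off on the first level: theta(G) acts trivially there
      and a does not. Cancelling a and using injectivity of theta leads to the shorter
      words.\<close>
    have "flips (T (b # l)) = flips (T (b' # l'))"
      using Cons.prems ev_Cons[of _ False "[]"] by (metis list.inject)
    then have b: "b = b'" by (auto simp: T split: if_splits)
    have "ev (subst (T l)) = ev (subst (T l'))"
    proof (cases b)
      case True
      have "ev [LA] (ev (subst (T l)) v) = ev [LA] (ev (subst (T l')) v)" for v
        using Cons.prems True b by (simp add: T ev_append fun_eq_iff)
      then have "ev [LA] (ev [LA] (ev (subst (T l)) v)) = ev [LA] (ev [LA] (ev (subst (T l')) v))" for v
        by (rule arg_cong)
      then show ?thesis by (simp add: fun_eq_iff)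
    next
      case False then show ?thesis using Cons.prems b by (simp add: T)
    qed
    then show ?case using Cons.IH b by (simp add: ev_subst_cong)
  qed simp
  then have "inj_on (P.semigroup_word ?x ?y) {l. length l = n}" for n
    by (auto simp: inj_on_def form nf_eq_iff)
  moreover have "finite_generating_set gt_group (range gt_elem)"
    using elem generate_gt_group by (auto simp: finite_generating_set_def range_gt_elem)
  ultimately show ?thesis using elem
    by (intro P.exponential_growth_of_free_semigroup[of "range gt_elem" ?x ?y]) auto
qed

lemma amenable_gt_group: "amenable gt_group"
proof -
  interpret P: group gt_group by (rule group_gt_group)
  show ?thesis
  proof (rule P.amenable_of_folner)
    show "range gt_elem \<subseteq> carrier gt_group" by (auto simp: gt_elem_def carrier_gt_group)
    show "generate gt_group (range gt_elem) = carrier gt_group" by (rule generate_gt_group)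
    fix e :: real assume e: "e > 0"
    obtain m :: nat where m: "1 / e < real m" using reals_Archimedean2 by blast
    have "0 < 1 / e" using e by simp
    then have m0: "real m > 0" using m by linarith
    have m1: "1 \<le> e * real m" using m e by (simp add: field_simps)
    \<comment> \<open>The order of choices matters: \<open>m\<close> makes the top layer, the only
      one pushed out by s, small; \<open>K\<close> bounds the weights of all theta^k(x) with k < m;
      the radius \<open>n\<close> depends on both.\<close>
    define K where "K = (\<Sum>k<m. \<Sum>x\<in>UNIV. wt ((subst ^^ k) [x]))"
    have K: "wt ((subst ^^ k) [x]) \<le> K" if "k < m" for k x
    proof -
      have "wt ((subst ^^ k) [x]) \<le> (\<Sum>x\<in>UNIV. wt ((subst ^^ k) [x]))"
        by (rule member_le_sum) (auto simp: finite_letters)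
      also have "\<dots> \<le> K" unfolding K_def
        by (rule member_le_sum[of k "{..<m}" "\<lambda>k. \<Sum>x\<in>UNIV. wt ((subst ^^ k) [x])"]) (use that in auto)
      finally show ?thesis .
    qed
    obtain n where n: "real (card (evset wt (n + K))) \<le> (1 + e) * real (card (evset wt n))"
      using folner_evset[OF e] by blast
    define A where "A = (\<lambda>(k, g). nf k g) ` ({..<m} \<times> evset wt n)"
    have inj: "inj_on (\<lambda>(k, g). nf k g) (UNIV \<times> range ev)"
      by (auto simp: inj_on_def nf_eq_iff)
    have ev: "evset wt i \<subseteq> range ev" for i by (auto simp: evset_def)
    have cardA: "card A = m * card (evset wt n)"
    proof -
      have "inj_on (\<lambda>(k, g). nf k g) ({..<m} \<times> evset wt n)"
        by (rule inj_on_subset[OF inj]) (use ev in auto)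
      then show ?thesis unfolding A_def by (simp add: card_image card_cartesian_product)
    qed
    have letter: "real (card ((gt_cls (gw [x]) <#\<^bsub>gt_group\<^esub> A) - A)) \<le> e * real (card A)" for x
    proof -
      let ?D = "evset wt (n + K) - evset wt n"
      \<comment> \<open>A letter keeps the layer k and multiplies g by theta^k(x), so elements leave
        the set only through the shell between the radii n and n + K.\<close>
      have "(gt_cls (gw [x]) <#\<^bsub>gt_group\<^esub> A) - A \<subseteq> (\<lambda>(k, g). nf k g) ` ({..<m} \<times> ?D)"
      proof
        fix z assume z: "z \<in> (gt_cls (gw [x]) <#\<^bsub>gt_group\<^esub> A) - A"
        then obtain k w where kw: "k < m" "wt w \<le> n" "z = gt_cls (gw [x]) \<otimes>\<^bsub>gt_group\<^esub> nf k (ev w)"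
          by (auto simp: l_coset_def A_def evset_def)
        let ?v = "red ((subst ^^ k) [x] @ w)"
        have zv: "z = nf k (ev ?v)" using kw(3) by (simp only: nf_left_mult ev_red)
        have "wt ?v \<le> wt ((subst ^^ k) [x] @ w)"
          using wt_red_cc[of "(subst ^^ k) [x] @ w"] by linarith
        then have "wt ?v \<le> n + K" using kw(2) K[OF kw(1), of x] by simp
        then have "ev ?v \<in> evset wt (n + K)" unfolding evset_def using distinct_adj_red by blast
        moreover have "ev ?v \<notin> evset wt n" using z kw(1) zv by (auto simp: A_def)
        ultimately show "z \<in> (\<lambda>(k, g). nf k g) ` ({..<m} \<times> ?D)" using kw(1) zv by auto
      qed
      then have "card ((gt_cls (gw [x]) <#\<^bsub>gt_group\<^esub> A) - A) \<le> card ((\<lambda>(k, g). nf k g) ` ({..<m} \<times> ?D))"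
        by (intro card_mono) (auto simp: finite_evset)
      also have "\<dots> \<le> card ({..<m} \<times> ?D)" by (intro card_image_le) (auto simp: finite_evset)
      also have "\<dots> = m * card ?D" by (simp add: card_cartesian_product)
      finally have "real (card ((gt_cls (gw [x]) <#\<^bsub>gt_group\<^esub> A) - A)) \<le> real m * real (card ?D)"
        by (metis of_nat_le_iff of_nat_mult)
      moreover have "real (card ?D) \<le> e * real (card (evset wt n))"
      proof -
        have "card ?D = card (evset wt (n + K)) - card (evset wt n)"
          by (intro card_Diff_subset finite_evset evset_mono) simp
        moreover have "card (evset wt n) \<le> card (evset wt (n + K))"
          by (intro card_mono finite_evset evset_mono) simp
        ultimately show ?thesis using n by (simp add: of_nat_diff algebra_simps)
      qed
      then have "real m * real (card ?D) \<le> real m * (e * real (card (evset wt n)))"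
        by (intro mult_left_mono) auto
      ultimately show ?thesis by (simp add: cardA mult_ac)
    qed
    have s: "real (card ((gt_elem Gs <#\<^bsub>gt_group\<^esub> A) - A)) \<le> e * real (card A)"
    proof -
      have "(gt_elem Gs <#\<^bsub>gt_group\<^esub> A) - A \<subseteq> nf m ` evset wt n"
      proof
        fix z assume z: "z \<in> (gt_elem Gs <#\<^bsub>gt_group\<^esub> A) - A"
        then obtain k g where kg: "k < m" "g \<in> evset wt n" "z = gt_elem Gs \<otimes>\<^bsub>gt_group\<^esub> nf k g"
          by (auto simp: l_coset_def A_def)
        obtain w where w: "g = ev w" using kg(2) ev by blast
        have zs: "z = nf (Suc k) g" using kg(3) by (simp only: w nf_s_left_mult)
        have "\<not> Suc k < m"
        proof
          assume "Suc k < m"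
          then have "z \<in> A" using kg(2) zs by (auto simp: A_def)
          then show False using z by simp
        qed
        then have "Suc k = m" using kg(1) by simp
        then show "z \<in> nf m ` evset wt n" using zs kg(2) by auto
      qed
      then have "card ((gt_elem Gs <#\<^bsub>gt_group\<^esub> A) - A) \<le> card (nf m ` evset wt n)"
        by (intro card_mono) (auto simp: finite_evset)
      also have "\<dots> \<le> card (evset wt n)" by (intro card_image_le finite_evset)
      finally have "real (card ((gt_elem Gs <#\<^bsub>gt_group\<^esub> A) - A)) \<le> 1 * real (card (evset wt n))" by simp
      also have "\<dots> \<le> (e * real m) * real (card (evset wt n))" using m1 by (intro mult_right_mono) auto
      finally show ?thesis by (simp add: cardA mult_ac)
    qed
    have gens: "gt_elem Ga = gt_cls (gw [LA])" "gt_elem Gb = gt_cls (gw [LB])" "gt_elem Gc = gt_cls (gw [LC])"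
      by (simp_all add: gt_elem_def gletter_def)
    have "finite A" by (auto simp: A_def finite_evset)
    moreover have "card A > 0" using cardA card_evset_pos[of n] m0 by simp
    then have "A \<noteq> {}" by auto
    moreover have "A \<subseteq> carrier gt_group" by (auto simp: A_def nf_carrier)
    moreover have "\<forall>x\<in>range gt_elem. real (card ((x <#\<^bsub>gt_group\<^esub> A) - A)) \<le> e * real (card A)"
      unfolding range_gt_elem using letter s by (simp add: gens del: gw_simps)
    ultimately show "\<exists>A. finite A \<and> A \<noteq> {} \<and> A \<subseteq> carrier gt_group \<and>
        (\<forall>x\<in>range gt_elem. real (card ((x <#\<^bsub>gt_group\<^esub> A) - A)) \<le> e * real (card A))" by blast
  qed
qed

lemma finitely_presented_gt_group: "finitely_presented gt_group"
proof -
  define code :: "gen \<Rightarrow> nat" where "code = case_gen 0 1 2 3"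
  have "inj_on code UNIV"
    by (rule injI) (auto simp: code_def split: gen.splits)
  moreover have "finite gt_relations"
    by (simp add: gt_relations_def gt_relators_def Let_def)
  moreover have "finite (UNIV :: gen set)"
    by (simp add: UNIV_gen)
  ultimately show ?thesis
    unfolding gt_group_def by (intro finitely_presented_presented_group[of code]) auto
qed

theorem corollary3p7:
  shows "finitely_presented gt_group \<and>
    (\<exists>\<iota> \<in> hom img_group gt_group. \<exists>\<theta>.
       inj_on \<iota> (carrier img_group) \<and>
       \<iota> img_a = gt_elem Ga \<and> \<iota> img_b = gt_elem Gb \<and> \<iota> img_c = gt_elem Gc \<and>
       \<theta> img_a = img_b \<and> \<theta> img_b = img_c \<and>
       \<theta> img_c = img_a \<otimes>\<^bsub>img_group\<^esub> img_b \<otimes>\<^bsub>img_group\<^esub> img_a \<and>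
       ascending_HNN_extension gt_group img_group \<theta> \<iota> (gt_elem Gs)) \<and>
    amenable gt_group \<and>
    exponential_growth gt_group"
proof (intro conjI bexI[of _ img_emb] exI[of _ img_theta])
  have theta: "img_theta img_a = img_b" "img_theta img_b = img_c" "img_theta img_c = ev [LA, LB, LA]"
    unfolding img_gens img_theta_ev by simp_all
  then show "img_theta img_a = img_b" "img_theta img_b = img_c" by simp_all
  show "img_theta img_c = img_a \<otimes>\<^bsub>img_group\<^esub> img_b \<otimes>\<^bsub>img_group\<^esub> img_a"
    using theta(3) by (simp add: mult_img_group o_assoc)
qed (fact finitely_presented_gt_group amenable_gt_group exponential_growth_gt_group img_emb_hom
    inj_on_img_emb img_emb_gens ascending_HNN_gt_group)+

end
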